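(* Let $u,w\in\mathcal{D}(E)$ be such that $T=M_wEM_u$ is a bounded operator on $L^2(\Sigma)$, and let $\widehat{T}$ be its Aluthge transformation. Then: (a) $\widehat{T}$ is normaloid. (b) $T$ is normaloid if and only if $$\|E(uw)\|_\infty=\|(E(|u|^2))^{\frac12}(E(|w|^2))^{\frac12}\|_\infty.$$
   Context: $(X,\Sigma,\mu)$ is a complete $\sigma$-finite measure space and $\mathcal{A}\subseteq\Sigma$ is a $\sigma$-subalgebra such that $\mu|_{\mathcal{A}}$ is $\sigma$-finite. $L^2(\Sigma)=L^2(X,\Sigma,\mu)$ (complex-valued functions). $L^0(\Sigma)$ (resp. $L^0(\mathcal{A})$) denotes the a.e. finite valued $\Sigma$-measurable (resp. $\mathcal{A}$-measurable) functions modulo null sets. $\|\cdot\|_\infty$ is the essential supremum norm. $E=E^{\mathcal{A}}$ is the conditional expectation: for $f\ge 0$ measurable or $f\in L^2(\Sigma)$, $E(f)$ is the unique $\mathcal{A}$-measurable function with $\int_A f\,d\mu=\int_A E(f)\,d\mu$ for all $A\in\mathcal{A}$ (for which the integrals are defined). $\mathcal{D}(E)=\{g\in L^0(\Sigma): E(|g|)\in L^0(\mathcal{A})\}$, on which $E$ is defined by linearity. $M_wEM_u$ is the operator $f\mapsto wE(uf)$. For a bounded operator $T$ on a Hilbert space, $|T|=(T^*T)^{1/2}$ and $T=U|T|$ is the polar decomposition with $U$ the partial isometry satisfying $\mathcal{N}(U)=\mathcal{N}(|T|)$ (kernels). The Aluthge transformation of $T$ is $\widehat{T}=|T|^{1/2}U|T|^{1/2}$.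 $T$ is normaloid if $\|T\|^n=\|T^n\|$ for all $n\in\mathbb{N}$. *)

theory Defs
  imports "HOL-Probability.Probability"
begin

section \<open>Operators on a complex Hilbert space\<close>

text \<open>
  A Hilbert space is given by an explicit carrier, because the underlying set of \<open>L\<^sup>2\<close> depends on
  the measure, which is a term.  The inner product is linear in its first argument.  An operator is
  a function that is \<^const>\<open>undefined\<close> outside the carrier, so that operators which agree on
  the carrier are equal and the descriptions below determine at most one object.
\<close>

record 'v inner_space =
  space_carrier :: "'v set"
  space_zero :: 'v
  space_add :: "'v \<Rightarrow> 'v \<Rightarrow> 'v"
  space_scale :: "complex \<Rightarrow> 'v \<Rightarrow> 'v"
  space_inner :: "'v \<Rightarrow> 'v \<Rightarrow> complex"

definition space_norm :: "'v inner_space \<Rightarrow> 'v \<Rightarrow> real" where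
  "space_norm H x = sqrt (Re (space_inner H x x))"

definition bounded_op :: "'v inner_space \<Rightarrow> ('v \<Rightarrow> 'v) \<Rightarrow> bool" where
  "bounded_op H T \<longleftrightarrow>
     T \<in> space_carrier H \<rightarrow>\<^sub>E space_carrier H \<and>
     (\<forall>x\<in>space_carrier H. \<forall>y\<in>space_carrier H.
        T (space_add H x y) = space_add H (T x) (T y)) \<and>
     (\<forall>c. \<forall>x\<in>space_carrier H. T (space_scale H c x) = space_scale H c (T x)) \<and>
     (\<exists>K. \<forall>x\<in>space_carrier H. space_norm H (T x) \<le> K * space_norm H x)"

definition op_norm :: "'v inner_space \<Rightarrow> ('v \<Rightarrow> 'v) \<Rightarrow> real" where
  "op_norm H T = (SUP x\<in>{x \<in> space_carrier H. space_norm H x \<le> 1}. space_norm H (T x))"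

definition op_comp :: "'v inner_space \<Rightarrow> ('v \<Rightarrow> 'v) \<Rightarrow> ('v \<Rightarrow> 'v) \<Rightarrow> ('v \<Rightarrow> 'v)" where
  "op_comp H S T = compose (space_carrier H) S T"

definition op_kernel :: "'v inner_space \<Rightarrow> ('v \<Rightarrow> 'v) \<Rightarrow> 'v set" where
  "op_kernel H T = {x \<in> space_carrier H. T x = space_zero H}"

definition op_adjoint :: "'v inner_space \<Rightarrow> ('v \<Rightarrow> 'v) \<Rightarrow> ('v \<Rightarrow> 'v)" where
  "op_adjoint H T = (THE S. bounded_op H S \<and>
     (\<forall>x\<in>space_carrier H. \<forall>y\<in>space_carrier H. space_inner H (T x) y = space_inner H x (S y)))"

definition positive_op :: "'v inner_space \<Rightarrow> ('v \<Rightarrow> 'v) \<Rightarrow> bool" where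
  "positive_op H T \<longleftrightarrow>
     bounded_op H T \<and> (\<forall>x\<in>space_carrier H. space_inner H (T x) x \<in> \<real>\<^sub>\<ge>\<^sub>0)"

definition op_sqrt :: "'v inner_space \<Rightarrow> ('v \<Rightarrow> 'v) \<Rightarrow> ('v \<Rightarrow> 'v)" where
  "op_sqrt H P = (THE Q. positive_op H Q \<and> op_comp H Q Q = P)"

definition op_abs :: "'v inner_space \<Rightarrow> ('v \<Rightarrow> 'v) \<Rightarrow> ('v \<Rightarrow> 'v)" where
  "op_abs H T = op_sqrt H (op_comp H (op_adjoint H T) T)"

definition partial_isometry :: "'v inner_space \<Rightarrow> ('v \<Rightarrow> 'v) \<Rightarrow> bool" where
  "partial_isometry H U \<longleftrightarrow>
     bounded_op H U \<and>
     (\<forall>x\<in>space_carrier H.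
        (\<forall>y\<in>op_kernel H U. space_inner H x y = 0) \<longrightarrow> space_norm H (U x) = space_norm H x)"

definition polar_isometry :: "'v inner_space \<Rightarrow> ('v \<Rightarrow> 'v) \<Rightarrow> ('v \<Rightarrow> 'v)" where
  "polar_isometry H T = (THE U. partial_isometry H U \<and>
     T = op_comp H U (op_abs H T) \<and> op_kernel H U = op_kernel H (op_abs H T))"

definition aluthge :: "'v inner_space \<Rightarrow> ('v \<Rightarrow> 'v) \<Rightarrow> ('v \<Rightarrow> 'v)" where
  "aluthge H T =
     op_comp H (op_sqrt H (op_abs H T)) (op_comp H (polar_isometry H T) (op_sqrt H (op_abs H T)))"

text \<open>
  The exponent starts at \<open>1\<close>: on the zero space, where the identity has norm \<open>0\<close>, the
  equation fails for exponent \<open>0\<close>; on every other space it holds trivially there.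
\<close>

definition normaloid :: "'v inner_space \<Rightarrow> ('v \<Rightarrow> 'v) \<Rightarrow> bool" where
  "normaloid H T \<longleftrightarrow> (\<forall>n\<ge>1. op_norm H T ^ n = op_norm H (T ^^ n))"

section \<open>The space \<open>L\<^sup>2\<close> of a measure\<close>

definition l2_functions :: "'a measure \<Rightarrow> ('a \<Rightarrow> complex) set" where
  "l2_functions M = {f \<in> borel_measurable M. integrable M (\<lambda>x. (cmod (f x))\<^sup>2)}"

definition ae_class :: "'a measure \<Rightarrow> ('a \<Rightarrow> complex) \<Rightarrow> ('a \<Rightarrow> complex) set" where
  "ae_class M f = {g \<in> borel_measurable M. AE x in M. g x = f x}"

definition ae_rep :: "('a \<Rightarrow> complex) set \<Rightarrow> 'a \<Rightarrow> complex" where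
  "ae_rep X = (SOME f. f \<in> X)"

definition L2 :: "'a measure \<Rightarrow> ('a \<Rightarrow> complex) set inner_space" where
  "L2 M = \<lparr>
     space_carrier = ae_class M ` l2_functions M,
     space_zero = ae_class M (\<lambda>x. 0),
     space_add = (\<lambda>X Y. ae_class M (\<lambda>x. ae_rep X x + ae_rep Y x)),
     space_scale = (\<lambda>c X. ae_class M (\<lambda>x. c * ae_rep X x)),
     space_inner = (\<lambda>X Y. \<integral>x. ae_rep X x * cnj (ae_rep Y x) \<partial>M)\<rparr>"

section \<open>Conditional expectation and weighted conditional operators\<close>

definition cond_exp_domain :: "'a measure \<Rightarrow> 'a measure \<Rightarrow> ('a \<Rightarrow> complex) set" where
  "cond_exp_domain M F =
     {g \<in> borel_measurable M. AE x in M. nn_cond_exp M F (\<lambda>y. ennreal (cmod (g y))) x < \<infinity>}"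

text \<open>
  \<^const>\<open>real_cond_exp\<close> is the difference of the conditional expectations of the positive and
  the negative part, so it needs no integrability and is meaningful on all of \<open>cond_exp_domain\<close>.
\<close>

definition complex_cond_exp ::
  "'a measure \<Rightarrow> 'a measure \<Rightarrow> ('a \<Rightarrow> complex) \<Rightarrow> ('a \<Rightarrow> complex)" where
  "complex_cond_exp M F g = (\<lambda>x.
     Complex (real_cond_exp M F (\<lambda>y. Re (g y)) x) (real_cond_exp M F (\<lambda>y. Im (g y)) x))"

text \<open>The operator \<open>M\<^sub>w E M\<^sub>u\<close>, i.e. \<open>f \<mapsto> w E(u f)\<close>.\<close>

definition weighted_cond_op ::
  "'a measure \<Rightarrow> 'a measure \<Rightarrow> ('a \<Rightarrow> complex) \<Rightarrow> ('a \<Rightarrow> complex)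
     \<Rightarrow> ('a \<Rightarrow> complex) set \<Rightarrow> ('a \<Rightarrow> complex) set" where
  "weighted_cond_op M F w u = (\<lambda>X\<in>space_carrier (L2 M).
     ae_class M (\<lambda>x. w x * complex_cond_exp M F (\<lambda>y. u y * ae_rep X y) x))"

text \<open>
  Boundedness on \<open>L\<^sup>2\<close> includes that the operator is defined everywhere on \<open>L\<^sup>2\<close>: the
  product \<open>u f\<close> has a conditional expectation for every \<open>f\<close>.  That the values \<open>w E(u f)\<close>
  lie in \<open>L\<^sup>2\<close> is part of \<^const>\<open>bounded_op\<close>.
\<close>

definition bounded_weighted_cond_op ::
  "'a measure \<Rightarrow> 'a measure \<Rightarrow> ('a \<Rightarrow> complex) \<Rightarrow> ('a \<Rightarrow> complex) \<Rightarrow> bool" where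
  "bounded_weighted_cond_op M F w u \<longleftrightarrow>
     (\<forall>f\<in>l2_functions M. (\<lambda>x. u x * f x) \<in> cond_exp_domain M F) \<and>
     bounded_op (L2 M) (weighted_cond_op M F w u)"

text \<open>
  Conditional expectations of \<open>|u|\<^sup>2\<close> and \<open>|w|\<^sup>2\<close> may be infinite, hence a square root on
  \<^typ>\<open>ennreal\<close>.  Multiplication there has \<open>0 * \<infinity> = 0\<close>, the convention of measure theory.
\<close>

definition ennreal_sqrt :: "ennreal \<Rightarrow> ennreal" where
  "ennreal_sqrt t = (if t = \<infinity> then \<infinity> else ennreal (sqrt (enn2real t)))"

end

theory Submission
  imports Defs
begin

text \<open>
  Over the subalgebra, conditional expectation acts like an inner product \<open>E(cnj q * p)\<close> whose values
  are \<open>F\<close>-measurable functions, and \<open>f \<mapsto> w E(u f)\<close> is an operator of rank one for it.  This makes the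
  polar decomposition and the Aluthge transformation explicit.

  Boundedness of \<open>T = M\<^sub>w E M\<^sub>u\<close> forces \<open>E(|w|\<^sup>2) E(|u|\<^sup>2)\<close> to be essentially bounded.  Hence
  \<open>T\<close> lives on the set \<open>S\<close> where both moments are positive and finite, and after normalizing there
  \<open>T f = \<kappa> v E(cnj e * f)\<close> with \<open>E(|v|\<^sup>2) = E(|e|\<^sup>2) = 1\<close> on \<open>S\<close> and
  \<open>\<kappa> = (E(|u|\<^sup>2) E(|w|\<^sup>2))\<^sup>1\<^sup>/\<^sup>2\<close> (lemma \<open>weighted_cond_op_normal_form\<close>).

  The operators \<open>(k, p, q) : f \<mapsto> k p E(cnj q * f)\<close>, with bounded \<open>F\<close>-measurable \<open>k\<close> and with \<open>p\<close>, \<open>q\<close> of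
  length \<open>1\<close> over \<open>S\<close>, are closed under adjoints and products:
  \<open>(k, p, q) (l, r, s) = (k l E(cnj q * r), p, s)\<close>; their norm is the essential supremum of \<open>|k|\<close> over
  \<open>S\<close> (\<open>cond_op_comp\<close>, \<open>cond_op_adjoint\<close>, \<open>cond_op_norm_le_iff\<close>).  So \<open>T = (\<kappa>, v, e)\<close> has
  \<open>|T| = (\<kappa>, e, e)\<close> with the root \<open>(sqrt \<kappa>, e, e)\<close>, its partial isometry is \<open>U = (1, v, e)\<close>, and the
  Aluthge transformation is \<open>(\<kappa> c, e, e)\<close> with \<open>c = E(cnj e * v)\<close>, \<open>|c| \<le> 1\<close> (\<open>cond_op_aluthge\<close>).
  That the root and the polar isometry are indeed these operators follows from
  the uniqueness theorems \<open>positive_op_eq_of_squares_eq\<close> and \<open>polar_isometry_eqI\<close>.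

  Powers are now read off.  The powers of \<open>(\<kappa> c, e, e)\<close> have the weights \<open>(\<kappa> c)\<^sup>n\<close>, so the Aluthge
  transformation is normaloid.  The power \<open>n + 1\<close> of \<open>T\<close> has the weight \<open>\<kappa> (\<kappa> c)\<^sup>n\<close>, and as \<open>|c| \<le> 1\<close>
  these weights have norm \<open>\<parallel>\<kappa>\<parallel>\<^sup>n\<^sup>+\<^sup>1\<close> for all \<open>n\<close> exactly if \<open>\<kappa> c\<close> and \<open>\<kappa>\<close> have the same essential
  supremum (\<open>normaloid_cond_op_iff\<close>).  Since \<open>\<kappa> c = E(u w)\<close>, this is the criterion of the theorem.
\<close>

section \<open>Inner product spaces\<close>

text \<open>
  The last axiom stands for the vector space laws together with definiteness: vectors are determined
  by their inner products.  Every linear identity between vectors is thus checked by expanding inner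
  products, and for \<open>L\<^sup>2\<close> it suffices to test against the difference of two functions.
\<close>

locale pre_hilbert =
  fixes H :: "'v inner_space"
  assumes zero_closed: "space_zero H \<in> space_carrier H"
    and add_closed: "\<lbrakk>x \<in> space_carrier H; y \<in> space_carrier H\<rbrakk> \<Longrightarrow> space_add H x y \<in> space_carrier H"
    and scale_closed: "x \<in> space_carrier H \<Longrightarrow> space_scale H c x \<in> space_carrier H"
    and inner_zero_left: "x \<in> space_carrier H \<Longrightarrow> space_inner H (space_zero H) x = 0"
    and inner_add_left: "\<lbrakk>x \<in> space_carrier H; y \<in> space_carrier H; z \<in> space_carrier H\<rbrakk> \<Longrightarrow>
      space_inner H (space_add H x y) z = space_inner H x z + space_inner H y z"
    and inner_scale_left: "\<lbrakk>x \<in> space_carrier H; y \<in> space_carrier H\<rbrakk> \<Longrightarrow>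
      space_inner H (space_scale H c x) y = c * space_inner H x y"
    and inner_commute: "\<lbrakk>x \<in> space_carrier H; y \<in> space_carrier H\<rbrakk> \<Longrightarrow>
      space_inner H x y = cnj (space_inner H y x)"
    and inner_self_nonneg: "x \<in> space_carrier H \<Longrightarrow> 0 \<le> Re (space_inner H x x)"
    and inner_ext: "\<lbrakk>x \<in> space_carrier H; y \<in> space_carrier H;
      \<And>z. z \<in> space_carrier H \<Longrightarrow> space_inner H x z = space_inner H y z\<rbrakk> \<Longrightarrow> x = y"
begin

abbreviation carrier_set (\<open>\<C>\<close>) where "\<C> \<equiv> space_carrier H"
abbreviation add_op (infixl \<open>\<oplus>\<close> 65) where "x \<oplus> y \<equiv> space_add H x y"
abbreviation scale_op (infixr \<open>\<odot>\<close> 75) where "c \<odot> x \<equiv> space_scale H c x"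
abbreviation inner_op (\<open>\<langle>_, _\<rangle>\<close>) where "\<langle>x, y\<rangle> \<equiv> space_inner H x y"
abbreviation zero_op (\<open>\<zero>\<close>) where "\<zero> \<equiv> space_zero H"
abbreviation norm_op (\<open>\<parallel>_\<parallel>\<close>) where "\<parallel>x\<parallel> \<equiv> space_norm H x"

lemma inner_add_right:
  assumes "x \<in> \<C>" "y \<in> \<C>" "z \<in> \<C>"
  shows "\<langle>z, x \<oplus> y\<rangle> = \<langle>z, x\<rangle> + \<langle>z, y\<rangle>"
  using assms inner_commute[of z "x \<oplus> y"] inner_commute[of z x] inner_commute[of z y]
  by (simp add: add_closed inner_add_left)

lemma inner_scale_right:
  assumes "x \<in> \<C>" "z \<in> \<C>"
  shows "\<langle>z, c \<odot> x\<rangle> = cnj c * \<langle>z, x\<rangle>"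
  using assms inner_commute[of z "c \<odot> x"] inner_commute[of z x]
  by (simp add: scale_closed inner_scale_left)

lemma inner_zero_right: "x \<in> \<C> \<Longrightarrow> \<langle>x, \<zero>\<rangle> = 0"
  using inner_commute[of x \<zero>] by (simp add: zero_closed inner_zero_left)

lemmas space_closed = zero_closed add_closed scale_closed
lemmas inner_simps = inner_add_left inner_add_right inner_scale_left inner_scale_right
  inner_zero_left inner_zero_right

lemma inner_self_real: "x \<in> \<C> \<Longrightarrow> \<langle>x, x\<rangle> = of_real (Re \<langle>x, x\<rangle>)"
  using inner_commute[of x x] by (simp add: complex_eq_iff)

lemma norm_sq: "x \<in> \<C> \<Longrightarrow> \<parallel>x\<parallel>\<^sup>2 = Re \<langle>x, x\<rangle>"
  by (simp add: space_norm_def inner_self_nonneg)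

lemma norm_nonneg: "x \<in> \<C> \<Longrightarrow> 0 \<le> \<parallel>x\<parallel>"
  by (simp add: space_norm_def inner_self_nonneg)

lemma bounded_op_closed: "bounded_op H T \<Longrightarrow> x \<in> \<C> \<Longrightarrow> T x \<in> \<C>"
  by (auto simp: bounded_op_def)

lemma bounded_op_add: "bounded_op H T \<Longrightarrow> x \<in> \<C> \<Longrightarrow> y \<in> \<C> \<Longrightarrow> T (x \<oplus> y) = T x \<oplus> T y"
  by (auto simp: bounded_op_def)

lemma bounded_op_scale: "bounded_op H T \<Longrightarrow> x \<in> \<C> \<Longrightarrow> T (c \<odot> x) = c \<odot> T x"
  by (auto simp: bounded_op_def)

lemma bounded_op_bound:
  assumes "bounded_op H T"
  obtains K where "0 \<le> K" "\<And>x. x \<in> \<C> \<Longrightarrow> \<parallel>T x\<parallel> \<le> K * \<parallel>x\<parallel>"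
proof -
  obtain K where K: "\<And>x. x \<in> \<C> \<Longrightarrow> \<parallel>T x\<parallel> \<le> K * \<parallel>x\<parallel>"
    using assms unfolding bounded_op_def by blast
  show thesis
  proof (rule that[of "max K 0"])
    fix x assume x: "x \<in> \<C>"
    then have "K * \<parallel>x\<parallel> \<le> max K 0 * \<parallel>x\<parallel>"
      by (intro mult_right_mono) (auto simp: norm_nonneg)
    then show "\<parallel>T x\<parallel> \<le> max K 0 * \<parallel>x\<parallel>" using K[OF x] by linarith
  qed simp
qed

lemma bounded_op_ext:
  assumes "bounded_op H S" "bounded_op H T" "\<And>x. x \<in> \<C> \<Longrightarrow> S x = T x"
  shows "S = T"
  using assms by (auto simp: bounded_op_def intro!: PiE_ext[of S "\<C>" "\<lambda>_. \<C>" T])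

lemma positive_op_bounded: "positive_op H A \<Longrightarrow> bounded_op H A"
  by (simp add: positive_op_def)

lemma positive_op_nonneg: "positive_op H A \<Longrightarrow> x \<in> \<C> \<Longrightarrow> 0 \<le> Re \<langle>A x, x\<rangle>"
  by (auto simp: positive_op_def nonneg_Reals_def)

lemma positive_op_Im: "positive_op H A \<Longrightarrow> x \<in> \<C> \<Longrightarrow> Im \<langle>A x, x\<rangle> = 0"
  by (auto simp: positive_op_def nonneg_Reals_def)

text \<open>
  Over the complex numbers a real quadratic form has a Hermitian polarization: evaluate it at
  \<open>x + y\<close> and at \<open>x + \<i> y\<close>.
\<close>

lemma positive_op_symmetric:
  assumes A: "positive_op H A" and x: "x \<in> \<C>" and y: "y \<in> \<C>"
  shows "\<langle>A x, y\<rangle> = \<langle>x, A y\<rangle>"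
proof -
  note bA = positive_op_bounded[OF A]
  note cl = space_closed bounded_op_closed[OF bA] x y
  have 1: "Im \<langle>A (x \<oplus> y), x \<oplus> y\<rangle> = 0" and 2: "Im \<langle>A (x \<oplus> \<i> \<odot> y), x \<oplus> \<i> \<odot> y\<rangle> = 0"
    by (intro positive_op_Im[OF A] cl)+
  have 3: "Im \<langle>A x, x\<rangle> = 0" "Im \<langle>A y, y\<rangle> = 0" using positive_op_Im[OF A] x y by auto
  have "\<langle>A x, y\<rangle> = cnj \<langle>A y, x\<rangle>"
    using 1 2 3
    by (simp add: bounded_op_add[OF bA] bounded_op_scale[OF bA] cl inner_simps complex_eq_iff)
  then show ?thesis using inner_commute[of x "A y"] cl by simp
qed

text \<open>
  The form \<open>\<langle>A x, y\<rangle>\<close> is a semi-inner product; its quadratic form along the line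
  \<open>x - s \<langle>A x, y\<rangle> y\<close> is a nonnegative polynomial in the real number \<open>s\<close>.
  The identity operator gives the usual inequality.
\<close>

lemma positive_op_Cauchy_Schwarz:
  assumes A: "positive_op H A" and x: "x \<in> \<C>" and y: "y \<in> \<C>"
  shows "(cmod \<langle>A x, y\<rangle>)\<^sup>2 \<le> Re \<langle>A x, x\<rangle> * Re \<langle>A y, y\<rangle>"
proof -
  note bA = positive_op_bounded[OF A]
  note cl = space_closed bounded_op_closed[OF bA] x y
  define b where "b = \<langle>A x, y\<rangle>"
  have sym: "\<langle>A y, x\<rangle> = cnj b"
    using positive_op_symmetric[OF A y x] inner_commute[of "y" "A x"] cl by (simp add: b_def)
  have im: "Im \<langle>A x, x\<rangle> = 0" "Im \<langle>A y, y\<rangle> = 0" using positive_op_Im[OF A] x y by auto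
  have quad: "0 \<le> Re \<langle>A x, x\<rangle> - 2 * s * (cmod b)\<^sup>2 + s\<^sup>2 * (cmod b)\<^sup>2 * Re \<langle>A y, y\<rangle>" for s :: real
  proof -
    define t where "t = - of_real s * b"
    have "0 \<le> Re \<langle>A (x \<oplus> t \<odot> y), x \<oplus> t \<odot> y\<rangle>"
      by (intro positive_op_nonneg[OF A] cl)
    also have "\<langle>A (x \<oplus> t \<odot> y), x \<oplus> t \<odot> y\<rangle> =
        \<langle>A x, x\<rangle> + cnj t * b + t * cnj b + t * cnj t * \<langle>A y, y\<rangle>"
      by (simp add: bounded_op_add[OF bA] bounded_op_scale[OF bA] cl inner_simps sym
          b_def[symmetric] algebra_simps)
    also have "Re \<dots> = Re \<langle>A x, x\<rangle> - 2 * s * (cmod b)\<^sup>2 + s\<^sup>2 * (cmod b)\<^sup>2 * Re \<langle>A y, y\<rangle>"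
      unfolding cmod_power2 using im by (simp add: t_def algebra_simps power2_eq_square)
    finally show ?thesis .
  qed
  have y0: "0 \<le> Re \<langle>A y, y\<rangle>" and x0: "0 \<le> Re \<langle>A x, x\<rangle>" using positive_op_nonneg[OF A] x y by auto
  show ?thesis
  proof (cases "Re \<langle>A y, y\<rangle> = 0")
    case True
    have "cmod b = 0"
    proof (rule ccontr)
      assume "cmod b \<noteq> 0"
      then show False using quad[of "(Re \<langle>A x, x\<rangle> + 1) / (2 * (cmod b)\<^sup>2)"] True x0
        by (simp add: field_simps)
    qed
    then show ?thesis using x0 y0 by (simp add: b_def)
  next
    case False
    then have "0 < Re \<langle>A y, y\<rangle>" using y0 by simp
    then show ?thesis using quad[of "1 / Re \<langle>A y, y\<rangle>"]
      by (simp add: b_def[symmetric] field_simps power2_eq_square)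
  qed
qed

lemma positive_op_id: "positive_op H (\<lambda>x\<in>\<C>. x)"
proof -
  have "\<langle>x, x\<rangle> \<in> \<real>\<^sub>\<ge>\<^sub>0" if "x \<in> \<C>" for x
    using inner_self_real[OF that] inner_self_nonneg[OF that] nonneg_Reals_of_real_iff by metis
  moreover have "bounded_op H (\<lambda>x\<in>\<C>. x)"
    by (auto simp: bounded_op_def add_closed scale_closed intro!: exI[of _ 1])
  ultimately show ?thesis by (simp add: positive_op_def)
qed

lemma inner_Cauchy_Schwarz:
  assumes "x \<in> \<C>" "y \<in> \<C>"
  shows "cmod \<langle>x, y\<rangle> \<le> \<parallel>x\<parallel> * \<parallel>y\<parallel>"
proof (rule power2_le_imp_le)
  show "(cmod \<langle>x, y\<rangle>)\<^sup>2 \<le> (\<parallel>x\<parallel> * \<parallel>y\<parallel>)\<^sup>2"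
    using positive_op_Cauchy_Schwarz[OF positive_op_id assms] assms
    by (simp add: power_mult_distrib norm_sq)
qed (simp add: norm_nonneg assms)

lemma positive_op_form_bound:
  assumes "positive_op H A" "\<And>x. x \<in> \<C> \<Longrightarrow> \<parallel>A x\<parallel> \<le> K * \<parallel>x\<parallel>" "x \<in> \<C>"
  shows "Re \<langle>A x, x\<rangle> \<le> K * Re \<langle>x, x\<rangle>"
proof -
  note cl = bounded_op_closed[OF positive_op_bounded[OF assms(1)]] assms(3)
  have "Re \<langle>A x, x\<rangle> \<le> cmod \<langle>A x, x\<rangle>" by (rule complex_Re_le_cmod)
  also have "\<dots> \<le> \<parallel>A x\<parallel> * \<parallel>x\<parallel>" by (intro inner_Cauchy_Schwarz cl)
  also have "\<dots> \<le> K * \<parallel>x\<parallel> * \<parallel>x\<parallel>" by (intro mult_right_mono assms norm_nonneg)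
  also have "\<dots> = K * Re \<langle>x, x\<rangle>" using norm_sq[OF assms(3)] by (simp add: power2_eq_square)
  finally show ?thesis .
qed

lemma norm_diff_zero_imp_eq:
  assumes "x \<in> \<C>" "y \<in> \<C>" "\<parallel>x \<oplus> (-1) \<odot> y\<parallel> = 0"
  shows "x = y"
proof (rule inner_ext)
  fix z assume z: "z \<in> \<C>"
  have "cmod \<langle>x \<oplus> (-1) \<odot> y, z\<rangle> \<le> 0"
    using inner_Cauchy_Schwarz[of "x \<oplus> (-1) \<odot> y" z] assms z by (simp add: space_closed)
  then show "\<langle>x, z\<rangle> = \<langle>y, z\<rangle>" using assms z by (simp add: space_closed inner_simps)
qed (use assms in auto)

lemma norm_sq_diff:
  assumes "x \<in> \<C>" "y \<in> \<C>"
  shows "Re \<langle>x \<oplus> (-1) \<odot> y, x \<oplus> (-1) \<odot> y\<rangle> = Re \<langle>x, x\<rangle> - 2 * Re \<langle>x, y\<rangle> + Re \<langle>y, y\<rangle>"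
  using inner_commute[of y x] assms by (simp add: space_closed inner_simps)

lemma norm_diff_triangle:
  assumes "x \<in> \<C>" "y \<in> \<C>"
  shows "\<parallel>x \<oplus> (-1) \<odot> y\<parallel> \<le> \<parallel>x\<parallel> + \<parallel>y\<parallel>"
proof (rule power2_le_imp_le)
  have "- Re \<langle>x, y\<rangle> \<le> \<parallel>x\<parallel> * \<parallel>y\<parallel>"
    using inner_Cauchy_Schwarz[OF assms] abs_Re_le_cmod[of "\<langle>x, y\<rangle>"] by linarith
  then show "\<parallel>x \<oplus> (-1) \<odot> y\<parallel>\<^sup>2 \<le> (\<parallel>x\<parallel> + \<parallel>y\<parallel>)\<^sup>2"
    using norm_sq_diff[OF assms] assms
    by (simp add: norm_sq space_closed power2_sum)
qed (simp add: norm_nonneg assms)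

text \<open>
  The difference \<open>S x - T x\<close> equals \<open>S (x - X n) - T (x - X n)\<close>, which tends to \<open>0\<close>.
\<close>

lemma bounded_ops_agree_on_limit:
  assumes S: "bounded_op H S" and T: "bounded_op H T"
    and x: "x \<in> \<C>" and X: "\<And>n::nat. X n \<in> \<C>" "\<And>n. S (X n) = T (X n)"
    and lim: "(\<lambda>n. \<parallel>x \<oplus> (-1) \<odot> X n\<parallel>) \<longlonglongrightarrow> 0"
  shows "S x = T x"
proof -
  obtain K where K: "0 \<le> K" "\<And>x. x \<in> \<C> \<Longrightarrow> \<parallel>S x\<parallel> \<le> K * \<parallel>x\<parallel>" using bounded_op_bound[OF S] by blast
  obtain L where L: "0 \<le> L" "\<And>x. x \<in> \<C> \<Longrightarrow> \<parallel>T x\<parallel> \<le> L * \<parallel>x\<parallel>" using bounded_op_bound[OF T] by blast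
  note cl = space_closed bounded_op_closed[OF S] bounded_op_closed[OF T] x X(1)
  have est: "\<parallel>S x \<oplus> (-1) \<odot> T x\<parallel> \<le> (K + L) * \<parallel>x \<oplus> (-1) \<odot> X n\<parallel>" for n
  proof -
    let ?e = "x \<oplus> (-1) \<odot> X n"
    have "S x \<oplus> (-1) \<odot> T x = S ?e \<oplus> (-1) \<odot> T ?e"
      by (rule inner_ext) (simp_all add: cl inner_simps X(2) bounded_op_add[OF S]
        bounded_op_scale[OF S] bounded_op_add[OF T] bounded_op_scale[OF T])
    then have "\<parallel>S x \<oplus> (-1) \<odot> T x\<parallel> \<le> \<parallel>S ?e\<parallel> + \<parallel>T ?e\<parallel>"
      by (simp add: norm_diff_triangle cl)
    also have "\<dots> \<le> K * \<parallel>?e\<parallel> + L * \<parallel>?e\<parallel>" by (intro add_mono K(2) L(2) cl)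
    finally show ?thesis by (simp add: algebra_simps)
  qed
  have "(\<lambda>n. (K + L) * \<parallel>x \<oplus> (-1) \<odot> X n\<parallel>) \<longlonglongrightarrow> (K + L) * 0" by (intro tendsto_intros lim)
  then have "\<parallel>S x \<oplus> (-1) \<odot> T x\<parallel> \<le> (K + L) * 0"
    using est by (intro LIMSEQ_le_const) auto
  then have "\<parallel>S x \<oplus> (-1) \<odot> T x\<parallel> = 0"
    using norm_nonneg[of "S x \<oplus> (-1) \<odot> T x"] by (simp add: cl)
  then show ?thesis by (intro norm_diff_zero_imp_eq cl)
qed

lemma norm_scale:
  assumes "x \<in> \<C>"
  shows "\<parallel>c \<odot> x\<parallel> = cmod c * \<parallel>x\<parallel>"
proof -
  have "\<langle>c \<odot> x, c \<odot> x\<rangle> = (c * cnj c) * \<langle>x, x\<rangle>"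
    using assms by (simp add: inner_simps scale_closed)
  also have "\<dots> = of_real ((cmod c)\<^sup>2) * of_real (Re \<langle>x, x\<rangle>)"
    unfolding complex_norm_square using inner_self_real[OF assms] by simp
  finally have "\<langle>c \<odot> x, c \<odot> x\<rangle> = of_real ((cmod c)\<^sup>2 * Re \<langle>x, x\<rangle>)" by simp
  then show ?thesis by (simp add: space_norm_def real_sqrt_mult)
qed

lemma op_norm_upper:
  assumes T: "bounded_op H T" and y: "y \<in> \<C>" "\<parallel>y\<parallel> \<le> 1"
  shows "\<parallel>T y\<parallel> \<le> op_norm H T"
proof -
  obtain K where K: "0 \<le> K" "\<And>x. x \<in> \<C> \<Longrightarrow> \<parallel>T x\<parallel> \<le> K * \<parallel>x\<parallel>"
    using bounded_op_bound[OF T] by blast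
  have "bdd_above ((\<lambda>x. \<parallel>T x\<parallel>) ` {x \<in> \<C>. \<parallel>x\<parallel> \<le> 1})"
  proof (rule bdd_aboveI2)
    fix z assume z: "z \<in> {x \<in> \<C>. \<parallel>x\<parallel> \<le> 1}"
    then show "\<parallel>T z\<parallel> \<le> K * 1" using K(2)[of z] mult_left_mono[OF _ K(1), of "\<parallel>z\<parallel>" 1] by auto
  qed
  then show ?thesis unfolding op_norm_def by (rule cSUP_upper[rotated]) (use y in auto)
qed

text \<open>
  Operator norms are determined below by their upper bounds, because those of a conditional rank one
  operator have a description by an inequality that holds almost everywhere.
\<close>

lemma op_norm_le_iff:
  assumes T: "bounded_op H T" and t: "0 \<le> t"
  shows "op_norm H T \<le> t \<longleftrightarrow> (\<forall>x\<in>\<C>. \<parallel>T x\<parallel> \<le> t * \<parallel>x\<parallel>)"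
proof
  obtain K where K: "0 \<le> K" "\<And>x. x \<in> \<C> \<Longrightarrow> \<parallel>T x\<parallel> \<le> K * \<parallel>x\<parallel>"
    using bounded_op_bound[OF T] by blast
  assume le: "op_norm H T \<le> t"
  show "\<forall>x\<in>\<C>. \<parallel>T x\<parallel> \<le> t * \<parallel>x\<parallel>"
  proof
    fix x assume x: "x \<in> \<C>"
    show "\<parallel>T x\<parallel> \<le> t * \<parallel>x\<parallel>"
    proof (cases "\<parallel>x\<parallel> = 0")
      case True
      then show ?thesis using K(2)[OF x] by simp
    next
      case False
      then have pos: "0 < \<parallel>x\<parallel>" using norm_nonneg[OF x] by simp
      define y where "y = of_real (1 / \<parallel>x\<parallel>) \<odot> x"
      have y: "y \<in> \<C>" "\<parallel>y\<parallel> = 1" using pos x by (auto simp: y_def scale_closed norm_scale norm_divide)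
      have "\<parallel>T y\<parallel> \<le> op_norm H T" by (rule op_norm_upper[OF T]) (use y in auto)
      moreover have "\<parallel>T y\<parallel> = \<parallel>T x\<parallel> / \<parallel>x\<parallel>"
        using pos x by (simp add: y_def bounded_op_scale[OF T] norm_scale bounded_op_closed[OF T] norm_divide)
      ultimately have "\<parallel>T x\<parallel> / \<parallel>x\<parallel> \<le> t" using le by simp
      then show ?thesis using pos by (simp add: field_simps)
    qed
  qed
next
  assume bd: "\<forall>x\<in>\<C>. \<parallel>T x\<parallel> \<le> t * \<parallel>x\<parallel>"
  have "\<parallel>T x\<parallel> \<le> t" if "x \<in> \<C>" "\<parallel>x\<parallel> \<le> 1" for x
    using bd that mult_left_mono[OF that(2) t] by force
  moreover have "\<zero> \<in> {x \<in> \<C>. \<parallel>x\<parallel> \<le> 1}"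
    by (simp add: zero_closed space_norm_def inner_zero_left)
  ultimately show "op_norm H T \<le> t" unfolding op_norm_def by (intro cSUP_least) auto
qed

lemma op_norm_nonneg:
  assumes T: "bounded_op H T"
  shows "0 \<le> op_norm H T"
proof -
  have "\<parallel>T \<zero>\<parallel> \<le> op_norm H T"
    by (rule op_norm_upper[OF T]) (simp_all add: zero_closed space_norm_def inner_zero_left)
  then show ?thesis using norm_nonneg[OF bounded_op_closed[OF T zero_closed]] by linarith
qed

section \<open>Uniqueness of adjoint, square root and polar isometry\<close>

lemma adjoint_eqI:
  assumes S: "bounded_op H S"
    and adj: "\<And>x y. x \<in> \<C> \<Longrightarrow> y \<in> \<C> \<Longrightarrow> \<langle>T x, y\<rangle> = \<langle>x, S y\<rangle>"
  shows "op_adjoint H T = S"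
  unfolding op_adjoint_def
proof (rule the_equality)
  show "bounded_op H S \<and> (\<forall>x\<in>\<C>. \<forall>y\<in>\<C>. \<langle>T x, y\<rangle> = \<langle>x, S y\<rangle>)" using assms by blast
next
  fix R assume R: "bounded_op H R \<and> (\<forall>x\<in>\<C>. \<forall>y\<in>\<C>. \<langle>T x, y\<rangle> = \<langle>x, R y\<rangle>)"
  show "R = S"
  proof (rule bounded_op_ext)
    fix y assume y: "y \<in> \<C>"
    show "R y = S y"
    proof (rule inner_ext)
      fix z assume z: "z \<in> \<C>"
      have "\<langle>z, R y\<rangle> = \<langle>z, S y\<rangle>" using R adj[OF z y] y z by metis
      then show "\<langle>R y, z\<rangle> = \<langle>S y, z\<rangle>"
        using inner_commute[of "R y" z] inner_commute[of "S y" z] R S y z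
        by (simp add: bounded_op_closed)
    qed (use R S y in \<open>auto intro: bounded_op_closed\<close>)
  qed (use R S in auto)
qed

text \<open>
  Let \<open>A\<^sup>2 = B\<^sup>2\<close> and \<open>D = A - B\<close>.  Then \<open>D A = - B D\<close>, hence
  \<open>\<langle>A x, D\<^sup>2 x\<rangle> = - \<langle>B D x, D x\<rangle> \<le> 0\<close> for every \<open>x\<close>, and likewise with \<open>A\<close> and \<open>B\<close>
  exchanged.  If \<open>d = \<parallel>D\<parallel>\<^sup>2\<close> were positive, the self-adjoint operator \<open>D\<^sup>2\<close> would have
  approximate eigenvectors for \<open>d\<close>: vectors \<open>x\<close> with \<open>D\<^sup>2 x\<close> close to \<open>d x\<close>.  For these
  \<open>d \<langle>A x, x\<rangle>\<close> is at most a small multiple of \<open>\<parallel>x\<parallel>\<^sup>2\<close>; by the Cauchy-Schwarz inequality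
  of a positive form \<open>A x\<close> is small as well, and so is \<open>B x\<close>.  Thus \<open>D x\<close> is small, although
  \<open>\<parallel>D x\<parallel>\<^sup>2\<close> is close to \<open>d \<parallel>x\<parallel>\<^sup>2\<close>.
\<close>

lemma positive_op_eq_of_squares_eq:
  assumes A: "positive_op H A" and B: "positive_op H B"
    and sq: "\<And>x. x \<in> \<C> \<Longrightarrow> A (A x) = B (B x)"
  shows "A = B"
proof -
  note bA = positive_op_bounded[OF A] and bB = positive_op_bounded[OF B]
  note clA = bounded_op_closed[OF bA] and clB = bounded_op_closed[OF bB]
  define q where "q x = Re \<langle>x, x\<rangle>" for x
  define D where "D x = A x \<oplus> (-1) \<odot> B x" for x
  have clD: "D x \<in> \<C>" if "x \<in> \<C>" for x using that by (simp add: D_def clA clB space_closed)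
  note cl = space_closed clA clB clD
  have q0: "0 \<le> q x" if "x \<in> \<C>" for x using that by (simp add: q_def inner_self_nonneg)
  have symD: "\<langle>D x, y\<rangle> = \<langle>x, D y\<rangle>" if "x \<in> \<C>" "y \<in> \<C>" for x y
    using that positive_op_symmetric[OF A that] positive_op_symmetric[OF B that]
    by (simp add: D_def cl inner_simps)
  obtain KA where KA: "0 \<le> KA" "\<And>x. x \<in> \<C> \<Longrightarrow> \<parallel>A x\<parallel> \<le> KA * \<parallel>x\<parallel>"
    using bounded_op_bound[OF bA] by blast
  obtain KB where KB: "0 \<le> KB" "\<And>x. x \<in> \<C> \<Longrightarrow> \<parallel>B x\<parallel> \<le> KB * \<parallel>x\<parallel>"
    using bounded_op_bound[OF bB] by blast
  define K where "K = KA + KB"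
  have K0: "0 \<le> K" using KA(1) KB(1) by (simp add: K_def)
  have KA': "\<parallel>A x\<parallel> \<le> K * \<parallel>x\<parallel>" and KB': "\<parallel>B x\<parallel> \<le> K * \<parallel>x\<parallel>" and KD: "\<parallel>D x\<parallel> \<le> K * \<parallel>x\<parallel>"
    if x: "x \<in> \<C>" for x
  proof -
    have "0 \<le> KA * \<parallel>x\<parallel>" "0 \<le> KB * \<parallel>x\<parallel>" using KA(1) KB(1) norm_nonneg[OF x] by auto
    then show "\<parallel>A x\<parallel> \<le> K * \<parallel>x\<parallel>" "\<parallel>B x\<parallel> \<le> K * \<parallel>x\<parallel>"
      using KA(2)[OF x] KB(2)[OF x] by (simp_all add: K_def algebra_simps)
    show "\<parallel>D x\<parallel> \<le> K * \<parallel>x\<parallel>"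
      using norm_diff_triangle[of "A x" "B x"] KA(2)[OF x] KB(2)[OF x] x
      by (simp add: D_def K_def cl algebra_simps)
  qed
  have AD: "Re \<langle>A x, D (D x)\<rangle> \<le> 0" and BD: "Re \<langle>B x, D (D x)\<rangle> \<le> 0" if x: "x \<in> \<C>" for x
  proof -
    have "D (A x) = (-1) \<odot> B (D x)"
      by (rule inner_ext) (simp_all add: D_def[of x] D_def[of "A x"] sq x cl inner_simps
        bounded_op_add[OF bB] bounded_op_scale[OF bB])
    then have "\<langle>A x, D (D x)\<rangle> = - \<langle>B (D x), D x\<rangle>"
      using symD[of "A x" "D x"] x by (simp add: cl inner_simps)
    then show "Re \<langle>A x, D (D x)\<rangle> \<le> 0" using positive_op_nonneg[OF B clD[OF x]] by simp
    have "D (B x) = (-1) \<odot> A (D x)"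
      by (rule inner_ext) (simp_all add: D_def[of x] D_def[of "B x"] sq x cl inner_simps
        bounded_op_add[OF bA] bounded_op_scale[OF bA])
    then have "\<langle>B x, D (D x)\<rangle> = - \<langle>A (D x), D x\<rangle>"
      using symD[of "B x" "D x"] x by (simp add: cl inner_simps)
    then show "Re \<langle>B x, D (D x)\<rangle> \<le> 0" using positive_op_nonneg[OF A clD[OF x]] by simp
  qed
  \<comment> \<open>\<open>d\<close> is the square of the norm of \<open>D\<close>.\<close>
  define S where "S = {c. 0 \<le> c \<and> (\<forall>x\<in>\<C>. q (D x) \<le> c * q x)}"
  define d where "d = Inf S"
  have "K\<^sup>2 \<in> S"
  proof -
    have "q (D x) \<le> K\<^sup>2 * q x" if x: "x \<in> \<C>" for x
      using power_mono[OF KD[OF x] norm_nonneg[OF clD[OF x]], of 2] x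
      by (simp add: q_def norm_sq[symmetric] clD power_mult_distrib)
    then show ?thesis by (simp add: S_def)
  qed
  then have S_ne: "S \<noteq> {}" by auto
  have bdd: "bdd_below S" by (rule bdd_belowI[of _ 0]) (simp add: S_def)
  have d0: "0 \<le> d" unfolding d_def by (rule cInf_greatest[OF S_ne]) (simp add: S_def)
  have qD: "q (D x) \<le> d * q x" if x: "x \<in> \<C>" for x
  proof (cases "q x = 0")
    case True
    then show ?thesis using S_ne x by (auto simp: S_def)
  next
    case False
    then have qx: "0 < q x" using q0[OF x] by simp
    have "q (D x) / q x \<le> d" unfolding d_def
      by (rule cInf_greatest[OF S_ne]) (use x qx in \<open>auto simp: S_def field_simps\<close>)
    then show ?thesis using qx by (simp add: field_simps)
  qed
  have "d = 0"
  proof (rule ccontr)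
    assume "d \<noteq> 0"
    then have d: "0 < d" using d0 by simp
    have key: "d \<le> 2 * K * sqrt (sqrt (d * \<epsilon>)) + \<epsilon>" if e: "0 < \<epsilon>" "\<epsilon> < d" for \<epsilon>
    proof -
      have "d - \<epsilon> \<notin> S"
        using cInf_lower[OF _ bdd, of "d - \<epsilon>"] e by (auto simp: d_def)
      then obtain x where x: "x \<in> \<C>" and big: "(d - \<epsilon>) * q x < q (D x)"
        using e by (auto simp: S_def not_le)
      have qx: "0 < q x" using big qD[OF x] q0[OF x] by (cases "q x = 0") auto
      \<comment> \<open>\<open>y\<close> measures how far \<open>x\<close> is from being an eigenvector of \<open>D\<^sup>2\<close> for \<open>d\<close>.\<close>
      define y where "y = D (D x) \<oplus> (-1) \<odot> (of_real d \<odot> x)"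
      have y: "y \<in> \<C>" by (simp add: y_def cl x)
      have "q y = q (D (D x)) - 2 * (d * q (D x)) + d * d * q x"
        using norm_sq_diff[of "D (D x)" "of_real d \<odot> x"] symD[of "D x" x] x
        by (simp add: y_def q_def cl inner_simps)
      also have "\<dots> \<le> d * q (D x) - 2 * (d * q (D x)) + d * d * q x"
        using qD[OF clD[OF x]] by simp
      also have "\<dots> = d * (d * q x - q (D x))" by (simp add: algebra_simps)
      also have "\<dots> \<le> d * (\<epsilon> * q x)"
        using big d by (intro mult_left_mono) (auto simp: algebra_simps)
      finally have qy: "q y \<le> d * \<epsilon> * q x" by simp
      have small: "cmod \<langle>P x, D x\<rangle> \<le> K * sqrt (sqrt (d * \<epsilon>)) * q x"
        if P: "positive_op H P" and neg: "Re \<langle>P x, D (D x)\<rangle> \<le> 0"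
          and KP: "\<And>x. x \<in> \<C> \<Longrightarrow> \<parallel>P x\<parallel> \<le> K * \<parallel>x\<parallel>" for P
      proof (rule power2_le_imp_le)
        note clP = bounded_op_closed[OF positive_op_bounded[OF P]]
        have "d * Re \<langle>P x, x\<rangle> = Re \<langle>P x, D (D x)\<rangle> - Re \<langle>P x, y\<rangle>"
          by (simp add: y_def cl clP x inner_simps)
        also have "\<dots> \<le> cmod \<langle>P x, y\<rangle>" using neg abs_Re_le_cmod[of "\<langle>P x, y\<rangle>"] by linarith
        also have "\<dots> \<le> \<parallel>P x\<parallel> * \<parallel>y\<parallel>" by (intro inner_Cauchy_Schwarz clP x y)
        also have "\<dots> \<le> (K * \<parallel>x\<parallel>) * sqrt (d * \<epsilon> * q x)"
          using KP[OF x] qy y clP x by (intro mult_mono) (auto simp: q_def space_norm_def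
            intro!: mult_nonneg_nonneg K0 real_sqrt_ge_zero inner_self_nonneg)
        also have "\<dots> = K * sqrt (d * \<epsilon>) * q x"
          using qx by (simp add: space_norm_def q_def real_sqrt_mult)
        finally have Px: "Re \<langle>P x, x\<rangle> * d \<le> K * sqrt (d * \<epsilon>) * q x" by (simp add: mult.commute)
        have "Re \<langle>P (D x), D x\<rangle> \<le> K * q (D x)"
          using positive_op_form_bound[OF P KP clD[OF x]] by (simp add: q_def)
        then have PD: "Re \<langle>P (D x), D x\<rangle> \<le> d * (K * q x)"
          using mult_left_mono[OF qD[OF x] K0] by (simp add: algebra_simps)
        have "(cmod \<langle>P x, D x\<rangle>)\<^sup>2 \<le> Re \<langle>P x, x\<rangle> * Re \<langle>P (D x), D x\<rangle>"
          by (intro positive_op_Cauchy_Schwarz P x clD)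
        also have "\<dots> \<le> Re \<langle>P x, x\<rangle> * (d * (K * q x))"
          by (intro mult_left_mono PD positive_op_nonneg[OF P x])
        also have "\<dots> = (Re \<langle>P x, x\<rangle> * d) * (K * q x)" by simp
        also have "\<dots> \<le> (K * sqrt (d * \<epsilon>) * q x) * (K * q x)"
          using Px K0 qx by (intro mult_right_mono) auto
        also have "\<dots> = (K * sqrt (sqrt (d * \<epsilon>)) * q x)\<^sup>2"
          using d e by (simp add: power_mult_distrib power2_eq_square[of K] power2_eq_square[of "q x"])
        finally show "(cmod \<langle>P x, D x\<rangle>)\<^sup>2 \<le> (K * sqrt (sqrt (d * \<epsilon>)) * q x)\<^sup>2" .
        show "0 \<le> K * sqrt (sqrt (d * \<epsilon>)) * q x" using K0 d e qx by simp
      qed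
      have "q (D x) = Re \<langle>A x, D x\<rangle> - Re \<langle>B x, D x\<rangle>"
        unfolding q_def by (subst (1) D_def) (simp add: cl x inner_simps)
      also have "\<dots> \<le> cmod \<langle>A x, D x\<rangle> + cmod \<langle>B x, D x\<rangle>"
        using abs_Re_le_cmod[of "\<langle>A x, D x\<rangle>"] abs_Re_le_cmod[of "\<langle>B x, D x\<rangle>"] by linarith
      also have "\<dots> \<le> 2 * K * sqrt (sqrt (d * \<epsilon>)) * q x"
        using small[OF A AD[OF x] KA'] small[OF B BD[OF x] KB'] by simp
      finally have "(d - \<epsilon>) * q x \<le> 2 * K * sqrt (sqrt (d * \<epsilon>)) * q x" using big by simp
      then show ?thesis using qx by simp
    qed
    \<comment> \<open>The bound \<open>key\<close> is contradictory for small \<open>\<epsilon>\<close>.\<close>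
    have "((\<lambda>\<epsilon>. 2 * K * sqrt (sqrt (d * \<epsilon>)) + \<epsilon>) \<longlongrightarrow> 2 * K * sqrt (sqrt (d * 0)) + 0) (at_right 0)"
      by (intro tendsto_intros)
    moreover have "eventually (\<lambda>\<epsilon>. d \<le> 2 * K * sqrt (sqrt (d * \<epsilon>)) + \<epsilon>) (at_right 0)"
      using eventually_at_right_less[of "0::real"] eventually_at_right[of 0 d] d key
      by (auto simp: eventually_at_right intro!: exI[of _ d])
    ultimately have "d \<le> 2 * K * sqrt (sqrt (d * 0)) + 0"
      by (rule tendsto_lowerbound) simp
    then show False using d by simp
  qed
  show ?thesis
  proof (rule bounded_op_ext[OF bA bB])
    fix x assume x: "x \<in> \<C>"
    have "q (D x) = 0" using qD[OF x] q0[OF clD[OF x]] \<open>d = 0\<close> by simp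
    then show "A x = B x"
      by (intro norm_diff_zero_imp_eq) (simp_all add: x cl q_def D_def space_norm_def)
  qed
qed

lemma op_sqrt_eqI:
  assumes "positive_op H Q" "op_comp H Q Q = P"
  shows "op_sqrt H P = Q"
  unfolding op_sqrt_def
proof (rule the_equality)
  fix R assume R: "positive_op H R \<and> op_comp H R R = P"
  show "R = Q"
  proof (rule positive_op_eq_of_squares_eq)
    fix x assume "x \<in> \<C>"
    then show "R (R x) = Q (Q x)"
      using R assms(2) unfolding op_comp_def compose_def by (metis restrict_apply')
  qed (use R assms in auto)
qed (use assms in auto)

lemma op_kernel_iff_norm:
  assumes T: "bounded_op H T"
  shows "x \<in> op_kernel H T \<longleftrightarrow> x \<in> \<C> \<and> \<parallel>T x\<parallel> = 0"
proof -
  have "y = \<zero> \<longleftrightarrow> \<parallel>y\<parallel> = 0" if y: "y \<in> \<C>" for y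
  proof
    assume "\<parallel>y\<parallel> = 0"
    moreover have "y \<oplus> (-1) \<odot> \<zero> = y"
      by (rule inner_ext) (simp_all add: y space_closed inner_simps)
    ultimately show "y = \<zero>" using norm_diff_zero_imp_eq[OF y zero_closed] by simp
  qed (simp add: space_norm_def inner_zero_left zero_closed)
  then show ?thesis by (auto simp: op_kernel_def bounded_op_closed[OF T])
qed

text \<open>
  Here \<open>P\<close> is to be the orthogonal projection onto the closure of the range of \<open>|T|\<close>.  Any competitor
  \<open>V\<close> agrees with \<open>U\<close> on the range of \<open>|T|\<close>, because both \<open>V |T|\<close> and \<open>U |T|\<close> are \<open>T\<close>, hence also on the
  vectors \<open>P x\<close>; and both vanish on \<open>x - P x\<close>, which lies in the kernel of \<open>|T|\<close>.  The identity
  \<open>\<parallel>U x\<parallel>\<^sup>2 = \<langle>P x, x\<rangle>\<close> makes \<open>U\<close> isometric on vectors orthogonal to the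
  kernel, since for them \<open>\<langle>x, x - P x\<rangle> = 0\<close>.
\<close>

lemma polar_isometry_eqI:
  assumes A: "bounded_op H (op_abs H T)" and U: "bounded_op H U" and P: "bounded_op H P"
    and T: "T = op_comp H U (op_abs H T)" and ker: "op_kernel H U = op_kernel H (op_abs H T)"
    and AP: "\<And>x. x \<in> \<C> \<Longrightarrow> op_abs H T (P x) = op_abs H T x"
    and UU: "\<And>x. x \<in> \<C> \<Longrightarrow> \<parallel>U x\<parallel>\<^sup>2 = Re \<langle>P x, x\<rangle>"
    and dense: "\<And>x. x \<in> \<C> \<Longrightarrow> \<exists>Z. (\<forall>n::nat. Z n \<in> \<C>) \<and> (\<lambda>n. \<parallel>P x \<oplus> (-1) \<odot> op_abs H T (Z n)\<parallel>) \<longlonglongrightarrow> 0"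
  shows "polar_isometry H T = U"
proof -
  note cl = space_closed bounded_op_closed[OF A] bounded_op_closed[OF U] bounded_op_closed[OF P]
  have diff_ker: "x \<oplus> (-1) \<odot> P x \<in> op_kernel H (op_abs H T)" if x: "x \<in> \<C>" for x
  proof -
    have "op_abs H T (x \<oplus> (-1) \<odot> P x) = \<zero>"
      by (rule inner_ext)
        (simp_all add: x cl bounded_op_add[OF A] bounded_op_scale[OF A] AP inner_simps)
    then show ?thesis by (simp add: op_kernel_def x cl)
  qed
  show ?thesis
    unfolding polar_isometry_def
  proof (rule the_equality)
    have "partial_isometry H U"
      unfolding partial_isometry_def
    proof (intro conjI ballI impI U)
      fix x assume x: "x \<in> \<C>" and orth: "\<forall>y\<in>op_kernel H U. \<langle>x, y\<rangle> = 0"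
      have "\<langle>x, x \<oplus> (-1) \<odot> P x\<rangle> = 0" using orth diff_ker[OF x] ker by simp
      then have "\<langle>x, x\<rangle> = \<langle>x, P x\<rangle>" by (simp add: x cl inner_simps)
      then have "Re \<langle>x, x\<rangle> = Re \<langle>P x, x\<rangle>" using inner_commute[of x "P x"] x cl by simp
      then have "\<parallel>U x\<parallel>\<^sup>2 = \<parallel>x\<parallel>\<^sup>2" using UU[OF x] norm_sq[OF x] by simp
      then show "\<parallel>U x\<parallel> = \<parallel>x\<parallel>" by (simp add: x cl norm_nonneg)
    qed
    then show "partial_isometry H U \<and> T = op_comp H U (op_abs H T) \<and>
        op_kernel H U = op_kernel H (op_abs H T)" using T ker by simp
  next
    fix V assume V': "partial_isometry H V \<and> T = op_comp H V (op_abs H T) \<and>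
        op_kernel H V = op_kernel H (op_abs H T)"
    then have V: "bounded_op H V" by (simp add: partial_isometry_def)
    note cl = space_closed bounded_op_closed[OF A] bounded_op_closed[OF U] bounded_op_closed[OF P]
      bounded_op_closed[OF V]
    have comp: "V (op_abs H T z) = U (op_abs H T z)" if z: "z \<in> \<C>" for z
    proof -
      have "op_comp H V (op_abs H T) z = op_comp H U (op_abs H T) z" using T V' by metis
      then show ?thesis using z by (simp add: op_comp_def compose_def)
    qed
    show "V = U"
    proof (rule bounded_op_ext[OF V U])
      fix x assume x: "x \<in> \<C>"
      obtain Z where Z: "\<And>n::nat. Z n \<in> \<C>"
        and lim: "(\<lambda>n. \<parallel>P x \<oplus> (-1) \<odot> op_abs H T (Z n)\<parallel>) \<longlonglongrightarrow> 0" using dense[OF x] by blast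
      have VP: "V (P x) = U (P x)"
        by (rule bounded_ops_agree_on_limit[OF V U _ _ _ lim]) (simp_all add: Z x cl comp)
      let ?r = "x \<oplus> (-1) \<odot> P x"
      have "?r \<in> op_kernel H V" "?r \<in> op_kernel H U"
        using diff_ker[OF x] V' ker by auto
      then have Vr: "V ?r = \<zero>" and Ur: "U ?r = \<zero>" by (simp_all add: op_kernel_def)
      have dec: "x = P x \<oplus> ?r"
        by (rule inner_ext) (simp_all add: x cl inner_simps)
      have "V x = V (P x) \<oplus> V ?r"
        by (subst dec) (rule bounded_op_add[OF V]; simp add: x cl)
      also have "\<dots> = U (P x) \<oplus> U ?r" by (simp only: VP Vr Ur)
      also have "\<dots> = U x"
        by (subst (3) dec) (rule bounded_op_add[OF U, symmetric]; simp add: x cl)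
      finally show "V x = U x" .
    qed
  qed
qed

end

section \<open>Conditional expectation of nonnegative and complex functions\<close>

lemma borel_measurable_cnj [measurable (raw)]:
  assumes "f \<in> borel_measurable M"
  shows "(\<lambda>x. cnj (f x)) \<in> borel_measurable M"
  using assms by (rule measurable_compose[OF _ borel_measurable_continuous_onI])
    (intro continuous_intros)

context sigma_finite_subalgebra
begin

lemma borel_measurable_F_M: "f \<in> borel_measurable F \<Longrightarrow> f \<in> borel_measurable M"
  by (rule measurable_from_subalg[OF subalg])

lemma borel_measurable_complex_cond_exp [measurable]:
  "complex_cond_exp M F g \<in> borel_measurable F"
  unfolding complex_cond_exp_def Complex_eq by measurable

lemma borel_measurable_complex_cond_exp2 [measurable]:
  "complex_cond_exp M F g \<in> borel_measurable M"
  by (rule borel_measurable_F_M) measurable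

lemma cond_exp_domain_measurable: "g \<in> cond_exp_domain M F \<Longrightarrow> g \<in> borel_measurable M"
  by (simp add: cond_exp_domain_def)

lemma cond_exp_domain_mono:
  assumes "g \<in> cond_exp_domain M F" and [measurable]: "f \<in> borel_measurable M"
    and "AE x in M. cmod (f x) \<le> cmod (g x)"
  shows "f \<in> cond_exp_domain M F"
proof -
  have [measurable]: "g \<in> borel_measurable M" using assms(1) by (rule cond_exp_domain_measurable)
  have "AE x in M. nn_cond_exp M F (\<lambda>x. ennreal (cmod (f x))) x \<le>
      nn_cond_exp M F (\<lambda>x. ennreal (cmod (g x))) x"
    using assms(3) by (intro nn_cond_exp_mono) (auto intro: ennreal_leI)
  moreover have "AE x in M. nn_cond_exp M F (\<lambda>x. ennreal (cmod (g x))) x < \<infinity>"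
    using assms(1) by (simp add: cond_exp_domain_def)
  ultimately have "AE x in M. nn_cond_exp M F (\<lambda>x. ennreal (cmod (f x))) x < \<infinity>"
    by eventually_elim auto
  then show ?thesis by (simp add: cond_exp_domain_def)
qed

lemma cond_exp_domain_add_norm:
  assumes "f \<in> cond_exp_domain M F" "g \<in> cond_exp_domain M F"
  shows "(\<lambda>x. of_real (cmod (f x) + cmod (g x))) \<in> cond_exp_domain M F"
proof -
  note [measurable] = assms[THEN cond_exp_domain_measurable]
  have "AE x in M. nn_cond_exp M F (\<lambda>x. ennreal (cmod (f x))) x < \<infinity>"
    "AE x in M. nn_cond_exp M F (\<lambda>x. ennreal (cmod (g x))) x < \<infinity>"
    using assms by (auto simp: cond_exp_domain_def)
  moreover have "AE x in M. nn_cond_exp M F (\<lambda>x. ennreal (cmod (f x))) x +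
      nn_cond_exp M F (\<lambda>x. ennreal (cmod (g x))) x =
      nn_cond_exp M F (\<lambda>x. ennreal (cmod (f x)) + ennreal (cmod (g x))) x"
    by (rule nn_cond_exp_sum) auto
  ultimately have "AE x in M. nn_cond_exp M F (\<lambda>x. ennreal (cmod (f x)) + ennreal (cmod (g x))) x < \<infinity>"
    by eventually_elim (metis ennreal_add_less_top infinity_ennreal_def)
  moreover have "(\<lambda>x. ennreal (cmod (f x)) + ennreal (cmod (g x))) =
      (\<lambda>x. ennreal (cmod (of_real (cmod (f x) + cmod (g x)) :: complex)))"
    by (rule ext) (simp flip: of_real_add)
  ultimately show ?thesis by (simp add: cond_exp_domain_def)
qed

lemma cond_exp_domain_add:
  assumes "f \<in> cond_exp_domain M F" "g \<in> cond_exp_domain M F"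
  shows "(\<lambda>x. f x + g x) \<in> cond_exp_domain M F"
proof (rule cond_exp_domain_mono[OF cond_exp_domain_add_norm[OF assms]])
  note [measurable] = assms[THEN cond_exp_domain_measurable]
  show "(\<lambda>x. f x + g x) \<in> borel_measurable M" by measurable
  show "AE x in M. cmod (f x + g x) \<le> cmod (of_real (cmod (f x) + cmod (g x)))"
    by (simp flip: of_real_add add: norm_triangle_ineq)
qed

lemma cond_exp_domain_mult:
  assumes c [measurable]: "c \<in> borel_measurable F" and f: "f \<in> cond_exp_domain M F"
  shows "(\<lambda>x. c x * f x) \<in> cond_exp_domain M F"
proof -
  note [measurable] = cond_exp_domain_measurable[OF f] borel_measurable_F_M[OF c]
  have "AE x in M. ennreal (cmod (c x)) * nn_cond_exp M F (\<lambda>x. ennreal (cmod (f x))) x =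
      nn_cond_exp M F (\<lambda>x. ennreal (cmod (c x)) * ennreal (cmod (f x))) x"
    by (rule nn_cond_exp_prod) auto
  moreover have "AE x in M. nn_cond_exp M F (\<lambda>x. ennreal (cmod (f x))) x < \<infinity>"
    using f by (auto simp: cond_exp_domain_def)
  ultimately have "AE x in M. nn_cond_exp M F (\<lambda>x. ennreal (cmod (c x)) * ennreal (cmod (f x))) x < \<infinity>"
    by eventually_elim (metis ennreal_less_top ennreal_mult_less_top infinity_ennreal_def)
  then show ?thesis by (simp add: cond_exp_domain_def norm_mult ennreal_mult)
qed

lemma cond_exp_domain_cnj:
  assumes "f \<in> cond_exp_domain M F"
  shows "(\<lambda>x. cnj (f x)) \<in> cond_exp_domain M F"
  using assms by (auto simp: cond_exp_domain_def)

lemma nn_cond_exp_finite: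
  assumes [measurable]: "f \<in> borel_measurable M" and "(\<integral>\<^sup>+x. f x \<partial>M) < \<infinity>"
  shows "AE x in M. nn_cond_exp M F f x < \<infinity>"
proof -
  have "(\<integral>\<^sup>+x. 1 * nn_cond_exp M F f x \<partial>M) = (\<integral>\<^sup>+x. 1 * f x \<partial>M)"
    by (rule nn_cond_exp_intg) auto
  then have "AE x in M. nn_cond_exp M F f x \<noteq> \<infinity>"
    using assms(2) by (intro nn_integral_noteq_infinite) auto
  then show ?thesis by eventually_elim (simp add: less_top)
qed

text \<open>
  The domain of the conditional expectation contains functions that are not integrable.  They become
  integrable after multiplication by a positive \<open>F\<close>-measurable function, and such a factor can be
  taken out of conditional expectations, so all algebraic rules carry over from integrable functions.
\<close>

lemma localizing_factor:
  assumes g: "g \<in> cond_exp_domain M F"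
  obtains h :: "'a \<Rightarrow> real" where "h \<in> borel_measurable F" "\<And>x. x \<in> space M \<Longrightarrow> 0 < h x"
    "integrable M (\<lambda>x. h x * cmod (g x))"
proof -
  note [measurable] = cond_exp_domain_measurable[OF g]
  interpret R: sigma_finite_measure "restr_to_subalg M F" by (rule sigma_fin_subalg)
  obtain \<rho> where "\<rho> \<in> borel_measurable (restr_to_subalg M F)"
    and \<rho>int: "(\<integral>\<^sup>+x. \<rho> x \<partial>restr_to_subalg M F) \<noteq> \<infinity>"
    and \<rho>pos: "\<And>x. x \<in> space M \<Longrightarrow> 0 < \<rho> x \<and> \<rho> x < \<infinity>"
    using R.Ex_finite_integrable_function by (auto simp: space_restr_to_subalg)
  then have \<rho>F [measurable]: "\<rho> \<in> borel_measurable F"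
    by (intro measurable_in_subalg'[OF subalg])
  note [measurable] = borel_measurable_F_M[OF \<rho>F]
  define A where "A = nn_cond_exp M F (\<lambda>x. ennreal (cmod (g x)))"
  have [measurable]: "A \<in> borel_measurable F" by (simp add: A_def)
  have A_fin: "AE x in M. A x < \<infinity>" using g by (simp add: A_def cond_exp_domain_def)
  define h where "h x = enn2real (\<rho> x) / (1 + enn2real (A x))" for x
  have hF [measurable]: "h \<in> borel_measurable F" unfolding h_def by measurable
  note [measurable] = borel_measurable_F_M[OF hF]
  have h0: "0 \<le> h x" for x by (simp add: h_def)
  \<comment> \<open>The factor \<open>1 / (1 + A)\<close> absorbs the conditional expectation, the factor \<open>\<rho>\<close> makes the integral finite.\<close>
  have "AE x in M. ennreal (h x) * A x \<le> \<rho> x"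
    using A_fin AE_space
  proof eventually_elim
    case (elim x)
    obtain r where r: "\<rho> x = ennreal r" "0 \<le> r" using \<rho>pos[OF elim(2)] by (cases "\<rho> x") auto
    obtain a where a: "A x = ennreal a" "0 \<le> a" using elim by (cases "A x") auto
    have "r / (1 + a) * a \<le> r" using r a by (simp add: field_simps)
    then show ?case using r a by (simp add: h_def ennreal_mult[symmetric] ennreal_leI)
  qed
  then have le: "(\<integral>\<^sup>+x. ennreal (h x) * A x \<partial>M) \<le> (\<integral>\<^sup>+x. \<rho> x \<partial>M)" by (rule nn_integral_mono_AE)
  have "(\<integral>\<^sup>+x. ennreal (h x) * ennreal (cmod (g x)) \<partial>M) = (\<integral>\<^sup>+x. ennreal (h x) * A x \<partial>M)"
    unfolding A_def by (rule nn_cond_exp_intg[symmetric]) auto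
  also have "\<dots> < \<infinity>"
    using le \<rho>int nn_integral_subalgebra2[OF subalg \<rho>F] by (auto simp: less_top top_unique)
  finally have int: "integrable M (\<lambda>x. h x * cmod (g x))"
    using h0 by (intro integrableI_nonneg) (auto simp: ennreal_mult)
  have "0 < h x" if "x \<in> space M" for x
    using \<rho>pos[OF that] by (auto simp: h_def enn2real_positive_iff intro!: divide_pos_pos add_pos_nonneg)
  then show thesis using that[OF hF _ int] by blast
qed

lemma real_cond_exp_linear_localized:
  fixes f g c d h :: "'a \<Rightarrow> real"
  assumes h [measurable]: "h \<in> borel_measurable F" and h0: "\<And>x. x \<in> space M \<Longrightarrow> 0 < h x"
    and c [measurable]: "c \<in> borel_measurable F" and d [measurable]: "d \<in> borel_measurable F"
    and [measurable]: "f \<in> borel_measurable M" "g \<in> borel_measurable M"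
    and int: "integrable M (\<lambda>x. h x * c x * f x)" "integrable M (\<lambda>x. h x * d x * g x)"
  shows "AE x in M. real_cond_exp M F (\<lambda>x. c x * f x + d x * g x) x =
    c x * real_cond_exp M F f x + d x * real_cond_exp M F g x"
proof -
  note [measurable] = borel_measurable_F_M[OF h] borel_measurable_F_M[OF c] borel_measurable_F_M[OF d]
  have eq: "(\<lambda>x. h x * (c x * f x + d x * g x)) = (\<lambda>x. h x * c x * f x + h x * d x * g x)"
    by (simp add: algebra_simps)
  have "AE x in M. real_cond_exp M F (\<lambda>x. h x * (c x * f x + d x * g x)) x =
      h x * real_cond_exp M F (\<lambda>x. c x * f x + d x * g x) x"
    using int by (intro real_cond_exp_mult) (auto simp: eq)
  moreover have "AE x in M. real_cond_exp M F (\<lambda>x. h x * c x * f x + h x * d x * g x) x =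
      real_cond_exp M F (\<lambda>x. h x * c x * f x) x + real_cond_exp M F (\<lambda>x. h x * d x * g x) x"
    by (rule real_cond_exp_add[OF int])
  moreover have "AE x in M. real_cond_exp M F (\<lambda>x. h x * c x * f x) x =
      h x * c x * real_cond_exp M F f x"
    by (rule real_cond_exp_mult) (use int in auto)
  moreover have "AE x in M. real_cond_exp M F (\<lambda>x. h x * d x * g x) x =
      h x * d x * real_cond_exp M F g x"
    by (rule real_cond_exp_mult) (use int in auto)
  ultimately show ?thesis using AE_space unfolding eq
  proof eventually_elim
    case (elim x)
    then have "h x * real_cond_exp M F (\<lambda>x. c x * f x + d x * g x) x =
        h x * (c x * real_cond_exp M F f x + d x * real_cond_exp M F g x)"
      by (simp add: algebra_simps)
    then show ?case using h0[OF elim(5)] by simp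
  qed
qed

lemma complex_cond_exp_cong:
  assumes "AE x in M. f x = g x" and [measurable]: "f \<in> borel_measurable M" "g \<in> borel_measurable M"
  shows "AE x in M. complex_cond_exp M F f x = complex_cond_exp M F g x"
proof -
  have "AE x in M. real_cond_exp M F (\<lambda>x. Re (f x)) x = real_cond_exp M F (\<lambda>x. Re (g x)) x"
    using assms(1) by (intro real_cond_exp_cong) auto
  moreover have "AE x in M. real_cond_exp M F (\<lambda>x. Im (f x)) x = real_cond_exp M F (\<lambda>x. Im (g x)) x"
    using assms(1) by (intro real_cond_exp_cong) auto
  ultimately show ?thesis by eventually_elim (simp add: complex_cond_exp_def)
qed

lemma complex_cond_exp_add:
  assumes f: "f \<in> cond_exp_domain M F" and g: "g \<in> cond_exp_domain M F"
  shows "AE x in M. complex_cond_exp M F (\<lambda>x. f x + g x) x =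
    complex_cond_exp M F f x + complex_cond_exp M F g x"
proof -
  note [measurable] = f[THEN cond_exp_domain_measurable] g[THEN cond_exp_domain_measurable]
  obtain h :: "'a \<Rightarrow> real" where h [measurable]: "h \<in> borel_measurable F"
    and h0: "\<And>x. x \<in> space M \<Longrightarrow> 0 < h x"
    and int: "integrable M (\<lambda>x. h x * cmod (of_real (cmod (f x) + cmod (g x))))"
    using localizing_factor[OF cond_exp_domain_add_norm[OF f g]] by blast
  note [measurable] = borel_measurable_F_M[OF h]
  have dom: "integrable M (\<lambda>x. h x * k x)"
    if [measurable]: "k \<in> borel_measurable M" and k: "\<And>x. \<bar>k x\<bar> \<le> cmod (f x) + cmod (g x)" for k
    using int
  proof (rule Bochner_Integration.integrable_bound)
    show "AE x in M. norm (h x * k x) \<le> norm (h x * cmod (of_real (cmod (f x) + cmod (g x))))"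
      using k by (auto simp: abs_mult simp flip: of_real_add intro!: mult_left_mono)
  qed measurable
  have bd: "\<bar>Re (f x)\<bar> \<le> cmod (f x) + cmod (g x)" "\<bar>Re (g x)\<bar> \<le> cmod (f x) + cmod (g x)"
    "\<bar>Im (f x)\<bar> \<le> cmod (f x) + cmod (g x)" "\<bar>Im (g x)\<bar> \<le> cmod (f x) + cmod (g x)" for x
    using abs_Re_le_cmod[of "f x"] abs_Re_le_cmod[of "g x"] abs_Im_le_cmod[of "f x"]
      abs_Im_le_cmod[of "g x"] norm_ge_zero[of "f x"] norm_ge_zero[of "g x"] by linarith+
  have "AE x in M. real_cond_exp M F (\<lambda>x. 1 * Re (f x) + 1 * Re (g x)) x =
      1 * real_cond_exp M F (\<lambda>x. Re (f x)) x + 1 * real_cond_exp M F (\<lambda>x. Re (g x)) x"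
    by (rule real_cond_exp_linear_localized[OF h h0]) (auto intro!: dom bd)
  moreover have "AE x in M. real_cond_exp M F (\<lambda>x. 1 * Im (f x) + 1 * Im (g x)) x =
      1 * real_cond_exp M F (\<lambda>x. Im (f x)) x + 1 * real_cond_exp M F (\<lambda>x. Im (g x)) x"
    by (rule real_cond_exp_linear_localized[OF h h0]) (auto intro!: dom bd)
  ultimately show ?thesis
    by eventually_elim (simp add: complex_cond_exp_def complex_eq_iff)
qed

lemma complex_cond_exp_mult:
  assumes c [measurable]: "c \<in> borel_measurable F" and f: "f \<in> cond_exp_domain M F"
  shows "AE x in M. complex_cond_exp M F (\<lambda>x. c x * f x) x = c x * complex_cond_exp M F f x"
proof -
  note [measurable] = f[THEN cond_exp_domain_measurable] borel_measurable_F_M[OF c]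
  obtain h :: "'a \<Rightarrow> real" where h [measurable]: "h \<in> borel_measurable F"
    and h0: "\<And>x. x \<in> space M \<Longrightarrow> 0 < h x"
    and int: "integrable M (\<lambda>x. h x * cmod (c x * f x))"
    using localizing_factor[OF cond_exp_domain_mult[OF c f]] by blast
  note [measurable] = borel_measurable_F_M[OF h]
  have dom: "integrable M (\<lambda>x. h x * k x * l x)"
    if [measurable]: "k \<in> borel_measurable M" "l \<in> borel_measurable M"
      and k: "\<And>x. \<bar>k x\<bar> \<le> cmod (c x)" and l: "\<And>x. \<bar>l x\<bar> \<le> cmod (f x)" for k l
    using int
  proof (rule Bochner_Integration.integrable_bound)
    show "AE x in M. norm (h x * k x * l x) \<le> norm (h x * cmod (c x * f x))"
      using k l by (auto simp: abs_mult norm_mult mult.assoc intro!: mult_left_mono mult_mono)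
  qed measurable
  have "AE x in M. real_cond_exp M F (\<lambda>x. Re (c x) * Re (f x) + (- Im (c x)) * Im (f x)) x =
      Re (c x) * real_cond_exp M F (\<lambda>x. Re (f x)) x + (- Im (c x)) * real_cond_exp M F (\<lambda>x. Im (f x)) x"
    by (rule real_cond_exp_linear_localized[OF h h0])
      (auto intro!: dom[of "\<lambda>x. - Im (c x)" "\<lambda>x. Im (f x)", simplified] dom abs_Re_le_cmod abs_Im_le_cmod)
  moreover have "AE x in M. real_cond_exp M F (\<lambda>x. Re (c x) * Im (f x) + Im (c x) * Re (f x)) x =
      Re (c x) * real_cond_exp M F (\<lambda>x. Im (f x)) x + Im (c x) * real_cond_exp M F (\<lambda>x. Re (f x)) x"
    by (rule real_cond_exp_linear_localized[OF h h0]) (auto intro!: dom abs_Re_le_cmod abs_Im_le_cmod)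
  ultimately show ?thesis
    by eventually_elim (simp add: complex_cond_exp_def complex_eq_iff)
qed

lemma complex_cond_exp_cnj:
  "complex_cond_exp M F (\<lambda>x. cnj (f x)) x = cnj (complex_cond_exp M F f x)"
  by (simp add: complex_cond_exp_def complex_eq_iff real_cond_exp_def)

lemma complex_cond_exp_nonneg:
  assumes [measurable]: "f \<in> borel_measurable M" and f0: "\<And>x. 0 \<le> f x"
  shows "AE x in M. complex_cond_exp M F (\<lambda>x. of_real (f x)) x =
    of_real (enn2real (nn_cond_exp M F (\<lambda>x. ennreal (f x)) x))"
proof -
  have "AE x in M. 0 = nn_cond_exp M F (\<lambda>x. 0) x" by (rule nn_cond_exp_F_meas) auto
  then show ?thesis
    by eventually_elim (simp add: complex_cond_exp_def complex_eq_iff real_cond_exp_def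
      ennreal_neg f0)
qed

lemma complex_cond_exp_integrable:
  assumes "integrable M f"
  shows "integrable M (complex_cond_exp M F f)"
    and "(\<integral>x. complex_cond_exp M F f x \<partial>M) = (\<integral>x. f x \<partial>M)"
proof -
  have int: "integrable M (\<lambda>x. Re (f x))" "integrable M (\<lambda>x. Im (f x))" using assms by auto
  note re = real_cond_exp_int[OF int(1)] and im = real_cond_exp_int[OF int(2)]
  have eq: "complex_cond_exp M F f = (\<lambda>x. of_real (real_cond_exp M F (\<lambda>x. Re (f x)) x) +
      \<i> * of_real (real_cond_exp M F (\<lambda>x. Im (f x)) x))"
    by (simp add: complex_cond_exp_def Complex_eq fun_eq_iff)
  show "integrable M (complex_cond_exp M F f)" unfolding eq using re im by auto
  then show "(\<integral>x. complex_cond_exp M F f x \<partial>M) = (\<integral>x. f x \<partial>M)"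
    using assms re im
    by (simp add: complex_eq_iff complex_cond_exp_def flip: integral_Re integral_Im)
qed

text \<open>
  If \<open>g < f\<close> held on a set \<open>B\<close> of positive finite measure, the integral of the bounded function \<open>g\<close>
  over \<open>B\<close> would be finite, so it could be subtracted and \<open>f - g\<close> would have integral \<open>0\<close> over \<open>B\<close>.
\<close>

lemma AE_le_of_set_nn_integral_le:
  fixes f g :: "'a \<Rightarrow> ennreal"
  assumes [measurable]: "f \<in> borel_measurable F" "g \<in> borel_measurable F"
    and g: "AE x in M. g x \<le> ennreal C"
    and le: "\<And>B. B \<in> sets F \<Longrightarrow> emeasure M B < \<infinity> \<Longrightarrow>
      (\<integral>\<^sup>+x. f x * indicator B x \<partial>M) \<le> (\<integral>\<^sup>+x. g x * indicator B x \<partial>M)"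
  shows "AE x in M. f x \<le> g x"
proof -
  note [measurable] = borel_measurable_F_M[OF assms(1)] borel_measurable_F_M[OF assms(2)]
  interpret R: sigma_finite_measure "restr_to_subalg M F" by (rule sigma_fin_subalg)
  obtain A :: "nat \<Rightarrow> 'a set" where A: "range A \<subseteq> sets (restr_to_subalg M F)"
    "(\<Union>i. A i) = space (restr_to_subalg M F)" "\<And>i. emeasure (restr_to_subalg M F) (A i) \<noteq> \<infinity>"
    using R.sigma_finite by blast
  have AF [measurable]: "A i \<in> sets F" for i using A(1) sets_restr_to_subalg[OF subalg] by auto
  have sM: "sets F \<subseteq> sets M" and sp: "space F = space M" using subalg by (auto simp: subalgebra_def)
  have A_fin: "emeasure M (A i) < \<infinity>" for i
    using A(3)[of i] emeasure_restr_to_subalg[OF subalg AF[of i]] by (simp add: less_top)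
  have A_un: "(\<Union>i. A i) = space M" using A(2) by (simp add: space_restr_to_subalg)
  have "AE x in M. x \<in> A i \<longrightarrow> f x \<le> g x" for i
  proof -
    define B where "B = A i \<inter> {x \<in> space F. g x < f x}"
    have BF [measurable]: "B \<in> sets F" unfolding B_def by measurable
    have [measurable]: "B \<in> sets M" using BF sM by auto
    have B_fin: "emeasure M B < \<infinity>"
    proof (rule le_less_trans[OF emeasure_mono A_fin[of i]])
      show "A i \<in> sets M" using AF[of i] sM by blast
    qed (simp add: B_def)
    have "(\<integral>\<^sup>+x. g x * indicator B x \<partial>M) \<le> (\<integral>\<^sup>+x. ennreal C * indicator B x \<partial>M)"
      using g by (intro nn_integral_mono_AE) (auto elim!: eventually_mono intro: mult_right_mono)
    also have "\<dots> < \<infinity>" using B_fin by (simp add: nn_integral_cmult_indicator ennreal_mult_less_top)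
    finally have fin: "(\<integral>\<^sup>+x. g x * indicator B x \<partial>M) < \<infinity>" .
    have "(\<integral>\<^sup>+x. f x * indicator B x \<partial>M) =
        (\<integral>\<^sup>+x. g x * indicator B x + (f x - g x) * indicator B x \<partial>M)"
      by (rule nn_integral_cong) (auto simp: B_def indicator_def intro!: ennreal_le_iff add_diff_inverse_ennreal[symmetric])
    also have "\<dots> = (\<integral>\<^sup>+x. g x * indicator B x \<partial>M) + (\<integral>\<^sup>+x. (f x - g x) * indicator B x \<partial>M)"
      by (rule nn_integral_add) auto
    finally have "(\<integral>\<^sup>+x. g x * indicator B x \<partial>M) + (\<integral>\<^sup>+x. (f x - g x) * indicator B x \<partial>M) \<le>
        (\<integral>\<^sup>+x. g x * indicator B x \<partial>M) + 0"
      using le[OF BF B_fin] by simp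
    then have "(\<integral>\<^sup>+x. (f x - g x) * indicator B x \<partial>M) = 0"
      using fin by (subst (asm) ennreal_add_left_cancel_le) auto
    then have "AE x in M. (f x - g x) * indicator B x = 0"
      by (subst (asm) nn_integral_0_iff_AE) auto
    then show ?thesis using AE_space
    proof eventually_elim
      case (elim x)
      show ?case
      proof (rule impI, rule ccontr)
        assume "x \<in> A i" "\<not> f x \<le> g x"
        then have "x \<in> B" "g x < f x" using elim(2) by (auto simp: B_def sp)
        then show False using elim(1) by (auto simp: diff_eq_0_iff_ennreal dest: leD)
      qed
    qed
  qed
  then have "AE x in M. \<forall>i. x \<in> A i \<longrightarrow> f x \<le> g x" unfolding AE_all_countable by blast
  then show ?thesis using AE_space
  proof eventually_elim
    case (elim x)
    then show ?case using A_un by blast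
  qed
qed

text \<open>
  The set where the conditional expectation of \<open>f\<close> vanishes belongs to \<open>F\<close>, so \<open>f\<close> has integral \<open>0\<close> over it.
\<close>

lemma nn_cond_exp_eq_0_imp:
  assumes [measurable]: "f \<in> borel_measurable M"
  shows "AE x in M. nn_cond_exp M F f x = 0 \<longrightarrow> f x = 0"
proof -
  define Z where "Z = {x \<in> space F. nn_cond_exp M F f x = 0}"
  have [measurable]: "Z \<in> sets F" unfolding Z_def by measurable
  have sp: "space F = space M" using subalg by (auto simp: subalgebra_def)
  have [measurable]: "Z \<in> sets M" using subalg by (auto simp: subalgebra_def)
  have "(\<integral>\<^sup>+x. indicator Z x * f x \<partial>M) = (\<integral>\<^sup>+x. indicator Z x * nn_cond_exp M F f x \<partial>M)"
    by (rule nn_cond_exp_intg[symmetric]) auto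
  also have "\<dots> = (\<integral>\<^sup>+x. 0 \<partial>M)" by (rule nn_integral_cong) (auto simp: Z_def indicator_def)
  finally have "AE x in M. indicator Z x * f x = 0"
    by (subst nn_integral_0_iff_AE[symmetric]) auto
  then show ?thesis using AE_space
    by eventually_elim (auto simp: Z_def sp indicator_def)
qed

lemma nn_cond_exp_SUP:
  fixes f :: "nat \<Rightarrow> 'a \<Rightarrow> ennreal"
  assumes [measurable]: "\<And>n. f n \<in> borel_measurable M" and inc: "incseq f"
  shows "AE x in M. (SUP n. nn_cond_exp M F (f n) x) = nn_cond_exp M F (\<lambda>x. SUP n. f n x) x"
proof (rule nn_cond_exp_charact)
  fix A assume [measurable]: "A \<in> sets F"
  then have [measurable]: "A \<in> sets M" using subalg by (auto simp: subalgebra_def)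
  have mono: "AE x in M. nn_cond_exp M F (f n) x \<le> nn_cond_exp M F (f (Suc n)) x" for n
    using inc by (intro nn_cond_exp_mono) (auto simp: incseq_Suc_iff le_fun_def)
  have "(\<integral>\<^sup>+x\<in>A. (SUP n. f n x) \<partial>M) = (\<integral>\<^sup>+x. (SUP n. f n x * indicator A x) \<partial>M)"
    by (simp add: SUP_mult_right_ennreal)
  also have "\<dots> = (SUP n. \<integral>\<^sup>+x. f n x * indicator A x \<partial>M)"
    using inc by (intro nn_integral_monotone_convergence_SUP)
      (auto simp: incseq_def le_fun_def intro!: mult_right_mono)
  also have "\<dots> = (SUP n. \<integral>\<^sup>+x. nn_cond_exp M F (f n) x * indicator A x \<partial>M)"
    using nn_cond_exp_intg[of "indicator A"] by (simp add: mult.commute)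
  also have "\<dots> = (\<integral>\<^sup>+x. (SUP n. nn_cond_exp M F (f n) x * indicator A x) \<partial>M)"
  proof (rule nn_integral_monotone_convergence_SUP_AE[symmetric])
    show "AE x in M. nn_cond_exp M F (f n) x * indicator A x \<le> nn_cond_exp M F (f (Suc n)) x * indicator A x" for n
      using mono[of n] by eventually_elim (rule mult_right_mono, simp_all)
  qed measurable
  also have "\<dots> = (\<integral>\<^sup>+x\<in>A. (SUP n. nn_cond_exp M F (f n) x) \<partial>M)"
    by (simp add: SUP_mult_right_ennreal)
  finally show "(\<integral>\<^sup>+x\<in>A. (SUP n. f n x) \<partial>M) = (\<integral>\<^sup>+x\<in>A. (SUP n. nn_cond_exp M F (f n) x) \<partial>M)" .
qed measurable

text \<open>
  On the \<open>F\<close>-measurable set where \<open>E(|u|\<^sup>2)\<close> vanishes \<open>u\<close> vanishes as well, and the indicator of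
  that set can be taken out of \<open>E(u f)\<close>.
\<close>

lemma complex_cond_exp_eq_0:
  assumes [measurable]: "u \<in> borel_measurable M" and uf: "(\<lambda>x. u x * f x) \<in> cond_exp_domain M F"
  shows "AE x in M. nn_cond_exp M F (\<lambda>y. ennreal ((cmod (u y))\<^sup>2)) x = 0 \<longrightarrow>
    complex_cond_exp M F (\<lambda>y. u y * f y) x = 0"
proof -
  let ?b = "nn_cond_exp M F (\<lambda>y. ennreal ((cmod (u y))\<^sup>2))"
  note [measurable] = cond_exp_domain_measurable[OF uf]
  define z where "z x = (if ?b x = 0 then 1 else 0 :: complex)" for x
  have zF [measurable]: "z \<in> borel_measurable F" unfolding z_def by measurable
  note [measurable] = borel_measurable_F_M[OF zF]
  have "AE x in M. ?b x = 0 \<longrightarrow> ennreal ((cmod (u x))\<^sup>2) = 0" by (rule nn_cond_exp_eq_0_imp) auto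
  then have "AE x in M. complex_cond_exp M F (\<lambda>x. z x * (u x * f x)) x = complex_cond_exp M F (\<lambda>x. 0) x"
    by (intro complex_cond_exp_cong) (auto elim!: eventually_mono simp: z_def)
  moreover have "AE x in M. complex_cond_exp M F (\<lambda>x. z x * (u x * f x)) x = z x * complex_cond_exp M F (\<lambda>x. u x * f x) x"
    by (rule complex_cond_exp_mult[OF zF uf])
  moreover have "AE x in M. 0 = nn_cond_exp M F (\<lambda>x. 0) x" by (rule nn_cond_exp_F_meas) auto
  ultimately show ?thesis
    by eventually_elim (auto simp: z_def complex_cond_exp_def real_cond_exp_def complex_eq_iff)
qed

end

section \<open>Functions with finite conditional second moment\<close>

text \<open>
  The conditional counterpart of \<open>L\<^sup>2\<close>: it is a module over the \<open>F\<close>-measurable functions on which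
  \<open>E(cnj p * q)\<close> is an inner product with \<open>F\<close>-measurable values, although \<open>cnj p * q\<close> need not be integrable.
\<close>

definition cond_l2 :: "'a measure \<Rightarrow> 'a measure \<Rightarrow> ('a \<Rightarrow> complex) set" where
  "cond_l2 M F = {f \<in> borel_measurable M. AE x in M. nn_cond_exp M F (\<lambda>y. ennreal ((cmod (f y))\<^sup>2)) x < \<infinity>}"

text \<open>
  For the inner product \<open>E(cnj p * q)\<close> such a function has length \<open>1\<close> over \<open>S\<close> and \<open>0\<close> elsewhere.
  The set \<open>S\<close> occurs because the functions \<open>u\<close> and \<open>w\<close> may vanish on part of the space.
\<close>

definition cond_unit :: "'a measure \<Rightarrow> 'a measure \<Rightarrow> 'a set \<Rightarrow> ('a \<Rightarrow> complex) \<Rightarrow> bool" where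
  "cond_unit M F S p \<longleftrightarrow> p \<in> borel_measurable M \<and>
     (AE x in M. nn_cond_exp M F (\<lambda>y. ennreal ((cmod (p y))\<^sup>2)) x = indicator S x)"

text \<open>
  The analogue of the rank one operator \<open>f \<mapsto> k \<langle>f, q\<rangle> p\<close>.  The weight \<open>k\<close> is kept apart from
  \<open>p\<close> so that \<open>p\<close> and \<open>q\<close> can be normalized and \<open>k\<close> carries the size of the operator.
\<close>

definition cond_ker :: "'a measure \<Rightarrow> 'a measure \<Rightarrow> ('a \<Rightarrow> complex) \<Rightarrow> ('a \<Rightarrow> complex) \<Rightarrow> ('a \<Rightarrow> complex)
    \<Rightarrow> ('a \<Rightarrow> complex) \<Rightarrow> 'a \<Rightarrow> complex" where
  "cond_ker M F k p q f = (\<lambda>x. k x * p x * complex_cond_exp M F (\<lambda>y. cnj (q y) * f y) x)"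

definition ess_bounded :: "'a measure \<Rightarrow> 'a measure \<Rightarrow> ('a \<Rightarrow> complex) \<Rightarrow> bool" where
  "ess_bounded M F k \<longleftrightarrow> k \<in> borel_measurable F \<and> (\<exists>C. AE x in M. cmod (k x) \<le> C)"

lemma cond_l2_measurable: "f \<in> cond_l2 M F \<Longrightarrow> f \<in> borel_measurable M"
  by (simp add: cond_l2_def)

lemma cond_unit_measurable: "cond_unit M F S p \<Longrightarrow> p \<in> borel_measurable M"
  by (simp add: cond_unit_def)

lemma l2_functions_measurable: "f \<in> l2_functions M \<Longrightarrow> f \<in> borel_measurable M"
  by (simp add: l2_functions_def)

lemma cond_unit_cond_l2: "cond_unit M F S p \<Longrightarrow> p \<in> cond_l2 M F"
  unfolding cond_unit_def cond_l2_def by (auto elim!: eventually_mono simp: indicator_def)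

lemma ess_bounded_obtain:
  assumes "ess_bounded M F k"
  obtains C where "0 \<le> C" "AE x in M. cmod (k x) \<le> C"
proof -
  obtain C where C: "AE x in M. cmod (k x) \<le> C" using assms by (auto simp: ess_bounded_def)
  then have "AE x in M. cmod (k x) \<le> max C 0" by eventually_elim simp
  then show thesis using that[of "max C 0"] by simp
qed

lemma ess_bounded_mult:
  assumes k: "ess_bounded M F k" and l: "ess_bounded M F l"
  shows "ess_bounded M F (\<lambda>x. k x * l x)"
proof -
  obtain C where C: "0 \<le> C" "AE x in M. cmod (k x) \<le> C" using ess_bounded_obtain[OF k] .
  obtain D where D: "0 \<le> D" "AE x in M. cmod (l x) \<le> D" using ess_bounded_obtain[OF l] .
  have "AE x in M. cmod (k x * l x) \<le> C * D"
    using C(2) D(2) by eventually_elim (simp add: norm_mult mult_mono C D)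
  then show ?thesis using k l by (auto simp: ess_bounded_def)
qed

lemma l2_cnj_mult_integrable:
  assumes f: "f \<in> l2_functions M" and g: "g \<in> l2_functions M"
  shows "integrable M (\<lambda>x. f x * cnj (g x))"
proof (rule Bochner_Integration.integrable_bound)
  note [measurable] = f[THEN l2_functions_measurable] g[THEN l2_functions_measurable]
  show "integrable M (\<lambda>x. (cmod (f x))\<^sup>2 + (cmod (g x))\<^sup>2)"
    using f g by (auto simp: l2_functions_def)
  show "(\<lambda>x. f x * cnj (g x)) \<in> borel_measurable M" by measurable
  have "a * b \<le> a\<^sup>2 + b\<^sup>2" if "0 \<le> a" "0 \<le> b" for a b :: real
    using sum_squares_bound[of a b] mult_nonneg_nonneg[OF that] by linarith
  then show "AE x in M. norm (f x * cnj (g x)) \<le> norm ((cmod (f x))\<^sup>2 + (cmod (g x))\<^sup>2)"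
    by (auto simp: norm_mult)
qed

lemma l2_add:
  assumes f: "f \<in> l2_functions M" and g: "g \<in> l2_functions M"
  shows "(\<lambda>x. f x + g x) \<in> l2_functions M"
proof -
  note [measurable] = f[THEN l2_functions_measurable] g[THEN l2_functions_measurable]
  have "integrable M (\<lambda>x. (cmod (f x + g x))\<^sup>2)"
  proof (rule Bochner_Integration.integrable_bound)
    show "integrable M (\<lambda>x. 2 * (cmod (f x))\<^sup>2 + 2 * (cmod (g x))\<^sup>2)"
      using f g by (auto simp: l2_functions_def)
    have "(cmod (a + b))\<^sup>2 \<le> 2 * (cmod a)\<^sup>2 + 2 * (cmod b)\<^sup>2" for a b
    proof -
      have "(cmod (a + b))\<^sup>2 \<le> (cmod a + cmod b)\<^sup>2" by (intro power_mono norm_triangle_ineq) simp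
      also have "\<dots> \<le> 2 * (cmod a)\<^sup>2 + 2 * (cmod b)\<^sup>2"
        using sum_squares_bound[of "cmod a" "cmod b"] by (simp add: power2_sum)
      finally show ?thesis .
    qed
    then show "AE x in M. norm ((cmod (f x + g x))\<^sup>2) \<le> norm (2 * (cmod (f x))\<^sup>2 + 2 * (cmod (g x))\<^sup>2)"
      by auto
  qed measurable
  then show ?thesis by (simp add: l2_functions_def)
qed

lemma l2_scale:
  assumes f: "f \<in> l2_functions M"
  shows "(\<lambda>x. c * f x) \<in> l2_functions M"
  using assms by (auto simp: l2_functions_def norm_mult power_mult_distrib)

lemma l2_iff_nn_integral:
  "f \<in> l2_functions M \<longleftrightarrow> f \<in> borel_measurable M \<and> (\<integral>\<^sup>+x. ennreal ((cmod (f x))\<^sup>2) \<partial>M) < \<infinity>"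
  by (auto simp: l2_functions_def integrable_iff_bounded)

lemma l2_nn_integral:
  assumes "f \<in> l2_functions M"
  shows "(\<integral>\<^sup>+x. ennreal ((cmod (f x))\<^sup>2) \<partial>M) = ennreal (\<integral>x. (cmod (f x))\<^sup>2 \<partial>M)"
  using assms by (intro nn_integral_eq_integral) (auto simp: l2_functions_def)

context sigma_finite_subalgebra
begin

lemma l2_cond_l2: "f \<in> l2_functions M \<Longrightarrow> f \<in> cond_l2 M F"
proof -
  assume f: "f \<in> l2_functions M"
  note [measurable] = l2_functions_measurable[OF f]
  have "AE x in M. nn_cond_exp M F (\<lambda>x. ennreal ((cmod (f x))\<^sup>2)) x < \<infinity>"
    using f by (intro nn_cond_exp_finite) (simp_all add: l2_iff_nn_integral)
  then show ?thesis by (simp add: cond_l2_def)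
qed

lemma cond_l2_cnj_mult:
  assumes p: "p \<in> cond_l2 M F" and q: "q \<in> cond_l2 M F"
  shows "(\<lambda>x. cnj (p x) * q x) \<in> cond_exp_domain M F"
proof (rule cond_exp_domain_mono)
  note [measurable] = p[THEN cond_l2_measurable] q[THEN cond_l2_measurable]
  show "(\<lambda>x. cnj (p x) * q x) \<in> borel_measurable M" by measurable
  show "(\<lambda>x. of_real (cmod (of_real ((cmod (p x))\<^sup>2)) + cmod (of_real ((cmod (q x))\<^sup>2))) :: complex)
      \<in> cond_exp_domain M F"
    using p q by (intro cond_exp_domain_add_norm) (auto simp: cond_exp_domain_def cond_l2_def norm_power)
  have "a * b \<le> a\<^sup>2 + b\<^sup>2" if "0 \<le> a" "0 \<le> b" for a b :: real
    using sum_squares_bound[of a b] mult_nonneg_nonneg[OF that] by linarith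
  then show "AE x in M. cmod (cnj (p x) * q x) \<le>
      cmod (of_real (cmod (of_real ((cmod (p x))\<^sup>2)) + cmod (of_real ((cmod (q x))\<^sup>2))) :: complex)"
    by (simp add: norm_mult norm_power flip: of_real_add)
qed

lemma cond_l2_power2: "p \<in> cond_l2 M F \<Longrightarrow> (\<lambda>x. of_real ((cmod (p x))\<^sup>2)) \<in> cond_exp_domain M F"
  by (auto simp: cond_exp_domain_def cond_l2_def norm_power)

text \<open>
  For \<open>c = E(cnj q * f)\<close> expand \<open>0 \<le> E(|f - c q|\<^sup>2)\<close>: the mixed terms contribute
  \<open>- 2 |c|\<^sup>2\<close> and the last one at most \<open>|c|\<^sup>2\<close>, because \<open>E(|q|\<^sup>2) \<le> 1\<close>.
\<close>

lemma cond_Bessel: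
  assumes q: "cond_unit M F S q" and f: "f \<in> cond_l2 M F"
  shows "AE x in M. (cmod (complex_cond_exp M F (\<lambda>y. cnj (q y) * f y) x))\<^sup>2 \<le>
    enn2real (nn_cond_exp M F (\<lambda>y. ennreal ((cmod (f y))\<^sup>2)) x)"
proof -
  note q2 = cond_unit_cond_l2[OF q]
  note [measurable] = f[THEN cond_l2_measurable] q2[THEN cond_l2_measurable]
  define c where "c = complex_cond_exp M F (\<lambda>y. cnj (q y) * f y)"
  have cF [measurable]: "c \<in> borel_measurable F" and [measurable]: "c \<in> borel_measurable M"
    by (simp_all add: c_def)
  define r where "r = (\<lambda>x. f x - c x * q x)"
  have [measurable]: "r \<in> borel_measurable M" by (simp add: r_def)
  define f1 q1 m1 m2 where "f1 x = complex_of_real ((cmod (f x))\<^sup>2)"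
    and "q1 x = of_real ((cmod (c x))\<^sup>2) * complex_of_real ((cmod (q x))\<^sup>2)"
    and "m1 x = - cnj (c x) * (cnj (q x) * f x)"
    and "m2 x = - c x * (cnj (f x) * q x)" for x
  have dom: "f1 \<in> cond_exp_domain M F" "q1 \<in> cond_exp_domain M F"
    "m1 \<in> cond_exp_domain M F" "m2 \<in> cond_exp_domain M F"
    unfolding f1_def q1_def m1_def m2_def
    by (intro cond_exp_domain_mult cond_l2_cnj_mult cond_l2_power2 f q2; measurable)+
  have eq: "(\<lambda>x. complex_of_real ((cmod (r x))\<^sup>2)) = (\<lambda>x. (f1 x + q1 x) + (m1 x + m2 x))"
    unfolding r_def f1_def q1_def m1_def m2_def complex_norm_square
    by (auto simp: fun_eq_iff algebra_simps)
  have "AE x in M. complex_cond_exp M F (\<lambda>x. (f1 x + q1 x) + (m1 x + m2 x)) x =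
      complex_cond_exp M F (\<lambda>x. f1 x + q1 x) x + complex_cond_exp M F (\<lambda>x. m1 x + m2 x) x"
    by (intro complex_cond_exp_add cond_exp_domain_add dom)
  moreover have "AE x in M. complex_cond_exp M F (\<lambda>x. f1 x + q1 x) x =
      complex_cond_exp M F f1 x + complex_cond_exp M F q1 x"
    "AE x in M. complex_cond_exp M F (\<lambda>x. m1 x + m2 x) x =
      complex_cond_exp M F m1 x + complex_cond_exp M F m2 x"
    by (intro complex_cond_exp_add dom)+
  moreover have "AE x in M. complex_cond_exp M F q1 x =
      of_real ((cmod (c x))\<^sup>2) * complex_cond_exp M F (\<lambda>x. of_real ((cmod (q x))\<^sup>2)) x"
    unfolding q1_def by (intro complex_cond_exp_mult cond_l2_power2 q2) auto
  moreover have "AE x in M. complex_cond_exp M F m1 x = - cnj (c x) * c x"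
    unfolding m1_def c_def[symmetric]
    using complex_cond_exp_mult[OF _ cond_l2_cnj_mult[OF q2 f], of "\<lambda>x. - cnj (c x)"]
    by (auto simp: c_def[symmetric])
  moreover have "AE x in M. complex_cond_exp M F m2 x = - c x * cnj (c x)"
  proof -
    have "complex_cond_exp M F (\<lambda>x. cnj (f x) * q x) x = cnj (c x)" for x
      using complex_cond_exp_cnj[of "\<lambda>y. cnj (q y) * f y" x] by (simp add: c_def mult.commute)
    then show ?thesis unfolding m2_def
      using complex_cond_exp_mult[OF _ cond_l2_cnj_mult[OF f q2], of "\<lambda>x. - c x"] by auto
  qed
  moreover have "AE x in M. complex_cond_exp M F f1 x =
      of_real (enn2real (nn_cond_exp M F (\<lambda>x. ennreal ((cmod (f x))\<^sup>2)) x))"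
    unfolding f1_def by (rule complex_cond_exp_nonneg) auto
  moreover have "AE x in M. complex_cond_exp M F (\<lambda>x. of_real ((cmod (q x))\<^sup>2)) x =
      of_real (enn2real (nn_cond_exp M F (\<lambda>x. ennreal ((cmod (q x))\<^sup>2)) x))"
    by (rule complex_cond_exp_nonneg) auto
  moreover have "AE x in M. complex_cond_exp M F (\<lambda>x. complex_of_real ((cmod (r x))\<^sup>2)) x =
      of_real (enn2real (nn_cond_exp M F (\<lambda>x. ennreal ((cmod (r x))\<^sup>2)) x))"
    by (rule complex_cond_exp_nonneg) auto
  moreover have "AE x in M. nn_cond_exp M F (\<lambda>x. ennreal ((cmod (q x))\<^sup>2)) x = indicator S x"
    using q by (simp add: cond_unit_def)
  ultimately show ?thesis unfolding eq c_def[symmetric]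
  proof eventually_elim
    case (elim x)
    define a s where "a = enn2real (nn_cond_exp M F (\<lambda>x. ennreal ((cmod (f x))\<^sup>2)) x)"
      and "s = enn2real (indicator S x)"
    have s: "s \<le> 1" by (simp add: s_def indicator_def)
    have cc: "c x * cnj (c x) = of_real ((cmod (c x))\<^sup>2)" "cnj (c x) * c x = of_real ((cmod (c x))\<^sup>2)"
      unfolding complex_norm_square by (simp_all add: mult.commute)
    have "of_real (enn2real (nn_cond_exp M F (\<lambda>x. ennreal ((cmod (r x))\<^sup>2)) x)) =
        (of_real a + of_real ((cmod (c x))\<^sup>2) * of_real s) + (- (cnj (c x) * c x) + - (c x * cnj (c x)))"
      using elim unfolding a_def s_def by (simp only: mult_minus_left)
    also have "\<dots> = complex_of_real (a + (cmod (c x))\<^sup>2 * s - 2 * (cmod (c x))\<^sup>2)"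
      unfolding cc by simp
    finally have "of_real (enn2real (nn_cond_exp M F (\<lambda>x. ennreal ((cmod (r x))\<^sup>2)) x)) =
        complex_of_real (a + (cmod (c x))\<^sup>2 * s - 2 * (cmod (c x))\<^sup>2)" .
    then have "0 \<le> a + (cmod (c x))\<^sup>2 * s - 2 * (cmod (c x))\<^sup>2"
      by (metis of_real_eq_iff enn2real_nonneg)
    moreover have "(cmod (c x))\<^sup>2 * s \<le> (cmod (c x))\<^sup>2"
      using mult_left_mono[OF s, of "(cmod (c x))\<^sup>2"] by simp
    ultimately show ?case unfolding a_def by linarith
  qed
qed

lemma cond_unit_inner_le_1:
  assumes q: "cond_unit M F S q" and p: "cond_unit M F R p"
  shows "AE x in M. cmod (complex_cond_exp M F (\<lambda>y. cnj (q y) * p y) x) \<le> 1"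
  using cond_Bessel[OF q cond_unit_cond_l2[OF p]] p[unfolded cond_unit_def, THEN conjunct2]
proof eventually_elim
  case (elim x)
  then have "(cmod (complex_cond_exp M F (\<lambda>y. cnj (q y) * p y) x))\<^sup>2 \<le> 1\<^sup>2"
    by (cases "x \<in> R") simp_all
  then show ?case by (rule power2_le_imp_le) simp
qed

lemma cond_unit_inner_ess_bounded:
  assumes "cond_unit M F S q" "cond_unit M F R p"
  shows "ess_bounded M F (complex_cond_exp M F (\<lambda>y. cnj (q y) * p y))"
  using cond_unit_inner_le_1[OF assms] by (auto simp: ess_bounded_def)

lemma cond_unit_self_inner:
  assumes p: "cond_unit M F S p"
  shows "AE x in M. complex_cond_exp M F (\<lambda>y. cnj (p y) * p y) x = indicator S x"
proof -
  note [measurable] = cond_unit_measurable[OF p]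
  have "AE x in M. complex_cond_exp M F (\<lambda>x. of_real ((cmod (p x))\<^sup>2)) x =
      of_real (enn2real (nn_cond_exp M F (\<lambda>x. ennreal ((cmod (p x))\<^sup>2)) x))"
    by (rule complex_cond_exp_nonneg) auto
  with p[unfolded cond_unit_def, THEN conjunct2] show ?thesis
    by eventually_elim (simp add: complex_norm_square mult.commute indicator_def del: of_real_power)
qed

lemma cond_ker_measurable [measurable]:
  assumes "k \<in> borel_measurable F" "cond_unit M F S p"
  shows "cond_ker M F k p q f \<in> borel_measurable M"
proof -
  note [measurable] = borel_measurable_F_M[OF assms(1)] cond_unit_measurable[OF assms(2)]
  show ?thesis unfolding cond_ker_def by measurable
qed

text \<open>
  All factors of the integrand except \<open>|p|\<^sup>2\<close> are \<open>F\<close>-measurable, so \<open>|p|\<^sup>2\<close> may be replaced by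
  its conditional expectation, the indicator of \<open>S\<close>.
\<close>

lemma cond_ker_nn_integral:
  assumes k [measurable]: "k \<in> borel_measurable F" and p: "cond_unit M F S p"
  shows "(\<integral>\<^sup>+x. ennreal ((cmod (cond_ker M F k p q f x))\<^sup>2) \<partial>M) =
    (\<integral>\<^sup>+x. ennreal ((cmod (k x * complex_cond_exp M F (\<lambda>y. cnj (q y) * f y) x))\<^sup>2) * indicator S x \<partial>M)"
proof -
  note [measurable] = cond_unit_measurable[OF p] borel_measurable_F_M[OF k]
  let ?c = "\<lambda>x. k x * complex_cond_exp M F (\<lambda>y. cnj (q y) * f y) x"
  have "(\<integral>\<^sup>+x. ennreal ((cmod (cond_ker M F k p q f x))\<^sup>2) \<partial>M) =
      (\<integral>\<^sup>+x. ennreal ((cmod (?c x))\<^sup>2) * ennreal ((cmod (p x))\<^sup>2) \<partial>M)"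
    by (simp add: cond_ker_def norm_mult power_mult_distrib ac_simps flip: ennreal_mult')
  also have "\<dots> = (\<integral>\<^sup>+x. ennreal ((cmod (?c x))\<^sup>2) * nn_cond_exp M F (\<lambda>x. ennreal ((cmod (p x))\<^sup>2)) x \<partial>M)"
    by (rule nn_cond_exp_intg[symmetric]) auto
  also have "\<dots> = (\<integral>\<^sup>+x. ennreal ((cmod (?c x))\<^sup>2) * indicator S x \<partial>M)"
    using p[unfolded cond_unit_def, THEN conjunct2]
    by (intro nn_integral_cong_AE) (auto elim!: eventually_mono)
  finally show ?thesis .
qed

lemma cond_exp_contraction:
  assumes q: "cond_unit M F S q" and f: "f \<in> l2_functions M"
  shows "(\<integral>\<^sup>+x. ennreal ((cmod (complex_cond_exp M F (\<lambda>y. cnj (q y) * f y) x))\<^sup>2) \<partial>M) \<le>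
    (\<integral>\<^sup>+x. ennreal ((cmod (f x))\<^sup>2) \<partial>M)"
proof -
  note [measurable] = l2_functions_measurable[OF f]
  have "(\<integral>\<^sup>+x. ennreal ((cmod (complex_cond_exp M F (\<lambda>y. cnj (q y) * f y) x))\<^sup>2) \<partial>M) \<le>
      (\<integral>\<^sup>+x. 1 * nn_cond_exp M F (\<lambda>y. ennreal ((cmod (f y))\<^sup>2)) x \<partial>M)"
  proof (rule nn_integral_mono_AE)
    show "AE x in M. ennreal ((cmod (complex_cond_exp M F (\<lambda>y. cnj (q y) * f y) x))\<^sup>2) \<le>
        1 * nn_cond_exp M F (\<lambda>y. ennreal ((cmod (f y))\<^sup>2)) x"
      using cond_Bessel[OF q l2_cond_l2[OF f]]
    proof eventually_elim
      case (elim x)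
      show ?case
      proof (cases "nn_cond_exp M F (\<lambda>y. ennreal ((cmod (f y))\<^sup>2)) x = \<top>")
        case False
        then show ?thesis using ennreal_leI[OF elim] by (simp add: less_top)
      qed simp
    qed
  qed
  also have "\<dots> = (\<integral>\<^sup>+x. 1 * ennreal ((cmod (f x))\<^sup>2) \<partial>M)"
    by (rule nn_cond_exp_intg) auto
  finally show ?thesis by simp
qed

lemma cond_ker_nn_integral_le:
  assumes k: "k \<in> borel_measurable F" and C: "AE x in M. x \<in> S \<longrightarrow> cmod (k x) \<le> C"
    and p: "cond_unit M F S p" and q: "cond_unit M F S q" and f: "f \<in> l2_functions M"
  shows "(\<integral>\<^sup>+x. ennreal ((cmod (cond_ker M F k p q f x))\<^sup>2) \<partial>M) \<le>
    ennreal (C\<^sup>2) * (\<integral>\<^sup>+x. ennreal ((cmod (f x))\<^sup>2) \<partial>M)"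
proof -
  let ?c = "complex_cond_exp M F (\<lambda>y. cnj (q y) * f y)"
  have "(\<integral>\<^sup>+x. ennreal ((cmod (cond_ker M F k p q f x))\<^sup>2) \<partial>M) \<le>
      (\<integral>\<^sup>+x. ennreal (C\<^sup>2) * ennreal ((cmod (?c x))\<^sup>2) \<partial>M)"
    unfolding cond_ker_nn_integral[OF k p]
  proof (rule nn_integral_mono_AE)
    show "AE x in M. ennreal ((cmod (k x * ?c x))\<^sup>2) * indicator S x \<le>
        ennreal (C\<^sup>2) * ennreal ((cmod (?c x))\<^sup>2)"
      using C by eventually_elim
        (auto simp: indicator_def norm_mult power_mult_distrib simp flip: ennreal_mult'
          intro!: ennreal_leI mult_right_mono power_mono)
  qed
  also have "\<dots> = ennreal (C\<^sup>2) * (\<integral>\<^sup>+x. ennreal ((cmod (?c x))\<^sup>2) \<partial>M)"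
    by (rule nn_integral_cmult) auto
  also have "\<dots> \<le> ennreal (C\<^sup>2) * (\<integral>\<^sup>+x. ennreal ((cmod (f x))\<^sup>2) \<partial>M)"
    by (intro mult_left_mono cond_exp_contraction[OF q f]) auto
  finally show ?thesis .
qed

lemma cond_ker_l2:
  assumes k: "ess_bounded M F k" and p: "cond_unit M F S p" and q: "cond_unit M F S q"
    and f: "f \<in> l2_functions M"
  shows "cond_ker M F k p q f \<in> l2_functions M"
proof -
  obtain C where C: "0 \<le> C" "AE x in M. cmod (k x) \<le> C" using ess_bounded_obtain[OF k] .
  have kF: "k \<in> borel_measurable F" using k by (simp add: ess_bounded_def)
  have "(\<integral>\<^sup>+x. ennreal ((cmod (cond_ker M F k p q f x))\<^sup>2) \<partial>M) \<le>
    ennreal (C\<^sup>2) * (\<integral>\<^sup>+x. ennreal ((cmod (f x))\<^sup>2) \<partial>M)"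
    using C(2) by (intro cond_ker_nn_integral_le[OF kF _ p q f]) auto
  also have "\<dots> < \<infinity>" using f by (simp add: l2_iff_nn_integral ennreal_mult_less_top)
  finally show ?thesis using kF p by (simp add: l2_iff_nn_integral cond_ker_measurable)
qed

text \<open>
  Conditioning the integrand takes \<open>k E(cnj q * f)\<close> out and leaves \<open>E(p * cnj g)\<close>.  Up to conjugation the
  result is symmetric in \<open>(p, g)\<close> and \<open>(q, f)\<close>, which yields the adjoint operator.
\<close>

lemma cond_ker_inner:
  assumes k: "ess_bounded M F k" and p: "cond_unit M F S p" and q: "cond_unit M F S q"
    and f: "f \<in> l2_functions M" and g: "g \<in> l2_functions M"
  shows "(\<integral>x. cond_ker M F k p q f x * cnj (g x) \<partial>M) =
    (\<integral>x. k x * complex_cond_exp M F (\<lambda>y. cnj (q y) * f y) x *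
      cnj (complex_cond_exp M F (\<lambda>y. cnj (p y) * g y) x) \<partial>M)"
proof -
  have kF [measurable]: "k \<in> borel_measurable F" using k by (simp add: ess_bounded_def)
  note [measurable] = borel_measurable_F_M[OF kF] cond_unit_measurable[OF p] l2_functions_measurable[OF g]
  let ?c = "\<lambda>x. k x * complex_cond_exp M F (\<lambda>y. cnj (q y) * f y) x"
  have eq: "(\<lambda>x. cond_ker M F k p q f x * cnj (g x)) = (\<lambda>x. ?c x * cnj (cnj (p x) * g x))"
    by (simp add: cond_ker_def fun_eq_iff)
  have int: "integrable M (\<lambda>x. cond_ker M F k p q f x * cnj (g x))"
    by (rule l2_cnj_mult_integrable[OF cond_ker_l2[OF k p q f] g])
  have "(\<integral>x. cond_ker M F k p q f x * cnj (g x) \<partial>M) =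
      (\<integral>x. complex_cond_exp M F (\<lambda>x. ?c x * cnj (cnj (p x) * g x)) x \<partial>M)"
    using complex_cond_exp_integrable(2)[OF int] unfolding eq by simp
  also have "\<dots> = (\<integral>x. ?c x * cnj (complex_cond_exp M F (\<lambda>y. cnj (p y) * g y) x) \<partial>M)"
  proof (rule integral_cong_AE)
    have "(\<lambda>x. cnj (cnj (p x) * g x)) \<in> cond_exp_domain M F"
      by (intro cond_exp_domain_cnj cond_l2_cnj_mult cond_unit_cond_l2[OF p] l2_cond_l2[OF g])
    then show "AE x in M. complex_cond_exp M F (\<lambda>x. ?c x * cnj (cnj (p x) * g x)) x =
        ?c x * cnj (complex_cond_exp M F (\<lambda>y. cnj (p y) * g y) x)"
      using complex_cond_exp_mult[of ?c "\<lambda>x. cnj (cnj (p x) * g x)"]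
      unfolding complex_cond_exp_cnj by simp
  qed measurable
  finally show ?thesis .
qed

end

section \<open>The Hilbert space of square-integrable functions\<close>

lemma ae_class_self: "f \<in> borel_measurable M \<Longrightarrow> f \<in> ae_class M f"
  by (simp add: ae_class_def)

lemma ae_class_eq_iff:
  assumes "f \<in> borel_measurable M" "g \<in> borel_measurable M"
  shows "ae_class M f = ae_class M g \<longleftrightarrow> (AE x in M. f x = g x)"
proof
  assume "ae_class M f = ae_class M g"
  then have "f \<in> ae_class M g" using ae_class_self[OF assms(1)] by simp
  then show "AE x in M. f x = g x" by (simp add: ae_class_def)
next
  assume ae: "AE x in M. f x = g x"
  have "(AE x in M. h x = f x) \<longleftrightarrow> (AE x in M. h x = g x)" for h
  proof
    assume "AE x in M. h x = f x" with ae show "AE x in M. h x = g x" by eventually_elim simp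
  next
    assume "AE x in M. h x = g x" with ae show "AE x in M. h x = f x" by eventually_elim simp
  qed
  then show "ae_class M f = ae_class M g" by (auto simp: ae_class_def)
qed

lemma ae_rep_ae_class:
  assumes "f \<in> borel_measurable M"
  shows "ae_rep (ae_class M f) \<in> borel_measurable M" "AE x in M. ae_rep (ae_class M f) x = f x"
proof -
  have "ae_rep (ae_class M f) \<in> ae_class M f"
    unfolding ae_rep_def by (rule someI[of "\<lambda>g. g \<in> ae_class M f", OF ae_class_self[OF assms]])
  then show "ae_rep (ae_class M f) \<in> borel_measurable M" "AE x in M. ae_rep (ae_class M f) x = f x"
    by (simp_all add: ae_class_def)
qed

lemma L2_carrier: "X \<in> space_carrier (L2 M) \<longleftrightarrow> (\<exists>f\<in>l2_functions M. X = ae_class M f)"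
  by (auto simp: L2_def)

lemma L2_carrierE:
  assumes "X \<in> space_carrier (L2 M)"
  obtains f where "f \<in> l2_functions M" "X = ae_class M f"
  using assms by (auto simp: L2_carrier)

lemma l2_of_ae_class_carrier:
  assumes f: "f \<in> borel_measurable M" and "ae_class M f \<in> space_carrier (L2 M)"
  shows "f \<in> l2_functions M"
proof -
  obtain g where g: "g \<in> l2_functions M" "ae_class M f = ae_class M g"
    using assms(2) by (rule L2_carrierE)
  have "AE x in M. f x = g x" using g f by (simp add: ae_class_eq_iff l2_functions_measurable)
  then have "(\<integral>\<^sup>+x. ennreal ((cmod (f x))\<^sup>2) \<partial>M) = (\<integral>\<^sup>+x. ennreal ((cmod (g x))\<^sup>2) \<partial>M)"
    by (intro nn_integral_cong_AE) (auto elim!: eventually_mono)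
  then show ?thesis using g(1) f by (simp add: l2_iff_nn_integral)
qed

lemma L2_zero: "space_zero (L2 M) = ae_class M (\<lambda>x. 0)"
  by (simp add: L2_def)

lemma L2_add:
  assumes f: "f \<in> l2_functions M" and g: "g \<in> l2_functions M"
  shows "space_add (L2 M) (ae_class M f) (ae_class M g) = ae_class M (\<lambda>x. f x + g x)"
proof -
  note m [measurable] = f[THEN l2_functions_measurable] g[THEN l2_functions_measurable]
  note [measurable] = ae_rep_ae_class(1)[OF m(1)] ae_rep_ae_class(1)[OF m(2)]
  have "AE x in M. ae_rep (ae_class M f) x + ae_rep (ae_class M g) x = f x + g x"
    using ae_rep_ae_class(2)[OF m(1)] ae_rep_ae_class(2)[OF m(2)] by eventually_elim simp
  then show ?thesis by (simp add: L2_def ae_class_eq_iff)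
qed

lemma L2_scale:
  assumes f: "f \<in> l2_functions M"
  shows "space_scale (L2 M) c (ae_class M f) = ae_class M (\<lambda>x. c * f x)"
proof -
  note m [measurable] = f[THEN l2_functions_measurable]
  note [measurable] = ae_rep_ae_class(1)[OF m]
  show ?thesis using ae_rep_ae_class(2)[OF m] by (simp add: L2_def ae_class_eq_iff)
qed

lemma L2_inner:
  assumes f: "f \<in> l2_functions M" and g: "g \<in> l2_functions M"
  shows "space_inner (L2 M) (ae_class M f) (ae_class M g) = (\<integral>x. f x * cnj (g x) \<partial>M)"
proof -
  note m [measurable] = f[THEN l2_functions_measurable] g[THEN l2_functions_measurable]
  note [measurable] = ae_rep_ae_class(1)[OF m(1)] ae_rep_ae_class(1)[OF m(2)]
  have "(\<integral>x. ae_rep (ae_class M f) x * cnj (ae_rep (ae_class M g) x) \<partial>M) = (\<integral>x. f x * cnj (g x) \<partial>M)"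
    using ae_rep_ae_class(2)[OF m(1)] ae_rep_ae_class(2)[OF m(2)]
    by (intro integral_cong_AE) auto
  then show ?thesis by (simp add: L2_def)
qed

lemma L2_inner_self:
  assumes f: "f \<in> l2_functions M"
  shows "space_inner (L2 M) (ae_class M f) (ae_class M f) = of_real (\<integral>x. (cmod (f x))\<^sup>2 \<partial>M)"
  unfolding L2_inner[OF f f] complex_norm_square[symmetric] 
  using f by (intro integral_of_real) (simp add: l2_functions_def)

lemma L2_norm:
  assumes f: "f \<in> l2_functions M"
  shows "space_norm (L2 M) (ae_class M f) = sqrt (\<integral>x. (cmod (f x))\<^sup>2 \<partial>M)"
  by (simp add: space_norm_def L2_inner_self[OF f])

lemma L2_norm_sq:
  assumes f: "f \<in> l2_functions M"
  shows "ennreal ((space_norm (L2 M) (ae_class M f))\<^sup>2) = (\<integral>\<^sup>+x. ennreal ((cmod (f x))\<^sup>2) \<partial>M)"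
  by (simp add: L2_norm[OF f] l2_nn_integral[OF f])

lemma L2_norm_le_iff:
  assumes f: "f \<in> l2_functions M" and "0 \<le> t"
  shows "space_norm (L2 M) (ae_class M f) \<le> t \<longleftrightarrow> (\<integral>\<^sup>+x. ennreal ((cmod (f x))\<^sup>2) \<partial>M) \<le> ennreal (t\<^sup>2)"
proof -
  have "sqrt a \<le> t \<longleftrightarrow> a \<le> t\<^sup>2" for a
    using \<open>0 \<le> t\<close> real_sqrt_le_iff[of a "t\<^sup>2"] by simp
  then show ?thesis by (simp add: L2_norm[OF f] l2_nn_integral[OF f])
qed

lemma zero_l2: "(\<lambda>x. 0) \<in> l2_functions M"
  by (simp add: l2_functions_def)

interpretation L2: pre_hilbert "L2 M"
proof
  show "space_zero (L2 M) \<in> space_carrier (L2 M)"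
    using zero_l2 by (auto simp: L2_carrier L2_zero)
next
  fix X Y assume "X \<in> space_carrier (L2 M)" "Y \<in> space_carrier (L2 M)"
  then show "space_add (L2 M) X Y \<in> space_carrier (L2 M)"
    by (auto simp: L2_carrier L2_add intro!: bexI[OF _ l2_add])
next
  fix X c assume "X \<in> space_carrier (L2 M)"
  then show "space_scale (L2 M) c X \<in> space_carrier (L2 M)"
    by (auto simp: L2_carrier L2_scale intro!: bexI[OF _ l2_scale])
next
  fix X assume "X \<in> space_carrier (L2 M)"
  then show "space_inner (L2 M) (space_zero (L2 M)) X = 0"
    by (auto simp: L2_carrier L2_zero L2_inner zero_l2)
next
  fix X Y Z assume "X \<in> space_carrier (L2 M)" "Y \<in> space_carrier (L2 M)" "Z \<in> space_carrier (L2 M)"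
  then obtain f g h where fgh: "f \<in> l2_functions M" "g \<in> l2_functions M" "h \<in> l2_functions M"
    and eq: "X = ae_class M f" "Y = ae_class M g" "Z = ae_class M h" by (auto simp: L2_carrier)
  show "space_inner (L2 M) (space_add (L2 M) X Y) Z = space_inner (L2 M) X Z + space_inner (L2 M) Y Z"
    using fgh l2_cnj_mult_integrable[OF fgh(1,3)] l2_cnj_mult_integrable[OF fgh(2,3)]
    by (simp add: eq L2_add L2_inner l2_add distrib_right)
next
  fix X Y c assume "X \<in> space_carrier (L2 M)" "Y \<in> space_carrier (L2 M)"
  then obtain f g where fg: "f \<in> l2_functions M" "g \<in> l2_functions M"
    and eq: "X = ae_class M f" "Y = ae_class M g" by (auto simp: L2_carrier)
  show "space_inner (L2 M) (space_scale (L2 M) c X) Y = c * space_inner (L2 M) X Y"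
    using fg by (simp add: eq L2_scale L2_inner l2_scale mult.assoc)
next
  fix X Y assume "X \<in> space_carrier (L2 M)" "Y \<in> space_carrier (L2 M)"
  then obtain f g where fg: "f \<in> l2_functions M" "g \<in> l2_functions M"
    and eq: "X = ae_class M f" "Y = ae_class M g" by (auto simp: L2_carrier)
  show "space_inner (L2 M) X Y = cnj (space_inner (L2 M) Y X)"
    using fg Bochner_Integration.integral_cnj[of M "\<lambda>x. g x * cnj (f x)"] by (simp add: eq L2_inner mult.commute)
next
  fix X assume "X \<in> space_carrier (L2 M)"
  then show "0 \<le> Re (space_inner (L2 M) X X)" by (auto simp: L2_carrier L2_inner_self)
next
  fix X Y assume "X \<in> space_carrier (L2 M)" "Y \<in> space_carrier (L2 M)"
    and ext: "\<And>Z. Z \<in> space_carrier (L2 M) \<Longrightarrow> space_inner (L2 M) X Z = space_inner (L2 M) Y Z"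
  then obtain f g where f: "f \<in> l2_functions M" and g: "g \<in> l2_functions M"
    and eq: "X = ae_class M f" "Y = ae_class M g" by (auto simp: L2_carrier)
  define d where "d x = f x + (-1) * g x" for x
  have d: "d \<in> l2_functions M" unfolding d_def by (intro l2_add l2_scale f g)
  have "(\<integral>x. f x * cnj (d x) \<partial>M) = (\<integral>x. g x * cnj (d x) \<partial>M)"
    using ext[of "ae_class M d"] f g d by (auto simp: eq L2_inner L2_carrier)
  then have "(\<integral>x. d x * cnj (d x) \<partial>M) = 0"
    using l2_cnj_mult_integrable[OF f d] l2_cnj_mult_integrable[OF g d]
    by (subst (1) d_def) (simp add: left_diff_distrib)
  then have "(\<integral>x. (cmod (d x))\<^sup>2 \<partial>M) = 0"
    using L2_inner_self[OF d] L2_inner[OF d d] by simp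
  then have "AE x in M. (cmod (d x))\<^sup>2 = 0"
    using d by (subst (asm) integral_nonneg_eq_0_iff_AE) (auto simp: l2_functions_def)
  then show "X = Y" unfolding eq
    by (subst ae_class_eq_iff) (auto simp: d_def f g l2_functions_measurable elim!: eventually_mono)
qed

section \<open>Operators of conditional rank one\<close>

text \<open>
  Writing \<open>(k, p, q)\<close> for this operator, the rules below are
  \<open>(k, p, q)\<^sup>* = (cnj k, q, p)\<close>, \<open>(k, p, q) (l, r, s) = (k l E(cnj q * r), p, s)\<close>, and
  \<open>\<parallel>(k, p, q)\<parallel>\<close> is the essential supremum of \<open>|k|\<close> over \<open>S\<close>.  Thus adjoints, products
  and with them roots, polar decomposition and Aluthge transformation amount to computations with weights.
\<close>

definition cond_op :: "'a measure \<Rightarrow> 'a measure \<Rightarrow> ('a \<Rightarrow> complex) \<Rightarrow> ('a \<Rightarrow> complex) \<Rightarrow> ('a \<Rightarrow> complex)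
    \<Rightarrow> ('a \<Rightarrow> complex) set \<Rightarrow> ('a \<Rightarrow> complex) set" where
  "cond_op M F k p q = (\<lambda>X\<in>space_carrier (L2 M). ae_class M (cond_ker M F k p q (ae_rep X)))"

lemma cond_op_extensional: "X \<notin> space_carrier (L2 M) \<Longrightarrow> cond_op M F k p q X = undefined"
  by (simp add: cond_op_def)

context sigma_finite_subalgebra
begin

lemma cond_unit_eq_0_outside:
  assumes p: "cond_unit M F S p"
  shows "AE x in M. x \<notin> S \<longrightarrow> p x = 0"
proof -
  note [measurable] = cond_unit_measurable[OF p]
  have "AE x in M. nn_cond_exp M F (\<lambda>y. ennreal ((cmod (p y))\<^sup>2)) x = 0 \<longrightarrow> ennreal ((cmod (p x))\<^sup>2) = 0"
    by (rule nn_cond_exp_eq_0_imp) auto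
  with p[unfolded cond_unit_def, THEN conjunct2] show ?thesis
    by eventually_elim auto
qed

lemma cond_ker_cong:
  assumes [measurable]: "k \<in> borel_measurable F" "k' \<in> borel_measurable F" and p: "cond_unit M F S p"
    and q: "q \<in> borel_measurable M" and f: "f \<in> borel_measurable M" and g: "g \<in> borel_measurable M"
    and k: "AE x in M. x \<in> S \<longrightarrow> k x = k' x" and fg: "AE x in M. f x = g x"
  shows "AE x in M. cond_ker M F k p q f x = cond_ker M F k' p q g x"
proof -
  note [measurable] = q f g
  have "AE x in M. complex_cond_exp M F (\<lambda>y. cnj (q y) * f y) x = complex_cond_exp M F (\<lambda>y. cnj (q y) * g y) x"
    using fg by (intro complex_cond_exp_cong) auto
  with k cond_unit_eq_0_outside[OF p] show ?thesis
    by eventually_elim (auto simp: cond_ker_def)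
qed

lemma cond_op_class:
  assumes k: "ess_bounded M F k" and p: "cond_unit M F S p" and q: "cond_unit M F S q"
    and f: "f \<in> l2_functions M"
  shows "cond_op M F k p q (ae_class M f) = ae_class M (cond_ker M F k p q f)"
proof -
  have kF: "k \<in> borel_measurable F" using k by (simp add: ess_bounded_def)
  note m = l2_functions_measurable[OF f]
  have "AE x in M. cond_ker M F k p q (ae_rep (ae_class M f)) x = cond_ker M F k p q f x"
    by (rule cond_ker_cong[OF kF kF p cond_unit_measurable[OF q] ae_rep_ae_class(1)[OF m] m _ ae_rep_ae_class(2)[OF m]]) simp
  moreover have "ae_class M f \<in> space_carrier (L2 M)" using f by (auto simp: L2_carrier)
  ultimately show ?thesis
    using cond_ker_measurable[OF kF p] by (simp add: cond_op_def ae_class_eq_iff)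
qed

text \<open>
  Only the values of the weight on \<open>S\<close> matter, as \<open>p\<close> vanishes almost everywhere outside \<open>S\<close>.
\<close>

lemma cond_op_cong:
  assumes k: "ess_bounded M F k" and k': "ess_bounded M F k'"
    and p: "cond_unit M F S p" and q: "cond_unit M F S q"
    and eq: "AE x in M. x \<in> S \<longrightarrow> k x = k' x"
  shows "cond_op M F k p q = cond_op M F k' p q"
proof
  fix X
  have kF: "k \<in> borel_measurable F" "k' \<in> borel_measurable F" using k k' by (auto simp: ess_bounded_def)
  show "cond_op M F k p q X = cond_op M F k' p q X"
  proof (cases "X \<in> space_carrier (L2 M)")
    case True
    then obtain f where f: "f \<in> l2_functions M" "X = ae_class M f" by (rule L2_carrierE)
    note m = l2_functions_measurable[OF f(1)]
    have "AE x in M. cond_ker M F k p q f x = cond_ker M F k' p q f x"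
      by (rule cond_ker_cong[OF kF p cond_unit_measurable[OF q] m m eq]) simp
    then show ?thesis
      using cond_ker_measurable[OF kF(1) p] cond_ker_measurable[OF kF(2) p]
      by (simp add: f cond_op_class[OF k p q f(1)] cond_op_class[OF k' p q f(1)] ae_class_eq_iff)
  qed (simp add: cond_op_extensional)
qed

lemma cond_op_closed:
  assumes k: "ess_bounded M F k" and p: "cond_unit M F S p" and q: "cond_unit M F S q"
    and X: "X \<in> space_carrier (L2 M)"
  shows "cond_op M F k p q X \<in> space_carrier (L2 M)"
  using X
proof (rule L2_carrierE)
  fix f assume f: "f \<in> l2_functions M" "X = ae_class M f"
  then show ?thesis using cond_ker_l2[OF k p q f(1)] by (auto simp: cond_op_class[OF k p q] L2_carrier)
qed

lemma cond_op_norm_le: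
  assumes k: "ess_bounded M F k" and p: "cond_unit M F S p" and q: "cond_unit M F S q"
    and X: "X \<in> space_carrier (L2 M)" and C: "0 \<le> C" "AE x in M. x \<in> S \<longrightarrow> cmod (k x) \<le> C"
  shows "space_norm (L2 M) (cond_op M F k p q X) \<le> C * space_norm (L2 M) X"
  using X
proof (rule L2_carrierE)
  fix f assume f: "f \<in> l2_functions M" "X = ae_class M f"
  have kF: "k \<in> borel_measurable F" using k by (simp add: ess_bounded_def)
  have "(\<integral>\<^sup>+x. ennreal ((cmod (cond_ker M F k p q f x))\<^sup>2) \<partial>M) \<le>
      ennreal (C\<^sup>2) * (\<integral>\<^sup>+x. ennreal ((cmod (f x))\<^sup>2) \<partial>M)"
    by (rule cond_ker_nn_integral_le[OF kF C(2) p q f(1)])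
  also have "\<dots> = ennreal ((C * space_norm (L2 M) X)\<^sup>2)"
    by (simp add: f(2) L2_norm_sq[OF f(1), symmetric] power_mult_distrib ennreal_mult)
  finally show ?thesis unfolding f(2) cond_op_class[OF k p q f(1)]
    using C(1) L2.norm_nonneg[OF X[unfolded f(2)]] by (subst L2_norm_le_iff[OF cond_ker_l2[OF k p q f(1)]]) auto
qed

lemma cond_op_bounded:
  assumes k: "ess_bounded M F k" and p: "cond_unit M F S p" and q: "cond_unit M F S q"
  shows "bounded_op (L2 M) (cond_op M F k p q)"
  unfolding bounded_op_def
proof (intro conjI ballI allI PiE_I)
  fix X assume "X \<in> space_carrier (L2 M)"
  then show "cond_op M F k p q X \<in> space_carrier (L2 M)" by (rule cond_op_closed[OF k p q])
next
  fix X assume "X \<notin> space_carrier (L2 M)"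
  then show "cond_op M F k p q X = undefined" by (rule cond_op_extensional)
next
  fix X Y assume "X \<in> space_carrier (L2 M)" "Y \<in> space_carrier (L2 M)"
  then obtain f g where f: "f \<in> l2_functions M" "X = ae_class M f"
    and g: "g \<in> l2_functions M" "Y = ae_class M g" by (meson L2_carrierE)
  have kF: "k \<in> borel_measurable F" using k by (simp add: ess_bounded_def)
  note [measurable] = cond_ker_measurable[OF kF p]
  have "AE x in M. complex_cond_exp M F (\<lambda>y. cnj (q y) * f y + cnj (q y) * g y) x =
      complex_cond_exp M F (\<lambda>y. cnj (q y) * f y) x + complex_cond_exp M F (\<lambda>y. cnj (q y) * g y) x"
    by (intro complex_cond_exp_add cond_l2_cnj_mult cond_unit_cond_l2[OF q] l2_cond_l2 f g)
  then have "AE x in M. cond_ker M F k p q (\<lambda>x. f x + g x) x = cond_ker M F k p q f x + cond_ker M F k p q g x"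
    by eventually_elim (simp add: cond_ker_def algebra_simps)
  then show "cond_op M F k p q (space_add (L2 M) X Y) =
      space_add (L2 M) (cond_op M F k p q X) (cond_op M F k p q Y)"
    by (simp add: f g L2_add l2_add cond_op_class[OF k p q] cond_ker_l2[OF k p q] ae_class_eq_iff)
next
  fix c X assume "X \<in> space_carrier (L2 M)"
  then obtain f where f: "f \<in> l2_functions M" "X = ae_class M f" by (rule L2_carrierE)
  have kF: "k \<in> borel_measurable F" using k by (simp add: ess_bounded_def)
  note [measurable] = cond_ker_measurable[OF kF p]
  have "AE x in M. complex_cond_exp M F (\<lambda>y. c * (cnj (q y) * f y)) x =
      c * complex_cond_exp M F (\<lambda>y. cnj (q y) * f y) x"
    by (intro complex_cond_exp_mult cond_l2_cnj_mult cond_unit_cond_l2[OF q] l2_cond_l2 f) auto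
  then have "AE x in M. cond_ker M F k p q (\<lambda>x. c * f x) x = c * cond_ker M F k p q f x"
    by eventually_elim (simp add: cond_ker_def mult.left_commute)
  then show "cond_op M F k p q (space_scale (L2 M) c X) = space_scale (L2 M) c (cond_op M F k p q X)"
    by (simp add: f L2_scale l2_scale cond_op_class[OF k p q] cond_ker_l2[OF k p q] ae_class_eq_iff)
next
  obtain C where C: "0 \<le> C" "AE x in M. cmod (k x) \<le> C" using ess_bounded_obtain[OF k] .
  have "AE x in M. x \<in> S \<longrightarrow> cmod (k x) \<le> C" using C(2) by eventually_elim simp
  then show "\<exists>K. \<forall>X\<in>space_carrier (L2 M). space_norm (L2 M) (cond_op M F k p q X) \<le> K * space_norm (L2 M) X"
    using cond_op_norm_le[OF k p q _ C(1)] by blast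
qed

lemma cond_op_apply_comp:
  assumes k: "ess_bounded M F k" and l: "ess_bounded M F l"
    and p: "cond_unit M F S p" and q: "cond_unit M F S q" and r: "cond_unit M F S r" and s: "cond_unit M F S s"
    and X: "X \<in> space_carrier (L2 M)"
  shows "cond_op M F k p q (cond_op M F l r s X) =
    cond_op M F (\<lambda>x. k x * l x * complex_cond_exp M F (\<lambda>y. cnj (q y) * r y) x) p s X"
  using X
proof (rule L2_carrierE)
  fix f assume f: "f \<in> l2_functions M" "X = ae_class M f"
  let ?kl = "\<lambda>x. k x * l x * complex_cond_exp M F (\<lambda>y. cnj (q y) * r y) x"
  have kF [measurable]: "k \<in> borel_measurable F" "l \<in> borel_measurable F" using k l by (auto simp: ess_bounded_def)
  have kl: "ess_bounded M F ?kl" by (intro ess_bounded_mult k l cond_unit_inner_ess_bounded[OF q r])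
  have klF: "?kl \<in> borel_measurable F" using kl by (simp add: ess_bounded_def)
  let ?c = "\<lambda>x. l x * complex_cond_exp M F (\<lambda>y. cnj (s y) * f y) x"
  have "AE x in M. complex_cond_exp M F (\<lambda>x. ?c x * (cnj (q x) * r x)) x =
      ?c x * complex_cond_exp M F (\<lambda>x. cnj (q x) * r x) x"
    by (intro complex_cond_exp_mult cond_l2_cnj_mult cond_unit_cond_l2[OF q] cond_unit_cond_l2[OF r]) measurable
  then have "AE x in M. cond_ker M F k p q (cond_ker M F l r s f) x = cond_ker M F ?kl p s f x"
    by eventually_elim (simp add: cond_ker_def ac_simps)
  then show ?thesis
    using cond_ker_measurable[OF kF(1) p] cond_ker_measurable[OF klF p]
    by (simp add: f cond_op_class[OF l r s f(1)] cond_op_class[OF k p q cond_ker_l2[OF l r s f(1)]]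
      cond_op_class[OF kl p s f(1)] ae_class_eq_iff)
qed

lemma cond_op_comp:
  assumes k: "ess_bounded M F k" and l: "ess_bounded M F l"
    and p: "cond_unit M F S p" and q: "cond_unit M F S q" and r: "cond_unit M F S r" and s: "cond_unit M F S s"
  shows "op_comp (L2 M) (cond_op M F k p q) (cond_op M F l r s) =
    cond_op M F (\<lambda>x. k x * l x * complex_cond_exp M F (\<lambda>y. cnj (q y) * r y) x) p s"
proof
  fix X
  show "op_comp (L2 M) (cond_op M F k p q) (cond_op M F l r s) X =
    cond_op M F (\<lambda>x. k x * l x * complex_cond_exp M F (\<lambda>y. cnj (q y) * r y) x) p s X"
    using cond_op_apply_comp[OF assms]
    by (cases "X \<in> space_carrier (L2 M)") (simp_all add: op_comp_def compose_def cond_op_extensional)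
qed

lemma cond_op_inner:
  assumes k: "ess_bounded M F k" and p: "cond_unit M F S p" and q: "cond_unit M F S q"
    and X: "X \<in> space_carrier (L2 M)" and Y: "Y \<in> space_carrier (L2 M)"
  shows "space_inner (L2 M) (cond_op M F k p q X) Y =
    space_inner (L2 M) X (cond_op M F (\<lambda>x. cnj (k x)) q p Y)"
proof -
  have k': "ess_bounded M F (\<lambda>x. cnj (k x))" using k by (auto simp: ess_bounded_def)
  obtain f g where f: "f \<in> l2_functions M" "X = ae_class M f"
    and g: "g \<in> l2_functions M" "Y = ae_class M g" using X Y by (meson L2_carrierE)
  have "(\<integral>x. cond_ker M F k p q f x * cnj (g x) \<partial>M) =
      cnj (\<integral>x. cond_ker M F (\<lambda>x. cnj (k x)) q p g x * cnj (f x) \<partial>M)"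
    unfolding cond_ker_inner[OF k p q f(1) g(1)] cond_ker_inner[OF k' q p g(1) f(1)]
    unfolding Bochner_Integration.integral_cnj[symmetric]
    by (simp add: ac_simps)
  also have "\<dots> = (\<integral>x. f x * cnj (cond_ker M F (\<lambda>x. cnj (k x)) q p g x) \<partial>M)"
    unfolding Bochner_Integration.integral_cnj[symmetric] by (simp add: ac_simps)
  finally show ?thesis
    by (simp add: f g cond_op_class[OF k p q] cond_op_class[OF k' q p] L2_inner
      cond_ker_l2[OF k p q] cond_ker_l2[OF k' q p])
qed

lemma cond_op_adjoint:
  assumes k: "ess_bounded M F k" and p: "cond_unit M F S p" and q: "cond_unit M F S q"
  shows "op_adjoint (L2 M) (cond_op M F k p q) = cond_op M F (\<lambda>x. cnj (k x)) q p"
proof (rule L2.adjoint_eqI)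
  have "ess_bounded M F (\<lambda>x. cnj (k x))" using k by (auto simp: ess_bounded_def)
  then show "bounded_op (L2 M) (cond_op M F (\<lambda>x. cnj (k x)) q p)" by (rule cond_op_bounded[OF _ q p])
qed (rule cond_op_inner[OF k p q])

section \<open>Norms of conditional rank one operators\<close>

text \<open>
  Test vectors for lower bounds of norms: the operator \<open>(k, p, q)\<close> maps \<open>q\<close>, restricted to \<open>B\<close>, to \<open>k p\<close>
  restricted to \<open>B \<inter> S\<close>, and the norm of this test vector is at most the root of the measure of \<open>B\<close>.
\<close>

lemma cond_unit_localized:
  assumes q: "cond_unit M F S q" and B: "B \<in> sets F" and fin: "emeasure M B < \<infinity>"
  defines "h \<equiv> \<lambda>x. indicator B x * q x"
  shows "h \<in> l2_functions M"
    and "(\<integral>\<^sup>+x. ennreal ((cmod (h x))\<^sup>2) \<partial>M) \<le> emeasure M B"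
    and "AE x in M. complex_cond_exp M F (\<lambda>y. cnj (q y) * h y) x = indicator B x * indicator S x"
proof -
  note [measurable] = cond_unit_measurable[OF q] B
  have [measurable]: "B \<in> sets M" using B subalg by (auto simp: subalgebra_def)
  have hm [measurable]: "h \<in> borel_measurable M" unfolding h_def by measurable
  have "(\<integral>\<^sup>+x. ennreal ((cmod (h x))\<^sup>2) \<partial>M) = (\<integral>\<^sup>+x. indicator B x * ennreal ((cmod (q x))\<^sup>2) \<partial>M)"
    by (rule nn_integral_cong) (simp add: h_def indicator_def)
  also have "\<dots> = (\<integral>\<^sup>+x. indicator B x * nn_cond_exp M F (\<lambda>x. ennreal ((cmod (q x))\<^sup>2)) x \<partial>M)"
    by (rule nn_cond_exp_intg[symmetric]) auto
  also have "\<dots> \<le> (\<integral>\<^sup>+x. indicator B x \<partial>M)"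
    using q[unfolded cond_unit_def, THEN conjunct2]
    by (intro nn_integral_mono_AE) (auto elim!: eventually_mono simp: indicator_def)
  finally show le: "(\<integral>\<^sup>+x. ennreal ((cmod (h x))\<^sup>2) \<partial>M) \<le> emeasure M B" by simp
  then show "h \<in> l2_functions M" using fin by (auto simp: l2_iff_nn_integral intro: le_less_trans)
  have "AE x in M. complex_cond_exp M F (\<lambda>y. indicator B y * (cnj (q y) * q y)) x =
      indicator B x * complex_cond_exp M F (\<lambda>y. cnj (q y) * q y) x"
    by (intro complex_cond_exp_mult cond_l2_cnj_mult cond_unit_cond_l2[OF q]) measurable
  with cond_unit_self_inner[OF q]
  show "AE x in M. complex_cond_exp M F (\<lambda>y. cnj (q y) * h y) x = indicator B x * indicator S x"
    unfolding h_def by eventually_elim (simp add: ac_simps)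
qed

text \<open>
  An upper bound of \<open>|k|\<close> on \<open>S\<close> bounds the operator because \<open>f \<mapsto> E(cnj q * f)\<close> is a contraction.
  Conversely, testing a bound \<open>t\<close> of the operator on \<open>q\<close> restricted to \<open>B\<close> yields
  \<open>\<integral>|k|\<^sup>2 \<le> t\<^sup>2 \<integral>1\<close> over \<open>B \<inter> S\<close> and \<open>B\<close>, for all \<open>B\<close> of finite measure in \<open>F\<close>.
\<close>

lemma cond_op_norm_le_iff:
  assumes S: "S \<in> sets F" and k: "ess_bounded M F k" and p: "cond_unit M F S p" and q: "cond_unit M F S q"
    and t: "0 \<le> t"
  shows "op_norm (L2 M) (cond_op M F k p q) \<le> t \<longleftrightarrow> (AE x in M. x \<in> S \<longrightarrow> cmod (k x) \<le> t)"
proof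
  assume "AE x in M. x \<in> S \<longrightarrow> cmod (k x) \<le> t"
  then show "op_norm (L2 M) (cond_op M F k p q) \<le> t"
    using cond_op_norm_le[OF k p q _ t] by (simp add: L2.op_norm_le_iff[OF cond_op_bounded[OF k p q] t])
next
  assume le: "op_norm (L2 M) (cond_op M F k p q) \<le> t"
  have kF [measurable]: "k \<in> borel_measurable F" using k by (simp add: ess_bounded_def)
  note [measurable] = S
  have "AE x in M. ennreal ((cmod (k x))\<^sup>2) * indicator S x \<le> ennreal (t\<^sup>2)"
  proof (rule AE_le_of_set_nn_integral_le)
    fix B assume B: "B \<in> sets F" and fin: "emeasure M B < \<infinity>"
    have [measurable]: "B \<in> sets M" using B subalg by (auto simp: subalgebra_def)
    let ?h = "\<lambda>x. indicator B x * q x"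
    note h = cond_unit_localized[OF q B fin]
    have hC: "ae_class M ?h \<in> space_carrier (L2 M)" using h(1) by (auto simp: L2_carrier)
    have "(\<integral>\<^sup>+x. ennreal ((cmod (k x))\<^sup>2) * indicator S x * indicator B x \<partial>M) =
        (\<integral>\<^sup>+x. ennreal ((cmod (k x * complex_cond_exp M F (\<lambda>y. cnj (q y) * ?h y) x))\<^sup>2) * indicator S x \<partial>M)"
      using h(3) by (intro nn_integral_cong_AE) (auto elim!: eventually_mono simp: indicator_def)
    also have "\<dots> = ennreal ((space_norm (L2 M) (cond_op M F k p q (ae_class M ?h)))\<^sup>2)"
      by (simp only: cond_ker_nn_integral[OF kF p, symmetric] cond_op_class[OF k p q h(1)]
        L2_norm_sq[OF cond_ker_l2[OF k p q h(1)]])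
    also have "\<dots> \<le> ennreal ((t * space_norm (L2 M) (ae_class M ?h))\<^sup>2)"
      using le hC L2.norm_nonneg[OF cond_op_closed[OF k p q hC]]
      unfolding L2.op_norm_le_iff[OF cond_op_bounded[OF k p q] t]
      by (intro ennreal_leI power_mono) auto
    also have "\<dots> = ennreal (t\<^sup>2) * (\<integral>\<^sup>+x. ennreal ((cmod (?h x))\<^sup>2) \<partial>M)"
      by (simp only: power_mult_distrib L2_norm_sq[OF h(1), symmetric]) (simp add: ennreal_mult)
    also have "\<dots> \<le> ennreal (t\<^sup>2) * emeasure M B"
      by (intro mult_left_mono h(2)) simp
    also have "\<dots> = (\<integral>\<^sup>+x. ennreal (t\<^sup>2) * indicator B x \<partial>M)"
      by (simp add: nn_integral_cmult_indicator)
    finally show "(\<integral>\<^sup>+x. ennreal ((cmod (k x))\<^sup>2) * indicator S x * indicator B x \<partial>M) \<le>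
        (\<integral>\<^sup>+x. ennreal (t\<^sup>2) * indicator B x \<partial>M)" .
  qed auto
  then show "AE x in M. x \<in> S \<longrightarrow> cmod (k x) \<le> t"
  proof eventually_elim
    case (elim x)
    show ?case
    proof
      assume "x \<in> S"
      then have "(cmod (k x))\<^sup>2 \<le> t\<^sup>2" using elim by simp
      then show "cmod (k x) \<le> t" using t by (rule power2_le_imp_le)
    qed
  qed
qed

lemma cond_op_norm_AE:
  assumes "S \<in> sets F" and k: "ess_bounded M F k" and p: "cond_unit M F S p" and q: "cond_unit M F S q"
  shows "AE x in M. x \<in> S \<longrightarrow> cmod (k x) \<le> op_norm (L2 M) (cond_op M F k p q)"
  using cond_op_norm_le_iff[OF assms L2.op_norm_nonneg[OF cond_op_bounded[OF k p q]]] by simp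

lemma esssup_eq_cond_op_norm:
  assumes S: "S \<in> sets F" and k: "ess_bounded M F k" and p: "cond_unit M F S p" and q: "cond_unit M F S q"
    and g: "g \<in> borel_measurable M" and gk: "AE x in M. g x = ennreal (cmod (k x)) * indicator S x"
  shows "esssup M g = ennreal (op_norm (L2 M) (cond_op M F k p q))"
proof (rule antisym)
  show le: "esssup M g \<le> ennreal (op_norm (L2 M) (cond_op M F k p q))"
    using g
  proof (rule esssup_I)
    show "AE x in M. g x \<le> ennreal (op_norm (L2 M) (cond_op M F k p q))"
      using gk cond_op_norm_AE[OF S k p q]
      by eventually_elim (auto simp: indicator_def intro: ennreal_leI)
  qed
  then have "esssup M g < \<infinity>" using le_less_trans ennreal_less_top by fastforce
  then obtain r where r: "esssup M g = ennreal r" "0 \<le> r" by (cases "esssup M g") auto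
  have "AE x in M. x \<in> S \<longrightarrow> cmod (k x) \<le> r"
    using esssup_AE[of g M] gk unfolding r(1) by eventually_elim (auto simp: r(2))
  then show "ennreal (op_norm (L2 M) (cond_op M F k p q)) \<le> esssup M g"
    using cond_op_norm_le_iff[OF S k p q r(2)] by (simp add: r ennreal_leI)
qed

section \<open>Powers and normaloid operators\<close>

lemma ess_bounded_power: "ess_bounded M F k \<Longrightarrow> ess_bounded M F (\<lambda>x. k x ^ n)"
proof (induction n)
  case 0
  show ?case by (auto simp: ess_bounded_def)
next
  case (Suc n)
  then show ?case using ess_bounded_mult[of M F k "\<lambda>x. k x ^ n"] by simp
qed

lemma cond_op_funpow:
  assumes k: "ess_bounded M F k" and p: "cond_unit M F S p" and q: "cond_unit M F S q"
    and X: "X \<in> space_carrier (L2 M)"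
  shows "(cond_op M F k p q ^^ Suc n) X =
    cond_op M F (\<lambda>x. k x * (k x * complex_cond_exp M F (\<lambda>y. cnj (q y) * p y) x) ^ n) p q X"
proof (induction n)
  case (Suc n)
  let ?c = "complex_cond_exp M F (\<lambda>y. cnj (q y) * p y)"
  have "(cond_op M F k p q ^^ Suc (Suc n)) X = cond_op M F k p q ((cond_op M F k p q ^^ Suc n) X)" by simp
  also have "\<dots> = cond_op M F (\<lambda>x. k x * (k x * (k x * ?c x) ^ n) * ?c x) p q X"
    unfolding Suc.IH
    by (intro cond_op_apply_comp[OF k _ p q p q X] ess_bounded_mult[OF k] ess_bounded_power
      cond_unit_inner_ess_bounded[OF q p])
  also have "(\<lambda>x. k x * (k x * (k x * ?c x) ^ n) * ?c x) = (\<lambda>x. k x * (k x * ?c x) ^ Suc n)"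
    by (simp add: ac_simps)
  finally show ?case .
qed simp

text \<open>
  Let \<open>N\<close> and \<open>Q\<close> be the essential suprema over \<open>S\<close> of \<open>|k|\<close> and \<open>|k c|\<close>.  By the product rule the weight of
  the power \<open>n + 1\<close> is \<open>k (k c)\<^sup>n\<close>, and since \<open>|c| \<le> 1\<close>,
  \<open>|k c|\<^sup>n\<^sup>+\<^sup>1 \<le> |k (k c)\<^sup>n| \<le> N Q\<^sup>n\<close>.  The norm of this power thus lies between
  \<open>Q\<^sup>n\<^sup>+\<^sup>1\<close> and \<open>N Q\<^sup>n\<close>.  If \<open>Q = N\<close>, both bounds are \<open>N\<^sup>n\<^sup>+\<^sup>1\<close>.  Conversely
  the square of a normaloid operator has norm \<open>N\<^sup>2 \<le> N Q\<close>, while always \<open>Q \<le> N\<close>.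
\<close>

lemma normaloid_cond_op_iff:
  assumes S: "S \<in> sets F" and k: "ess_bounded M F k" and p: "cond_unit M F S p" and q: "cond_unit M F S q"
  defines "c \<equiv> complex_cond_exp M F (\<lambda>y. cnj (q y) * p y)"
  shows "normaloid (L2 M) (cond_op M F k p q) \<longleftrightarrow>
    op_norm (L2 M) (cond_op M F (\<lambda>x. k x * c x) p q) = op_norm (L2 M) (cond_op M F k p q)"
proof -
  have c: "ess_bounded M F c" unfolding c_def by (rule cond_unit_inner_ess_bounded[OF q p])
  have c1: "AE x in M. cmod (c x) \<le> 1" unfolding c_def by (rule cond_unit_inner_le_1[OF q p])
  have kc: "ess_bounded M F (\<lambda>x. k x * c x)" by (rule ess_bounded_mult[OF k c])
  define N Q where "N = op_norm (L2 M) (cond_op M F k p q)"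
    and "Q = op_norm (L2 M) (cond_op M F (\<lambda>x. k x * c x) p q)"
  have N0: "0 \<le> N" and Q0: "0 \<le> Q"
    unfolding N_def Q_def by (intro L2.op_norm_nonneg cond_op_bounded[OF _ p q] k kc)+
  have kN: "AE x in M. x \<in> S \<longrightarrow> cmod (k x) \<le> N"
    unfolding N_def by (rule cond_op_norm_AE[OF S k p q])
  have kQ: "AE x in M. x \<in> S \<longrightarrow> cmod (k x * c x) \<le> Q"
    unfolding Q_def by (rule cond_op_norm_AE[OF S kc p q])
  define kn where "kn n = (\<lambda>x. k x * (k x * c x) ^ n)" for n
  have kn: "ess_bounded M F (kn n)" for n
    unfolding kn_def by (intro ess_bounded_mult k ess_bounded_power kc)
  define B where "B n = op_norm (L2 M) (cond_op M F (kn n) p q)" for n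
  have B0: "0 \<le> B n" for n unfolding B_def by (intro L2.op_norm_nonneg cond_op_bounded[OF kn p q])
  have B_le: "B n \<le> t \<longleftrightarrow> (AE x in M. x \<in> S \<longrightarrow> cmod (kn n x) \<le> t)" if "0 \<le> t" for n t
    unfolding B_def by (rule cond_op_norm_le_iff[OF S kn p q that])
  have power: "op_norm (L2 M) (cond_op M F k p q ^^ Suc n) = B n" for n
    unfolding B_def op_norm_def kn_def c_def
    by (intro SUP_cong refl) (simp add: cond_op_funpow[OF k p q] del: funpow.simps)
  have "normaloid (L2 M) (cond_op M F k p q) \<longleftrightarrow> (\<forall>n. N ^ Suc n = B n)"
    unfolding normaloid_def N_def[symmetric] power[symmetric]
    by (metis Suc_le_D One_nat_def Suc_le_mono le0)
  also have "\<dots> \<longleftrightarrow> Q = N"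
  proof
    assume pow: "\<forall>n. N ^ Suc n = B n"
    have "AE x in M. x \<in> S \<longrightarrow> cmod (k x * c x) \<le> N"
      using kN c1
    proof eventually_elim
      case (elim x)
      have "cmod (k x * c x) \<le> cmod (k x)"
        using mult_left_mono[OF elim(2), of "cmod (k x)"] by (simp add: norm_mult)
      then show ?case using elim(1) by auto
    qed
    then have QN: "Q \<le> N" unfolding Q_def using cond_op_norm_le_iff[OF S kc p q N0] by simp
    have "AE x in M. x \<in> S \<longrightarrow> cmod (kn 1 x) \<le> N * Q"
      using kN kQ by eventually_elim (auto simp: kn_def norm_mult intro!: mult_mono N0)
    then have "B 1 \<le> N * Q" using B_le[of "N * Q" 1] N0 Q0 by simp
    then have "N * N \<le> N * Q" using pow[rule_format, of 1] by simp
    then show "Q = N" using QN N0 Q0 by (cases "N = 0") auto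
  next
    assume eq: "Q = N"
    show "\<forall>n. N ^ Suc n = B n"
    proof
      fix n
      have "B n \<le> N ^ Suc n"
        unfolding B_le[OF zero_le_power[OF N0]] using kN kQ
      proof eventually_elim
        case (elim x)
        show ?case
        proof
          assume "x \<in> S"
          then have "cmod (k x) * cmod (k x * c x) ^ n \<le> N * N ^ n"
            using elim eq by (intro mult_mono power_mono) (auto simp: N0)
          then show "cmod (kn n x) \<le> N ^ Suc n" by (simp add: kn_def norm_mult norm_power)
        qed
      qed
      moreover have "N \<le> root (Suc n) (B n)"
      proof -
        have "AE x in M. x \<in> S \<longrightarrow> cmod (kn n x) \<le> B n" using B_le[OF B0[of n], of n] by simp
        then have "AE x in M. x \<in> S \<longrightarrow> cmod (k x * c x) \<le> root (Suc n) (B n)"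
          using c1
        proof eventually_elim
          case (elim x)
          show ?case
          proof
            assume x: "x \<in> S"
            have "cmod (k x * c x) \<le> cmod (k x)"
              using mult_left_mono[OF elim(2), of "cmod (k x)"] by (simp add: norm_mult)
            then have "cmod (k x * c x) ^ Suc n \<le> cmod (kn n x)"
              by (simp add: kn_def norm_mult[of "k x" "(k x * c x) ^ n"] norm_power mult_right_mono)
            then have "cmod (k x * c x) ^ Suc n \<le> B n" using elim(1) x by auto
            then have "root (Suc n) (cmod (k x * c x) ^ Suc n) \<le> root (Suc n) (B n)"
              by (intro real_root_le_mono) auto
            then show "cmod (k x * c x) \<le> root (Suc n) (B n)"
              by (simp add: real_root_power_cancel del: power_Suc)
          qed
        qed
        then have "Q \<le> root (Suc n) (B n)"
          unfolding Q_def using B0[of n] by (subst cond_op_norm_le_iff[OF S kc p q]) auto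
        then show ?thesis using eq by simp
      qed
      then have "N ^ Suc n \<le> root (Suc n) (B n) ^ Suc n" using N0 by (intro power_mono)
      then have "N ^ Suc n \<le> B n" using B0[of n] by (simp add: real_root_pow_pos2 del: power_Suc)
      ultimately show "N ^ Suc n = B n" by simp
    qed
  qed
  finally show ?thesis by (simp add: N_def Q_def)
qed

text \<open>
  For \<open>p = q\<close> the factor \<open>c\<close> is \<open>1\<close> on \<open>S\<close>, so the criterion holds trivially.
\<close>

corollary normaloid_cond_op_diagonal:
  assumes S: "S \<in> sets F" and k: "ess_bounded M F k" and p: "cond_unit M F S p"
  shows "normaloid (L2 M) (cond_op M F k p p)"
proof -
  have "AE x in M. x \<in> S \<longrightarrow> k x * complex_cond_exp M F (\<lambda>y. cnj (p y) * p y) x = k x"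
    using cond_unit_self_inner[OF p] by eventually_elim simp
  then have "cond_op M F (\<lambda>x. k x * complex_cond_exp M F (\<lambda>y. cnj (p y) * p y) x) p p = cond_op M F k p p"
    by (intro cond_op_cong[OF _ k p p] ess_bounded_mult[OF k] cond_unit_inner_ess_bounded[OF p p])
  then show ?thesis unfolding normaloid_cond_op_iff[OF S k p p] by simp
qed

section \<open>Absolute value, polar decomposition and Aluthge transformation\<close>

lemma ess_bounded_of_real:
  "ess_bounded M F (\<lambda>x. complex_of_real (\<kappa> x)) \<longleftrightarrow> \<kappa> \<in> borel_measurable F \<and> (\<exists>C. AE x in M. \<bar>\<kappa> x\<bar> \<le> C)"
proof -
  have "\<kappa> \<in> borel_measurable F" if [measurable]: "(\<lambda>x. complex_of_real (\<kappa> x)) \<in> borel_measurable F"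
  proof -
    have "(\<lambda>x. Re (complex_of_real (\<kappa> x))) \<in> borel_measurable F" by measurable
    then show ?thesis by simp
  qed
  moreover have "(\<lambda>x. complex_of_real (\<kappa> x)) \<in> borel_measurable F" if [measurable]: "\<kappa> \<in> borel_measurable F"
    by measurable
  ultimately have "(\<lambda>x. complex_of_real (\<kappa> x)) \<in> borel_measurable F \<longleftrightarrow> \<kappa> \<in> borel_measurable F" by blast
  then show ?thesis unfolding ess_bounded_def by simp
qed

lemma ess_bounded_sqrt:
  assumes "ess_bounded M F (\<lambda>x. complex_of_real (\<kappa> x))" and k0: "\<And>x. 0 \<le> \<kappa> x"
  shows "ess_bounded M F (\<lambda>x. complex_of_real (sqrt (\<kappa> x)))"
proof -
  from assms(1) obtain C where "\<kappa> \<in> borel_measurable F" and C: "AE x in M. \<bar>\<kappa> x\<bar> \<le> C"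
    by (auto simp: ess_bounded_of_real)
  moreover have "AE x in M. \<bar>sqrt (\<kappa> x)\<bar> \<le> sqrt C" using C by eventually_elim (simp add: k0)
  ultimately show ?thesis by (auto simp: ess_bounded_of_real)
qed

lemma cond_op_positive:
  assumes k: "ess_bounded M F (\<lambda>x. complex_of_real (\<kappa> x))" and k0: "\<And>x. 0 \<le> \<kappa> x" and e: "cond_unit M F S e"
  shows "positive_op (L2 M) (cond_op M F (\<lambda>x. complex_of_real (\<kappa> x)) e e)"
  unfolding positive_op_def
proof (intro conjI ballI cond_op_bounded[OF k e e])
  fix X assume "X \<in> space_carrier (L2 M)"
  then obtain f where f: "f \<in> l2_functions M" "X = ae_class M f" by (rule L2_carrierE)
  let ?c = "complex_cond_exp M F (\<lambda>y. cnj (e y) * f y)"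
  have "space_inner (L2 M) (cond_op M F (\<lambda>x. complex_of_real (\<kappa> x)) e e X) X =
      (\<integral>x. complex_of_real (\<kappa> x) * ?c x * cnj (?c x) \<partial>M)"
    by (simp add: f cond_op_class[OF k e e] L2_inner cond_ker_l2[OF k e e] cond_ker_inner[OF k e e])
  also have "\<dots> = (\<integral>x. complex_of_real (\<kappa> x * (cmod (?c x))\<^sup>2) \<partial>M)"
    by (intro Bochner_Integration.integral_cong refl) (simp add: complex_norm_square mult.assoc del: of_real_power)
  also have "\<dots> = of_real (\<integral>x. \<kappa> x * (cmod (?c x))\<^sup>2 \<partial>M)"
    by (rule integral_complex_of_real)
  also have "\<dots> \<in> \<real>\<^sub>\<ge>\<^sub>0" using k0 by (simp add: integral_nonneg)
  finally show "space_inner (L2 M) (cond_op M F (\<lambda>x. complex_of_real (\<kappa> x)) e e X) X \<in> \<real>\<^sub>\<ge>\<^sub>0" .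
qed

lemma cond_op_sqrt:
  assumes k: "ess_bounded M F (\<lambda>x. complex_of_real (\<kappa> x))" and k0: "\<And>x. 0 \<le> \<kappa> x" and e: "cond_unit M F S e"
  shows "op_sqrt (L2 M) (cond_op M F (\<lambda>x. complex_of_real (\<kappa> x)) e e) =
    cond_op M F (\<lambda>x. complex_of_real (sqrt (\<kappa> x))) e e"
proof (rule L2.op_sqrt_eqI)
  note sk = ess_bounded_sqrt[OF k k0]
  show "positive_op (L2 M) (cond_op M F (\<lambda>x. complex_of_real (sqrt (\<kappa> x))) e e)"
    by (rule cond_op_positive[OF sk _ e]) (simp add: k0)
  have "AE x in M. x \<in> S \<longrightarrow> complex_of_real (sqrt (\<kappa> x)) * complex_of_real (sqrt (\<kappa> x)) *
      complex_cond_exp M F (\<lambda>y. cnj (e y) * e y) x = complex_of_real (\<kappa> x)"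
    using cond_unit_self_inner[OF e] by eventually_elim (simp add: k0 flip: of_real_mult)
  then show "op_comp (L2 M) (cond_op M F (\<lambda>x. complex_of_real (sqrt (\<kappa> x))) e e)
      (cond_op M F (\<lambda>x. complex_of_real (sqrt (\<kappa> x))) e e) = cond_op M F (\<lambda>x. complex_of_real (\<kappa> x)) e e"
    unfolding cond_op_comp[OF sk sk e e e e]
    by (intro cond_op_cong[OF _ k e e] ess_bounded_mult sk cond_unit_inner_ess_bounded[OF e e])
qed

lemma cond_op_abs:
  assumes k: "ess_bounded M F (\<lambda>x. complex_of_real (\<kappa> x))" and k0: "\<And>x. 0 \<le> \<kappa> x"
    and v: "cond_unit M F S v" and e: "cond_unit M F S e"
  shows "op_abs (L2 M) (cond_op M F (\<lambda>x. complex_of_real (\<kappa> x)) v e) =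
    cond_op M F (\<lambda>x. complex_of_real (\<kappa> x)) e e"
proof -
  have k2: "ess_bounded M F (\<lambda>x. complex_of_real ((\<kappa> x)\<^sup>2))"
    using ess_bounded_mult[OF k k] by (simp add: power2_eq_square)
  have "AE x in M. x \<in> S \<longrightarrow> complex_of_real (\<kappa> x) * complex_of_real (\<kappa> x) *
      complex_cond_exp M F (\<lambda>y. cnj (v y) * v y) x = complex_of_real ((\<kappa> x)\<^sup>2)"
    using cond_unit_self_inner[OF v] by eventually_elim (simp add: power2_eq_square)
  then have "op_comp (L2 M) (op_adjoint (L2 M) (cond_op M F (\<lambda>x. complex_of_real (\<kappa> x)) v e))
      (cond_op M F (\<lambda>x. complex_of_real (\<kappa> x)) v e) = cond_op M F (\<lambda>x. complex_of_real ((\<kappa> x)\<^sup>2)) e e"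
    unfolding cond_op_adjoint[OF k v e] complex_cnj_complex_of_real cond_op_comp[OF k k e v v e]
    by (intro cond_op_cong[OF _ k2 e e] ess_bounded_mult k cond_unit_inner_ess_bounded[OF v v])
  then show ?thesis unfolding op_abs_def using cond_op_sqrt[OF k2 _ e] k0 by simp
qed

lemma cond_op_norm_eq_0_iff:
  assumes k: "ess_bounded M F k" and p: "cond_unit M F S p" and q: "cond_unit M F S q"
    and S: "S \<in> sets F" and f: "f \<in> l2_functions M"
  shows "space_norm (L2 M) (cond_op M F k p q (ae_class M f)) = 0 \<longleftrightarrow>
    (AE x in M. x \<in> S \<longrightarrow> k x * complex_cond_exp M F (\<lambda>y. cnj (q y) * f y) x = 0)"
proof -
  have kF: "k \<in> borel_measurable F" using k by (simp add: ess_bounded_def)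
  have [measurable]: "S \<in> sets M" using S subalg by (auto simp: subalgebra_def)
  note [measurable] = borel_measurable_F_M[OF kF]
  let ?c = "\<lambda>x. k x * complex_cond_exp M F (\<lambda>y. cnj (q y) * f y) x"
  have "space_norm (L2 M) (cond_op M F k p q (ae_class M f)) = 0 \<longleftrightarrow>
      ennreal ((space_norm (L2 M) (cond_op M F k p q (ae_class M f)))\<^sup>2) = 0" by simp
  also have "\<dots> \<longleftrightarrow> (\<integral>\<^sup>+x. ennreal ((cmod (?c x))\<^sup>2) * indicator S x \<partial>M) = 0"
    by (simp only: cond_op_class[OF k p q f] L2_norm_sq[OF cond_ker_l2[OF k p q f]] cond_ker_nn_integral[OF kF p])
  also have "\<dots> \<longleftrightarrow> (AE x in M. ennreal ((cmod (?c x))\<^sup>2) * indicator S x = 0)"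
    by (rule nn_integral_0_iff_AE) auto
  also have "\<dots> \<longleftrightarrow> (AE x in M. x \<in> S \<longrightarrow> ?c x = 0)"
    by (intro AE_cong) (auto simp: indicator_def)
  finally show ?thesis .
qed

lemma cond_op_diff:
  assumes k: "ess_bounded M F k" and l: "ess_bounded M F l"
    and p: "cond_unit M F S p" and q: "cond_unit M F S q" and X: "X \<in> space_carrier (L2 M)"
  shows "space_add (L2 M) (cond_op M F k p q X) (space_scale (L2 M) (-1) (cond_op M F l p q X)) =
    cond_op M F (\<lambda>x. k x - l x) p q X"
  using X
proof (rule L2_carrierE)
  fix f assume f: "f \<in> l2_functions M" "X = ae_class M f"
  obtain C where C: "0 \<le> C" "AE x in M. cmod (k x) \<le> C" using ess_bounded_obtain[OF k] .
  obtain D where D: "0 \<le> D" "AE x in M. cmod (l x) \<le> D" using ess_bounded_obtain[OF l] .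
  have "AE x in M. cmod (k x - l x) \<le> C + D" using C(2) D(2)
    by eventually_elim (metis add_mono norm_triangle_ineq4 order_trans)
  then have kl: "ess_bounded M F (\<lambda>x. k x - l x)" using k l by (auto simp: ess_bounded_def)
  have "(\<lambda>x. cond_ker M F k p q f x + (-1) * cond_ker M F l p q f x) = cond_ker M F (\<lambda>x. k x - l x) p q f"
    by (simp add: cond_ker_def fun_eq_iff algebra_simps)
  then show ?thesis
    by (simp add: f cond_op_class[OF k p q] cond_op_class[OF l p q] cond_op_class[OF kl p q]
      cond_ker_l2[OF k p q] cond_ker_l2[OF l p q] L2_scale L2_add l2_scale[where c = "-1", simplified])
qed

text \<open>
  Dominated convergence, with the square of \<open>E(cnj q * f)\<close> as majorant.
\<close>

lemma cond_op_tendsto_0: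
  assumes k: "\<And>n::nat. ess_bounded M F (k n)" and p: "cond_unit M F S p" and q: "cond_unit M F S q"
    and S: "S \<in> sets F" and k1: "\<And>n x. x \<in> S \<Longrightarrow> cmod (k n x) \<le> 1"
    and lim: "\<And>x. x \<in> S \<Longrightarrow> (\<lambda>n. k n x) \<longlonglongrightarrow> 0" and X: "X \<in> space_carrier (L2 M)"
  shows "(\<lambda>n. space_norm (L2 M) (cond_op M F (k n) p q X)) \<longlonglongrightarrow> 0"
  using X
proof (rule L2_carrierE)
  fix f assume f: "f \<in> l2_functions M" "X = ae_class M f"
  have kF [measurable]: "k n \<in> borel_measurable F" for n using k by (simp add: ess_bounded_def)
  have [measurable]: "S \<in> sets M" using S subalg by (auto simp: subalgebra_def)
  note [measurable] = borel_measurable_F_M[OF kF]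
  let ?c = "complex_cond_exp M F (\<lambda>y. cnj (q y) * f y)"
  let ?i = "\<lambda>n x. ennreal ((cmod (k n x * ?c x))\<^sup>2) * indicator S x"
  have "(\<lambda>n. \<integral>\<^sup>+x. ?i n x \<partial>M) \<longlonglongrightarrow> (\<integral>\<^sup>+x. 0 \<partial>M)"
  proof (rule nn_integral_dominated_convergence[where w = "\<lambda>x. ennreal ((cmod (?c x))\<^sup>2)"])
    show "(\<integral>\<^sup>+x. ennreal ((cmod (?c x))\<^sup>2) \<partial>M) < \<infinity>"
      using cond_exp_contraction[OF q f(1)] f(1) by (auto simp: l2_iff_nn_integral intro: le_less_trans)
    show "AE x in M. ?i n x \<le> ennreal ((cmod (?c x))\<^sup>2)" for n
    proof (rule AE_I2)
      fix x
      show "?i n x \<le> ennreal ((cmod (?c x))\<^sup>2)"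
      proof (cases "x \<in> S")
        case True
        then have "cmod (k n x * ?c x) \<le> cmod (?c x)"
          using mult_right_mono[OF k1, of x "cmod (?c x)" n] by (simp add: norm_mult)
        then show ?thesis using True by (simp add: ennreal_leI power_mono)
      qed simp
    qed
    show "AE x in M. (\<lambda>n. ?i n x) \<longlonglongrightarrow> 0"
    proof (rule AE_I2)
      fix x
      show "(\<lambda>n. ?i n x) \<longlonglongrightarrow> 0"
      proof (cases "x \<in> S")
        case True
        have "(\<lambda>n. ennreal ((cmod (k n x * ?c x))\<^sup>2)) \<longlonglongrightarrow> ennreal ((cmod (0 * ?c x))\<^sup>2)"
          by (intro tendsto_intros lim True)
        then show ?thesis using True by simp
      qed simp
    qed
  qed measurable
  then have "(\<lambda>n. ennreal ((space_norm (L2 M) (cond_op M F (k n) p q X))\<^sup>2)) \<longlonglongrightarrow> ennreal 0"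
    by (simp add: f(2) cond_op_class[OF k p q f(1)] L2_norm_sq[OF cond_ker_l2[OF k p q f(1)]]
      cond_ker_nn_integral[OF kF p])
  then have "(\<lambda>n. (space_norm (L2 M) (cond_op M F (k n) p q X))\<^sup>2) \<longlonglongrightarrow> 0"
    by (subst (asm) tendsto_ennreal_iff) auto
  then have "(\<lambda>n. sqrt ((space_norm (L2 M) (cond_op M F (k n) p q X))\<^sup>2)) \<longlonglongrightarrow> sqrt 0"
    by (rule tendsto_real_sqrt)
  then show ?thesis by (simp add: tendsto_rabs_zero_iff)
qed

text \<open>
  The projection onto the closure of the range of \<open>|T|\<close>, which is \<open>(\<kappa>, e, e)\<close>, is \<open>(1, e, e)\<close>.  As
  \<open>1 / \<kappa>\<close> need not be bounded, the range is approached by means of the regularized inverses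
  \<open>r n = 1 / (\<kappa> + 1 / (n + 1))\<close>: the weights \<open>\<kappa> * r n\<close> increase to \<open>1\<close> on \<open>S\<close>.
\<close>

lemma cond_op_polar_isometry:
  assumes S: "S \<in> sets F" and k: "ess_bounded M F (\<lambda>x. complex_of_real (\<kappa> x))" and k0: "\<And>x. 0 \<le> \<kappa> x"
    and kS: "\<And>x. x \<in> S \<Longrightarrow> 0 < \<kappa> x" and v: "cond_unit M F S v" and e: "cond_unit M F S e"
  shows "polar_isometry (L2 M) (cond_op M F (\<lambda>x. complex_of_real (\<kappa> x)) v e) = cond_op M F (\<lambda>x. 1) v e"
proof (rule L2.polar_isometry_eqI[where P = "cond_op M F (\<lambda>x. 1) e e"], unfold cond_op_abs[OF k k0 v e])
  have one: "ess_bounded M F (\<lambda>x. 1)" by (auto simp: ess_bounded_def)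
  let ?k = "\<lambda>x. complex_of_real (\<kappa> x)"
  let ?ee = "complex_cond_exp M F (\<lambda>y. cnj (e y) * e y)"
  note ee = cond_unit_self_inner[OF e] and ebd = cond_unit_inner_ess_bounded[OF e e]
  show "bounded_op (L2 M) (cond_op M F ?k e e)" "bounded_op (L2 M) (cond_op M F (\<lambda>x. 1) v e)"
    "bounded_op (L2 M) (cond_op M F (\<lambda>x. 1) e e)"
    by (intro cond_op_bounded[OF _ _ e] k one v e)+
  have absorb: "cond_op M F (\<lambda>x. k x * ?ee x) p e = cond_op M F k p e"
    if "ess_bounded M F k" "cond_unit M F S p" for k p
  proof (rule cond_op_cong[OF _ that e])
    show "AE x in M. x \<in> S \<longrightarrow> k x * ?ee x = k x" using ee by eventually_elim simp
  qed (intro ess_bounded_mult that ebd)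
  show "cond_op M F ?k v e = op_comp (L2 M) (cond_op M F (\<lambda>x. 1) v e) (cond_op M F ?k e e)"
    using absorb[OF k v] by (simp add: cond_op_comp[OF one k v e e e])
  show "op_kernel (L2 M) (cond_op M F (\<lambda>x. 1) v e) = op_kernel (L2 M) (cond_op M F ?k e e)"
  proof (rule set_eqI)
    fix X
    have "space_norm (L2 M) (cond_op M F (\<lambda>x. 1) v e X) = 0 \<longleftrightarrow> space_norm (L2 M) (cond_op M F ?k e e X) = 0"
      if X: "X \<in> space_carrier (L2 M)"
      using X
    proof (rule L2_carrierE)
      fix f assume f: "f \<in> l2_functions M" "X = ae_class M f"
      show ?thesis unfolding f(2) cond_op_norm_eq_0_iff[OF one v e S f(1)] cond_op_norm_eq_0_iff[OF k e e S f(1)]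
        by (intro AE_cong) (use kS in force)
    qed
    then show "X \<in> op_kernel (L2 M) (cond_op M F (\<lambda>x. 1) v e) \<longleftrightarrow> X \<in> op_kernel (L2 M) (cond_op M F ?k e e)"
      unfolding L2.op_kernel_iff_norm[OF cond_op_bounded[OF one v e]]
        L2.op_kernel_iff_norm[OF cond_op_bounded[OF k e e]] by blast
  qed
  fix X assume X: "X \<in> space_carrier (L2 M)"
  show "cond_op M F ?k e e (cond_op M F (\<lambda>x. 1) e e X) = cond_op M F ?k e e X"
    using absorb[OF k e] by (simp add: cond_op_apply_comp[OF k one e e e e X])
  show "(space_norm (L2 M) (cond_op M F (\<lambda>x. 1) v e X))\<^sup>2 =
      Re (space_inner (L2 M) (cond_op M F (\<lambda>x. 1) e e X) X)"
  proof -
    have vv: "cond_op M F (complex_cond_exp M F (\<lambda>y. cnj (v y) * v y)) e e = cond_op M F (\<lambda>x. 1) e e"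
      using cond_unit_self_inner[OF v]
      by (intro cond_op_cong[OF _ one e e] cond_unit_inner_ess_bounded[OF v v]) (auto elim!: eventually_mono)
    have "space_inner (L2 M) (cond_op M F (\<lambda>x. 1) v e X) (cond_op M F (\<lambda>x. 1) v e X) =
        space_inner (L2 M) X (cond_op M F (\<lambda>x. 1) e v (cond_op M F (\<lambda>x. 1) v e X))"
      using cond_op_inner[OF one v e X cond_op_closed[OF one v e X]] by simp
    also have "\<dots> = space_inner (L2 M) X (cond_op M F (\<lambda>x. 1) e e X)"
      using vv by (simp add: cond_op_apply_comp[OF one one e v v e X])
    finally show ?thesis
      using L2.inner_commute[OF X cond_op_closed[OF one e e X]]
      by (simp add: L2.norm_sq[OF cond_op_closed[OF one v e X]])
  qed
  define r where "r n x = 1 / (\<kappa> x + 1 / real (Suc n))" for n x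
  have kF [measurable]: "\<kappa> \<in> borel_measurable F" using k by (simp add: ess_bounded_of_real)
  have pos: "0 < \<kappa> x + 1 / real (Suc n)" for n x using k0[of x] by (intro add_nonneg_pos) auto
  have r: "ess_bounded M F (\<lambda>x. complex_of_real (r n x))" for n
  proof -
    have "\<bar>r n x\<bar> \<le> real (Suc n)" for x
      using k0[of x] pos[of x n] by (simp add: r_def field_simps)
    then show ?thesis unfolding ess_bounded_of_real by (auto simp: r_def[abs_def])
  qed
  have krbd: "ess_bounded M F (\<lambda>x. ?k x * complex_of_real (r n x))" for n
    by (rule ess_bounded_mult[OF k r])
  have kr: "1 - \<kappa> x * r n x = (1 / real (Suc n)) * r n x" for n x
    using pos[of x n] by (simp add: r_def field_simps)
  define d where "d n x = 1 - ?k x * complex_of_real (r n x)" for n x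
  have d_eq: "d n x = complex_of_real ((1 / real (Suc n)) * r n x)" for n x
    unfolding d_def kr[symmetric] by simp
  have "ess_bounded M F (d n)" for n
    unfolding d_eq[abs_def] of_real_mult by (intro ess_bounded_mult r) (auto simp: ess_bounded_def)
  moreover have "cmod (d n x) \<le> 1" for n x
    unfolding d_eq norm_of_real using k0[of x] pos[of x n] by (simp add: r_def field_simps)
  moreover have "(\<lambda>n. d n x) \<longlonglongrightarrow> 0" if "x \<in> S" for x
  proof -
    have n: "(\<lambda>n. 1 / real (Suc n)) \<longlonglongrightarrow> 0" by (rule LIMSEQ_Suc[OF lim_1_over_n])
    have "(\<lambda>n. complex_of_real ((1 / real (Suc n)) * r n x)) \<longlonglongrightarrow> complex_of_real (0 * (1 / (\<kappa> x + 0)))"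
      unfolding r_def using kS[OF that] by (intro tendsto_intros n) auto
    then show ?thesis by (simp add: d_eq)
  qed
  ultimately have lim: "(\<lambda>n. space_norm (L2 M) (cond_op M F (d n) e e X)) \<longlonglongrightarrow> 0"
    by (intro cond_op_tendsto_0[OF _ e e S _ _ X])
  have "space_add (L2 M) (cond_op M F (\<lambda>x. 1) e e X)
      (space_scale (L2 M) (-1) (cond_op M F ?k e e (cond_op M F (\<lambda>x. complex_of_real (r n x)) e e X))) =
      cond_op M F (d n) e e X" for n
    unfolding cond_op_apply_comp[OF k r e e e e X] absorb[OF krbd e] cond_op_diff[OF one krbd e e X] d_def[abs_def] ..
  with lim show "\<exists>Z. (\<forall>n::nat. Z n \<in> space_carrier (L2 M)) \<and>
      (\<lambda>n. space_norm (L2 M) (space_add (L2 M) (cond_op M F (\<lambda>x. 1) e e X)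
        (space_scale (L2 M) (-1) (cond_op M F ?k e e (Z n))))) \<longlonglongrightarrow> 0"
    using cond_op_closed[OF r e e X]
    by (intro exI[of _ "\<lambda>n. cond_op M F (\<lambda>x. complex_of_real (r n x)) e e X"]) simp
qed

text \<open>
  The product \<open>(sqrt \<kappa>, e, e) (1, v, e) (sqrt \<kappa>, e, e)\<close> has weight
  \<open>sqrt \<kappa> E(cnj e * v) sqrt \<kappa>\<close> between \<open>e\<close> and \<open>e\<close>.
\<close>

lemma cond_op_aluthge:
  assumes S: "S \<in> sets F" and k: "ess_bounded M F (\<lambda>x. complex_of_real (\<kappa> x))" and k0: "\<And>x. 0 \<le> \<kappa> x"
    and kS: "\<And>x. x \<in> S \<Longrightarrow> 0 < \<kappa> x" and v: "cond_unit M F S v" and e: "cond_unit M F S e"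
  shows "aluthge (L2 M) (cond_op M F (\<lambda>x. complex_of_real (\<kappa> x)) v e) =
    cond_op M F (\<lambda>x. complex_of_real (\<kappa> x) * complex_cond_exp M F (\<lambda>y. cnj (e y) * v y) x) e e"
proof -
  have one: "ess_bounded M F (\<lambda>x. 1)" by (auto simp: ess_bounded_def)
  let ?s = "\<lambda>x. complex_of_real (sqrt (\<kappa> x))"
  let ?ee = "complex_cond_exp M F (\<lambda>y. cnj (e y) * e y)"
  let ?ev = "complex_cond_exp M F (\<lambda>y. cnj (e y) * v y)"
  note s = ess_bounded_sqrt[OF k k0] and ebd = cond_unit_inner_ess_bounded[OF e e]
    and evbd = cond_unit_inner_ess_bounded[OF e v]
  have t: "ess_bounded M F (\<lambda>x. 1 * ?s x * ?ee x)" by (intro ess_bounded_mult one s ebd)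
  have "AE x in M. x \<in> S \<longrightarrow> ?s x * (1 * ?s x * ?ee x) * ?ev x = complex_of_real (\<kappa> x) * ?ev x"
    using cond_unit_self_inner[OF e] by eventually_elim (simp add: k0 flip: of_real_mult)
  then have "cond_op M F (\<lambda>x. ?s x * (1 * ?s x * ?ee x) * ?ev x) e e =
      cond_op M F (\<lambda>x. complex_of_real (\<kappa> x) * ?ev x) e e"
    by (intro cond_op_cong[OF _ _ e e] ess_bounded_mult s t k evbd)
  moreover have "polar_isometry (L2 M) (cond_op M F (\<lambda>x. complex_of_real (\<kappa> x)) v e) = cond_op M F (\<lambda>x. 1) v e"
    by (intro cond_op_polar_isometry[OF S k k0 _ v e] kS)
  ultimately show ?thesis
    unfolding aluthge_def cond_op_abs[OF k k0 v e] cond_op_sqrt[OF k k0 e]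
      cond_op_comp[OF one s v e e e] cond_op_comp[OF s t e e v e] by (simp only: cond_op_comp[OF one s v e e e] cond_op_comp[OF s t e e v e])
qed

section \<open>Normal form of a bounded weighted conditional operator\<close>

lemma weighted_cond_op_class:
  assumes [measurable]: "w \<in> borel_measurable M" "u \<in> borel_measurable M" and f: "f \<in> l2_functions M"
  shows "weighted_cond_op M F w u (ae_class M f) =
    ae_class M (\<lambda>x. w x * complex_cond_exp M F (\<lambda>y. u y * f y) x)"
proof -
  note m [measurable] = l2_functions_measurable[OF f]
  note [measurable] = ae_rep_ae_class(1)[OF m]
  have "AE x in M. complex_cond_exp M F (\<lambda>y. u y * ae_rep (ae_class M f) y) x =
      complex_cond_exp M F (\<lambda>y. u y * f y) x"
    using ae_rep_ae_class(2)[OF m] by (intro complex_cond_exp_cong) auto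
  then have "AE x in M. w x * complex_cond_exp M F (\<lambda>y. u y * ae_rep (ae_class M f) y) x =
      w x * complex_cond_exp M F (\<lambda>y. u y * f y) x"
    by eventually_elim simp
  moreover have "ae_class M f \<in> space_carrier (L2 M)" using f by (auto simp: L2_carrier)
  ultimately show ?thesis by (simp add: weighted_cond_op_def ae_class_eq_iff)
qed

text \<open>
  Test the operator on \<open>f = cnj u\<close>, restricted to the set where \<open>|u| \<le> n\<close> and to some \<open>B\<close> in \<open>F\<close> of
  finite measure.  With \<open>a = E(|w|\<^sup>2)\<close> and \<open>b\<^sub>n\<close> the conditional expectation of the truncated \<open>|u|\<^sup>2\<close>
  the squared norms of \<open>w E(u f)\<close> and \<open>f\<close> are the integrals of \<open>a b\<^sub>n\<^sup>2\<close> and \<open>b\<^sub>n\<close> over \<open>B\<close>, so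
  \<open>a b\<^sub>n\<^sup>2 \<le> K\<^sup>2 b\<^sub>n\<close>.  Truncation makes \<open>b\<^sub>n\<close> finite, one factor cancels, and
  \<open>n \<rightarrow> \<infinity>\<close> gives the claim also where \<open>E(|u|\<^sup>2)\<close> is infinite.
\<close>

lemma weighted_cond_op_moment_bound:
  assumes w [measurable]: "w \<in> borel_measurable M" and u [measurable]: "u \<in> borel_measurable M"
    and bd: "bounded_op (L2 M) (weighted_cond_op M F w u)"
  obtains K where "0 \<le> K"
    "AE x in M. nn_cond_exp M F (\<lambda>y. ennreal ((cmod (w y))\<^sup>2)) x *
      nn_cond_exp M F (\<lambda>y. ennreal ((cmod (u y))\<^sup>2)) x \<le> ennreal (K\<^sup>2)"
proof -
  obtain K where K0: "0 \<le> K" and K: "\<And>X. X \<in> space_carrier (L2 M) \<Longrightarrow>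
      space_norm (L2 M) (weighted_cond_op M F w u X) \<le> K * space_norm (L2 M) X"
    using L2.bounded_op_bound[OF bd] by blast
  define a where "a = nn_cond_exp M F (\<lambda>y. ennreal ((cmod (w y))\<^sup>2))"
  have aF [measurable]: "a \<in> borel_measurable F" "a \<in> borel_measurable M" by (simp_all add: a_def)
  define t where "t n x = (if cmod (u x) \<le> real n then (cmod (u x))\<^sup>2 else 0)" for n x
  have t0: "0 \<le> t n x" and tn: "t n x \<le> (real n)\<^sup>2" for n x by (auto simp: t_def intro: power_mono)
  have [measurable]: "t n \<in> borel_measurable M" for n unfolding t_def by measurable
  define b where "b n = nn_cond_exp M F (\<lambda>y. ennreal (t n y))" for n
  have bF [measurable]: "b n \<in> borel_measurable F" "b n \<in> borel_measurable M" for n by (simp_all add: b_def)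
  have b_fin: "AE x in M. b n x \<le> ennreal ((real n)\<^sup>2)" for n
  proof -
    have "AE x in M. ennreal ((real n)\<^sup>2) = nn_cond_exp M F (\<lambda>x. ennreal ((real n)\<^sup>2)) x"
      by (rule nn_cond_exp_F_meas) auto
    moreover have "AE x in M. b n x \<le> nn_cond_exp M F (\<lambda>x. ennreal ((real n)\<^sup>2)) x"
      unfolding b_def using tn by (intro nn_cond_exp_mono) (auto intro: ennreal_leI)
    ultimately show ?thesis by eventually_elim simp
  qed
  have step: "AE x in M. a x * b n x * b n x \<le> ennreal (K\<^sup>2) * b n x" for n
  proof (rule AE_le_of_set_nn_integral_le)
    show "AE x in M. ennreal (K\<^sup>2) * b n x \<le> ennreal (K\<^sup>2 * (real n)\<^sup>2)"
      using b_fin[of n] by eventually_elim (simp add: ennreal_mult mult_left_mono)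
    fix B assume B [measurable]: "B \<in> sets F" and fin: "emeasure M B < \<infinity>"
    then have [measurable]: "B \<in> sets M" using subalg by (auto simp: subalgebra_def)
    define f where "f = (\<lambda>x. indicator B x * (if cmod (u x) \<le> real n then cnj (u x) else 0))"
    have fm [measurable]: "f \<in> borel_measurable M" unfolding f_def by measurable
    have f2: "ennreal ((cmod (f x))\<^sup>2) = indicator B x * ennreal (t n x)" for x
      by (simp add: f_def t_def indicator_def)
    have f_int: "(\<integral>\<^sup>+x. ennreal ((cmod (f x))\<^sup>2) \<partial>M) = (\<integral>\<^sup>+x. indicator B x * b n x \<partial>M)"
      unfolding f2 b_def by (rule nn_cond_exp_intg[symmetric]) auto
    have "(\<integral>\<^sup>+x. indicator B x * b n x \<partial>M) \<le> (\<integral>\<^sup>+x. ennreal ((real n)\<^sup>2) * indicator B x \<partial>M)"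
      using b_fin[of n] by (intro nn_integral_mono_AE) (auto elim!: eventually_mono simp: indicator_def)
    also have "\<dots> < \<infinity>" using fin by (simp add: nn_integral_cmult_indicator ennreal_mult_less_top)
    finally have f: "f \<in> l2_functions M" using f_int by (simp add: l2_iff_nn_integral)
    then have fC: "ae_class M f \<in> space_carrier (L2 M)" by (auto simp: L2_carrier)
    have uf: "(\<lambda>x. u x * f x) = (\<lambda>x. of_real (indicator B x * t n x))"
      by (auto simp: f_def t_def indicator_def complex_norm_square fun_eq_iff simp del: of_real_power)
    let ?g = "\<lambda>x. w x * complex_cond_exp M F (\<lambda>y. u y * f y) x"
    note cl = weighted_cond_op_class[OF w u f]
    have g: "?g \<in> l2_functions M"
      using L2.bounded_op_closed[OF bd fC] unfolding cl by (intro l2_of_ae_class_carrier) measurable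
    have ce: "AE x in M. complex_cond_exp M F (\<lambda>y. u y * f y) x = of_real (enn2real (indicator B x * b n x))"
    proof -
      have "AE x in M. complex_cond_exp M F (\<lambda>x. of_real (indicator B x * t n x)) x =
          of_real (enn2real (nn_cond_exp M F (\<lambda>x. ennreal (indicator B x * t n x)) x))"
        using t0 by (intro complex_cond_exp_nonneg) auto
      moreover have "AE x in M. indicator B x * b n x = nn_cond_exp M F (\<lambda>x. indicator B x * ennreal (t n x)) x"
        unfolding b_def by (rule nn_cond_exp_prod) auto
      moreover have "(\<lambda>x. ennreal (indicator B x * t n x)) = (\<lambda>x. indicator B x * ennreal (t n x))"
        by (auto simp: indicator_def)
      ultimately show ?thesis unfolding uf by auto
    qed
    have "(\<integral>\<^sup>+x. a x * b n x * b n x * indicator B x \<partial>M) =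
        (\<integral>\<^sup>+x. (b n x * b n x * indicator B x) * a x \<partial>M)"
      by (simp add: ac_simps)
    also have "\<dots> = (\<integral>\<^sup>+x. (b n x * b n x * indicator B x) * ennreal ((cmod (w x))\<^sup>2) \<partial>M)"
      unfolding a_def by (rule nn_cond_exp_intg) auto
    also have "\<dots> = (\<integral>\<^sup>+x. ennreal ((cmod (?g x))\<^sup>2) \<partial>M)"
    proof (rule nn_integral_cong_AE)
      show "AE x in M. (b n x * b n x * indicator B x) * ennreal ((cmod (w x))\<^sup>2) = ennreal ((cmod (?g x))\<^sup>2)"
        using ce b_fin[of n]
      proof eventually_elim
        case (elim x)
        obtain r where r: "b n x = ennreal r" "0 \<le> r" using elim(2) by (cases "b n x") (auto simp: top_unique)
        show ?case unfolding elim(1) using r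
          by (simp add: indicator_def norm_mult power_mult_distrib power2_eq_square ac_simps ennreal_mult[symmetric])
      qed
    qed
    also have "\<dots> = ennreal ((space_norm (L2 M) (weighted_cond_op M F w u (ae_class M f)))\<^sup>2)"
      unfolding cl by (rule L2_norm_sq[OF g, symmetric])
    also have "\<dots> \<le> ennreal ((K * space_norm (L2 M) (ae_class M f))\<^sup>2)"
      using K[OF fC] L2.norm_nonneg[OF L2.bounded_op_closed[OF bd fC]] by (intro ennreal_leI power_mono)
    also have "\<dots> = ennreal (K\<^sup>2) * (\<integral>\<^sup>+x. ennreal ((cmod (f x))\<^sup>2) \<partial>M)"
      by (simp only: power_mult_distrib L2_norm_sq[OF f, symmetric]) (simp add: ennreal_mult)
    also have "\<dots> = (\<integral>\<^sup>+x. ennreal (K\<^sup>2) * (indicator B x * b n x) \<partial>M)"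
      unfolding f_int by (rule nn_integral_cmult[symmetric]) auto
    also have "\<dots> = (\<integral>\<^sup>+x. ennreal (K\<^sup>2) * b n x * indicator B x \<partial>M)" by (simp add: ac_simps)
    finally show "(\<integral>\<^sup>+x. a x * b n x * b n x * indicator B x \<partial>M) \<le>
        (\<integral>\<^sup>+x. ennreal (K\<^sup>2) * b n x * indicator B x \<partial>M)" .
  qed measurable
  have "AE x in M. a x * b n x \<le> ennreal (K\<^sup>2)" for n
    using step[of n] b_fin[of n]
  proof eventually_elim
    case (elim x)
    show ?case
    proof (cases "b n x = 0")
      case False
      have "b n x \<noteq> \<top>" using elim(2) by (auto simp: top_unique)
      then show ?thesis using elim(1) False
        using ennreal_mult_le_mult_iff[of "b n x" "a x * b n x" "ennreal (K\<^sup>2)"] by (simp add: ac_simps)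
    qed simp
  qed
  then have "AE x in M. \<forall>n. a x * b n x \<le> ennreal (K\<^sup>2)" unfolding AE_all_countable by blast
  moreover have "AE x in M. (SUP n. b n x) = nn_cond_exp M F (\<lambda>x. SUP n. ennreal (t n x)) x"
    unfolding b_def
    by (rule nn_cond_exp_SUP) (auto simp: incseq_def le_fun_def t_def intro!: ennreal_leI)
  moreover have "(SUP n. ennreal (t n x)) = ennreal ((cmod (u x))\<^sup>2)" for x
  proof (rule antisym)
    show "(SUP n. ennreal (t n x)) \<le> ennreal ((cmod (u x))\<^sup>2)"
      by (rule SUP_least) (auto simp: t_def intro: ennreal_leI)
    obtain n where "cmod (u x) \<le> real n" using real_arch_simple by blast
    then show "ennreal ((cmod (u x))\<^sup>2) \<le> (SUP n. ennreal (t n x))"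
      by (intro SUP_upper2[of n]) (auto simp: t_def)
  qed
  ultimately have "AE x in M. a x * nn_cond_exp M F (\<lambda>y. ennreal ((cmod (u y))\<^sup>2)) x \<le> ennreal (K\<^sup>2)"
  proof (elim AE_mp, intro AE_I2 impI, goal_cases)
    case (1 x)
    have "a x * (SUP n. b n x) = (SUP n. a x * b n x)" by (rule SUP_mult_left_ennreal)
    also have "\<dots> \<le> ennreal (K\<^sup>2)" using 1 by (intro SUP_least) auto
    finally show ?case using 1 by simp
  qed
  then show thesis using that[OF K0] by (simp add: a_def)
qed

lemma cond_unit_normalize:
  assumes f [measurable]: "f \<in> borel_measurable M" and S [measurable]: "S \<in> sets F"
    and fin: "\<And>x. x \<in> S \<Longrightarrow> 0 < nn_cond_exp M F (\<lambda>y. ennreal ((cmod (f y))\<^sup>2)) x \<and>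
      nn_cond_exp M F (\<lambda>y. ennreal ((cmod (f y))\<^sup>2)) x < \<infinity>"
  shows "cond_unit M F S (\<lambda>x. of_real (indicator S x /
    sqrt (enn2real (nn_cond_exp M F (\<lambda>y. ennreal ((cmod (f y))\<^sup>2)) x))) * f x)"
proof -
  have [measurable]: "S \<in> sets M" using S subalg by (auto simp: subalgebra_def)
  define c where "c = nn_cond_exp M F (\<lambda>y. ennreal ((cmod (f y))\<^sup>2))"
  have [measurable]: "c \<in> borel_measurable F" "c \<in> borel_measurable M" by (simp_all add: c_def)
  have eq: "ennreal ((cmod (of_real (indicator S x / sqrt (enn2real (c x))) * f x))\<^sup>2) =
      ennreal (indicator S x / enn2real (c x)) * ennreal ((cmod (f x))\<^sup>2)" for x
    by (simp add: norm_mult norm_divide power_mult_distrib power_divide indicator_def flip: ennreal_mult')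
  have ae: "AE x in M. ennreal (indicator S x / enn2real (c x)) * c x =
      nn_cond_exp M F (\<lambda>x. ennreal (indicator S x / enn2real (c x)) * ennreal ((cmod (f x))\<^sup>2)) x"
    unfolding c_def by (rule nn_cond_exp_prod) auto
  have ind: "ennreal (indicator S x / enn2real (c x)) * c x = indicator S x" for x
  proof (cases "x \<in> S")
    case True
    then obtain r where "c x = ennreal r" "0 < r"
      using fin[OF True] unfolding c_def[symmetric] by (cases "c x") auto
    then show ?thesis using True by (simp flip: ennreal_mult)
  qed simp
  from ae have "AE x in M. nn_cond_exp M F (\<lambda>x. ennreal (indicator S x / enn2real (c x)) * ennreal ((cmod (f x))\<^sup>2)) x = indicator S x"
    unfolding ind by eventually_elim simp
  then show ?thesis unfolding cond_unit_def c_def[symmetric] eq by simp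
qed

text \<open>
  The product of \<open>a = E(|w|\<^sup>2)\<close> and \<open>b = E(|u|\<^sup>2)\<close> is essentially bounded, so wherever one of them is
  infinite the other is \<open>0\<close>.  Let \<open>S\<close> be the set where both are positive and finite.  Outside \<open>S\<close> one of
  \<open>u\<close> and \<open>w\<close> vanishes almost everywhere, so that \<open>w E(u f)\<close>, \<open>u w\<close> and \<open>a b\<close> are \<open>0\<close> there.  On \<open>S\<close>
  divide \<open>w\<close> by the root of \<open>a\<close> and \<open>cnj u\<close> by the root of \<open>b\<close>; then \<open>\<kappa>\<close> is the root of \<open>a b\<close>.
\<close>

lemma weighted_cond_op_normal_form:
  assumes u: "u \<in> borel_measurable M" and w: "w \<in> borel_measurable M"
    and bounded: "bounded_weighted_cond_op M F w u"
  obtains S \<kappa> v e where "S \<in> sets F" "ess_bounded M F (\<lambda>x. complex_of_real (\<kappa> x))"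
    "\<forall>x. 0 \<le> \<kappa> x" "\<forall>x\<in>S. 0 < \<kappa> x" "\<forall>x. x \<notin> S \<longrightarrow> \<kappa> x = 0" "cond_unit M F S v" "cond_unit M F S e"
    "weighted_cond_op M F w u = cond_op M F (\<lambda>x. complex_of_real (\<kappa> x)) v e"
    "AE x in M. complex_cond_exp M F (\<lambda>y. u y * w y) x =
      of_real (\<kappa> x) * complex_cond_exp M F (\<lambda>y. cnj (e y) * v y) x"
    "AE x in M. ennreal_sqrt (nn_cond_exp M F (\<lambda>y. ennreal ((cmod (u y))\<^sup>2)) x) *
      ennreal_sqrt (nn_cond_exp M F (\<lambda>y. ennreal ((cmod (w y))\<^sup>2)) x) = ennreal (\<kappa> x)"
proof -
  note [measurable] = u w
  define a b where "a = nn_cond_exp M F (\<lambda>y. ennreal ((cmod (w y))\<^sup>2))"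
    and "b = nn_cond_exp M F (\<lambda>y. ennreal ((cmod (u y))\<^sup>2))"
  have [measurable]: "a \<in> borel_measurable F" "b \<in> borel_measurable F"
    "a \<in> borel_measurable M" "b \<in> borel_measurable M" by (simp_all add: a_def b_def)
  have bd: "bounded_op (L2 M) (weighted_cond_op M F w u)"
    and dom: "\<And>f. f \<in> l2_functions M \<Longrightarrow> (\<lambda>x. u x * f x) \<in> cond_exp_domain M F"
    using bounded by (auto simp: bounded_weighted_cond_op_def)
  obtain K where K0: "0 \<le> K" and ab: "AE x in M. a x * b x \<le> ennreal (K\<^sup>2)"
    using weighted_cond_op_moment_bound[OF w u bd] unfolding a_def b_def by blast
  define S where "S = {x \<in> space F. 0 < a x \<and> a x < \<infinity> \<and> 0 < b x \<and> b x < \<infinity>}"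
  have S [measurable]: "S \<in> sets F" unfolding S_def by measurable
  have sp: "space F = space M" using subalg by (auto simp: subalgebra_def)
  have outside: "AE x in M. x \<notin> S \<longrightarrow> a x = 0 \<or> b x = 0"
    using ab AE_space
  proof eventually_elim
    case (elim x)
    then have "a x * b x < \<top>" using ennreal_less_top le_less_trans by blast
    then show ?case using elim(2) by (auto simp: S_def sp ennreal_mult_less_top less_top zero_less_iff_neq_zero)
  qed
  have w0: "AE x in M. a x = 0 \<longrightarrow> w x = 0" and u0: "AE x in M. b x = 0 \<longrightarrow> u x = 0"
    unfolding a_def b_def
    using nn_cond_exp_eq_0_imp[of "\<lambda>y. ennreal ((cmod (w y))\<^sup>2)"]
      nn_cond_exp_eq_0_imp[of "\<lambda>y. ennreal ((cmod (u y))\<^sup>2)"] by auto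
  define v e where "v = (\<lambda>x. of_real (indicator S x / sqrt (enn2real (a x))) * w x)"
    and "e = (\<lambda>x. of_real (indicator S x / sqrt (enn2real (b x))) * cnj (u x))"
  define \<kappa> where "\<kappa> x = indicator S x * sqrt (enn2real (a x) * enn2real (b x))" for x
  have v: "cond_unit M F S v"
    using cond_unit_normalize[OF w S] unfolding v_def a_def[symmetric] by (auto simp: S_def)
  have e: "cond_unit M F S e"
    using cond_unit_normalize[OF borel_measurable_cnj[OF u] S] unfolding e_def complex_mod_cnj b_def[symmetric]
    by (auto simp: S_def)
  have pos: "0 < enn2real (a x)" "0 < enn2real (b x)" if "x \<in> S" for x
    using that by (auto simp: S_def enn2real_positive_iff)
  have k0: "0 \<le> \<kappa> x" for x by (simp add: \<kappa>_def)
  have kS: "0 < \<kappa> x" if "x \<in> S" for x using pos[OF that] that by (simp add: \<kappa>_def)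
  have k: "ess_bounded M F (\<lambda>x. complex_of_real (\<kappa> x))"
    unfolding ess_bounded_of_real
  proof (intro conjI exI)
    show "\<kappa> \<in> borel_measurable F" unfolding \<kappa>_def[abs_def] by measurable
    show "AE x in M. \<bar>\<kappa> x\<bar> \<le> K"
      using ab
    proof eventually_elim
      case (elim x)
      have "\<kappa> x \<le> K"
      proof (cases "x \<in> S")
        case True
        obtain r s where rs: "a x = ennreal r" "0 \<le> r" "b x = ennreal s" "0 \<le> s"
          using True by (cases "a x"; cases "b x") (auto simp: S_def)
        then have "r * s \<le> K\<^sup>2" using elim by (simp flip: ennreal_mult)
        then have "sqrt (r * s) \<le> sqrt (K\<^sup>2)" by (rule real_sqrt_le_mono)
        then show ?thesis using rs K0 True by (simp add: \<kappa>_def)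
      qed (simp add: \<kappa>_def K0)
      then show ?case using k0[of x] by simp
    qed
  qed
  \<comment> \<open>The weight undoes the two normalizations.\<close>
  have on_S: "of_real (\<kappa> x) * (of_real (indicator S x / sqrt (enn2real (a x))) *
      of_real (indicator S x / sqrt (enn2real (b x)))) = (indicator S x :: complex)" for x
    using pos[of x] by (cases "x \<in> S") (simp_all add: \<kappa>_def real_sqrt_mult)
  have op: "weighted_cond_op M F w u = cond_op M F (\<lambda>x. complex_of_real (\<kappa> x)) v e"
  proof (rule L2.bounded_op_ext[OF bd cond_op_bounded[OF k v e]])
    fix X assume "X \<in> space_carrier (L2 M)"
    then obtain f where f: "f \<in> l2_functions M" "X = ae_class M f" by (rule L2_carrierE)
    let ?c = "complex_cond_exp M F (\<lambda>y. u y * f y)"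
    have ef: "(\<lambda>y. cnj (e y) * f y) = (\<lambda>y. of_real (indicator S y / sqrt (enn2real (b y))) * (u y * f y))"
      by (simp add: e_def fun_eq_iff)
    have "AE x in M. complex_cond_exp M F (\<lambda>y. cnj (e y) * f y) x =
        of_real (indicator S x / sqrt (enn2real (b x))) * ?c x"
      unfolding ef by (rule complex_cond_exp_mult[OF _ dom[OF f(1)]]) measurable
    moreover have "AE x in M. b x = 0 \<longrightarrow> ?c x = 0"
      unfolding b_def by (rule complex_cond_exp_eq_0[OF u dom[OF f(1)]])
    ultimately have "AE x in M. w x * ?c x = cond_ker M F (\<lambda>x. complex_of_real (\<kappa> x)) v e f x"
      using outside w0
    proof eventually_elim
      case (elim x)
      have "cond_ker M F (\<lambda>x. complex_of_real (\<kappa> x)) v e f x =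
          (of_real (\<kappa> x) * (of_real (indicator S x / sqrt (enn2real (a x))) *
          of_real (indicator S x / sqrt (enn2real (b x))))) * (w x * ?c x)"
        unfolding cond_ker_def v_def elim(1) by (simp only: ac_simps)
      also have "\<dots> = indicator S x * (w x * ?c x)" by (simp only: on_S)
      also have "\<dots> = w x * ?c x" using elim(2-4) by (cases "x \<in> S") auto
      finally show ?case by simp
    qed
    moreover have "cond_ker M F (\<lambda>x. complex_of_real (\<kappa> x)) v e f \<in> borel_measurable M"
      using k v by (intro cond_ker_measurable) (auto simp: ess_bounded_def)
    ultimately show "weighted_cond_op M F w u X = cond_op M F (\<lambda>x. complex_of_real (\<kappa> x)) v e X"
      unfolding f(2) weighted_cond_op_class[OF w u f(1)] cond_op_class[OF k v e f(1)]
      by (subst ae_class_eq_iff) auto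
  qed
  have uw: "AE x in M. complex_cond_exp M F (\<lambda>y. u y * w y) x =
      of_real (\<kappa> x) * complex_cond_exp M F (\<lambda>y. cnj (e y) * v y) x"
  proof -
    note [measurable] = cond_unit_measurable[OF v] cond_unit_measurable[OF e]
    have kF [measurable]: "(\<lambda>x. complex_of_real (\<kappa> x)) \<in> borel_measurable F" using k by (simp add: ess_bounded_def)
    note [measurable] = borel_measurable_F_M[OF kF]
    have "AE x in M. u x * w x = of_real (\<kappa> x) * (cnj (e x) * v x)"
      using outside w0 u0
    proof eventually_elim
      case (elim x)
      have "of_real (\<kappa> x) * (cnj (e x) * v x) =
          (of_real (\<kappa> x) * (of_real (indicator S x / sqrt (enn2real (a x))) *
          of_real (indicator S x / sqrt (enn2real (b x))))) * (u x * w x)"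
        unfolding v_def e_def complex_cnj_mult complex_cnj_complex_of_real complex_cnj_cnj
        by (simp only: ac_simps)
      also have "\<dots> = indicator S x * (u x * w x)" by (simp only: on_S)
      also have "\<dots> = u x * w x" using elim by (cases "x \<in> S") auto
      finally show ?case by simp
    qed
    then have "AE x in M. complex_cond_exp M F (\<lambda>y. u y * w y) x =
        complex_cond_exp M F (\<lambda>x. of_real (\<kappa> x) * (cnj (e x) * v x)) x"
      by (rule complex_cond_exp_cong) measurable
    moreover have "AE x in M. complex_cond_exp M F (\<lambda>x. of_real (\<kappa> x) * (cnj (e x) * v x)) x =
        of_real (\<kappa> x) * complex_cond_exp M F (\<lambda>y. cnj (e y) * v y) x"
      by (intro complex_cond_exp_mult[OF kF] cond_l2_cnj_mult cond_unit_cond_l2[OF e] cond_unit_cond_l2[OF v])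
    ultimately show ?thesis by eventually_elim simp
  qed
  have sq: "AE x in M. ennreal_sqrt (b x) * ennreal_sqrt (a x) = ennreal (\<kappa> x)"
    using outside
  proof eventually_elim
    case (elim x)
    show ?case
    proof (cases "x \<in> S")
      case True
      then have "ennreal_sqrt (b x) * ennreal_sqrt (a x) = ennreal (sqrt (enn2real (b x))) * ennreal (sqrt (enn2real (a x)))"
        by (auto simp: S_def ennreal_sqrt_def)
      then show ?thesis using True by (simp add: \<kappa>_def real_sqrt_mult ac_simps ennreal_mult)
    next
      case False
      then show ?thesis using elim by (auto simp: \<kappa>_def ennreal_sqrt_def)
    qed
  qed
  show thesis
  proof (rule that[OF S k _ _ _ v e op uw])
    show "\<forall>x. 0 \<le> \<kappa> x" "\<forall>x\<in>S. 0 < \<kappa> x" using k0 kS by blast+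
    show "\<forall>x. x \<notin> S \<longrightarrow> \<kappa> x = 0" by (simp add: \<kappa>_def)
  qed (use sq in \<open>simp add: a_def b_def\<close>)
qed

end

section \<open>Normaloid weighted conditional operators\<close>

lemma borel_measurable_ennreal_sqrt [measurable (raw)]:
  assumes [measurable]: "f \<in> borel_measurable M"
  shows "(\<lambda>x. ennreal_sqrt (f x)) \<in> borel_measurable M"
  unfolding ennreal_sqrt_def by measurable

theorem theorem4p1:
  fixes M F :: "'a measure" and u w :: "'a \<Rightarrow> complex"
  assumes "complete_measure M"
    and "sigma_finite_measure M"
    and "sigma_finite_subalgebra M F"
    and "u \<in> cond_exp_domain M F"
    and "w \<in> cond_exp_domain M F"
    and "bounded_weighted_cond_op M F w u"
  shows "normaloid (L2 M) (aluthge (L2 M) (weighted_cond_op M F w u)) \<and>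
    (normaloid (L2 M) (weighted_cond_op M F w u) \<longleftrightarrow>
      esssup M (\<lambda>x. ennreal (cmod (complex_cond_exp M F (\<lambda>y. u y * w y) x))) =
      esssup M (\<lambda>x.
        ennreal_sqrt (nn_cond_exp M F (\<lambda>y. ennreal ((cmod (u y))\<^sup>2)) x) *
        ennreal_sqrt (nn_cond_exp M F (\<lambda>y. ennreal ((cmod (w y))\<^sup>2)) x)))"
proof -
  interpret sigma_finite_subalgebra M F by fact
  note m [measurable] = assms(4,5)[THEN cond_exp_domain_measurable]
  obtain S \<kappa> v e where S: "S \<in> sets F" and k: "ess_bounded M F (\<lambda>x. complex_of_real (\<kappa> x))"
    and k0': "\<forall>x. 0 \<le> \<kappa> x" and kS': "\<forall>x\<in>S. 0 < \<kappa> x" and kout': "\<forall>x. x \<notin> S \<longrightarrow> \<kappa> x = 0"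
    and v: "cond_unit M F S v" and e: "cond_unit M F S e"
    and op: "weighted_cond_op M F w u = cond_op M F (\<lambda>x. complex_of_real (\<kappa> x)) v e"
    and uw: "AE x in M. complex_cond_exp M F (\<lambda>y. u y * w y) x =
      of_real (\<kappa> x) * complex_cond_exp M F (\<lambda>y. cnj (e y) * v y) x"
    and sq: "AE x in M. ennreal_sqrt (nn_cond_exp M F (\<lambda>y. ennreal ((cmod (u y))\<^sup>2)) x) *
      ennreal_sqrt (nn_cond_exp M F (\<lambda>y. ennreal ((cmod (w y))\<^sup>2)) x) = ennreal (\<kappa> x)"
    using weighted_cond_op_normal_form[OF m(1) m(2) assms(6)] .
  have k0: "0 \<le> \<kappa> x" for x using k0' by simp
  have kS: "0 < \<kappa> x" if "x \<in> S" for x using kS' that by simp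
  have kout: "\<kappa> x = 0" if "x \<notin> S" for x using kout' that by simp
  let ?T = "cond_op M F (\<lambda>x. complex_of_real (\<kappa> x)) v e"
  let ?kc = "\<lambda>x. complex_of_real (\<kappa> x) * complex_cond_exp M F (\<lambda>y. cnj (e y) * v y) x"
  have kc: "ess_bounded M F ?kc" by (rule ess_bounded_mult[OF k cond_unit_inner_ess_bounded[OF e v]])
  have "aluthge (L2 M) ?T = cond_op M F ?kc e e"
    by (intro cond_op_aluthge[OF S k k0 _ v e] kS)
  then have "normaloid (L2 M) (aluthge (L2 M) ?T)"
    using normaloid_cond_op_diagonal[OF S kc e] by simp
  moreover have "esssup M (\<lambda>x. ennreal (cmod (complex_cond_exp M F (\<lambda>y. u y * w y) x))) =
      ennreal (op_norm (L2 M) (cond_op M F ?kc v e))"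
  proof (rule esssup_eq_cond_op_norm[OF S kc v e])
    show "AE x in M. ennreal (cmod (complex_cond_exp M F (\<lambda>y. u y * w y) x)) =
        ennreal (cmod (?kc x)) * indicator S x"
      using uw by eventually_elim (auto simp: kout indicator_def)
  qed measurable
  moreover have "esssup M (\<lambda>x.
        ennreal_sqrt (nn_cond_exp M F (\<lambda>y. ennreal ((cmod (u y))\<^sup>2)) x) *
        ennreal_sqrt (nn_cond_exp M F (\<lambda>y. ennreal ((cmod (w y))\<^sup>2)) x)) =
      ennreal (op_norm (L2 M) ?T)"
  proof (rule esssup_eq_cond_op_norm[OF S k v e])
    show "AE x in M. ennreal_sqrt (nn_cond_exp M F (\<lambda>y. ennreal ((cmod (u y))\<^sup>2)) x) *
        ennreal_sqrt (nn_cond_exp M F (\<lambda>y. ennreal ((cmod (w y))\<^sup>2)) x) =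
        ennreal (cmod (complex_of_real (\<kappa> x))) * indicator S x"
      using sq by eventually_elim (auto simp: kout k0 indicator_def)
  qed measurable
  moreover have "normaloid (L2 M) ?T \<longleftrightarrow>
      op_norm (L2 M) (cond_op M F ?kc v e) = op_norm (L2 M) ?T"
    by (rule normaloid_cond_op_iff[OF S k v e])
  ultimately show ?thesis
    unfolding op using L2.op_norm_nonneg[OF cond_op_bounded[OF kc v e]] L2.op_norm_nonneg[OF cond_op_bounded[OF k v e]]
    by simp
qed

end
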